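(* Let $\varphi\colon \mathbb{P}^3 \dashrightarrow \mathbb{P}^3$ be a birational map of complex projective space whose four components are monomials of the same positive degree $d$ with no common factor, and let $d'$ be the common degree of the monomials (also taken without common factor) defining the inverse $\varphi^{-1}$. Let $f$ be the sum of the four monomials defining $\varphi$, let $D=V(f)\subset\mathbb{P}^3$, and let $k_i$ ($0\le i\le 3$) and $\ell_{i,j}$ ($0\le i<j\le 3$) be the integers associated to $D$ as defined in the context. Then $$\sum_{0\leq i \leq 3} k_i -\sum_{0\leq i < j \leq 3} \ell_{i,j} \leq 3d+1,$$ and hence $$d'\leq d^2-d+1.$$ Moreover, up to permutation of variables or coordinates, equality (in either inequality) is attained only for the map $$\varphi_{3,d}(x_0:x_1:x_2:x_3)=(x_0^d:x_0^{d-1}x_1:x_1^{d-1}x_2:x_2^{d-1}x_3).$$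
   Context: Work over $\mathbb{C}$, with homogeneous coordinates $x_0,\dots,x_3$ on $\mathbb{P}^3$. The map is $\varphi(x)=(x^{a_0}:x^{a_1}:x^{a_2}:x^{a_3})$, where $a_i=(a_{i0},\dots,a_{i3})$ is a vector of non-negative integers with $\sum_j a_{ij}=d$ and $x^{a_i}=x_0^{a_{i0}}x_1^{a_{i1}}x_2^{a_{i2}}x_3^{a_{i3}}$; the four monomials have no common factor. It is a known fact that the inverse of such a birational map is again defined by monomials of a common degree; $d'$ denotes this degree once common factors are removed. Put $f=\sum_{i=0}^3 x^{a_i}\in\mathbb{C}[x_0,\dots,x_3]$, $D=V(f)\subset\mathbb{P}^3$, and let $H_i=V(x_i)\subset\mathbb{P}^3$ be the coordinate planes. - $k_i:=\deg (D\cap H_i)_{\mathrm{red}}$ is the degree of the support (reduced structure) of the plane curve $D\cap H_i$. - $\ell_{i,j}:=1$ if $D$ contains the line $H_i\cap H_j$, and $\ell_{i,j}:=0$ otherwise. "Up to permutation of variables or coordinates" means up to permuting the variables $x_0,\dots,x_3$ of the source and/or permuting the four component monomials of the map. *)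

theory Defs
  imports "HOL-Analysis.Analysis" "HOL-Library.Poly_Mapping" "HOL-Library.Numeral_Type"
begin

text \<open>The index type \<open>4\<close> has the elements \<open>0 < 1 < 2 < 3\<close>, but its arithmetic is modulo 4.
  An element of \<open>poly4\<close> maps the exponent vector of each monomial to its coefficient.\<close>

type_synonym poly4 = "(4 \<Rightarrow>\<^sub>0 nat) \<Rightarrow>\<^sub>0 complex"

definition X :: "4 \<Rightarrow> poly4" where
  "X i = Poly_Mapping.single (Poly_Mapping.single i 1) 1"

definition homogeneous :: "nat \<Rightarrow> poly4 \<Rightarrow> bool" where
  "homogeneous e p \<longleftrightarrow> (\<forall>m\<in>Poly_Mapping.keys p. (\<Sum>i\<in>UNIV. Poly_Mapping.lookup m i) = e)"

definition eval_poly :: "poly4 \<Rightarrow> complex ^ 4 \<Rightarrow> complex" where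
  "eval_poly p x = (\<Sum>m\<in>Poly_Mapping.keys p.
     Poly_Mapping.lookup p m * (\<Prod>i\<in>UNIV. (x $ i) ^ Poly_Mapping.lookup m i))"

definition subst_poly :: "poly4 \<Rightarrow> (4 \<Rightarrow> poly4) \<Rightarrow> poly4" where
  "subst_poly p F = (\<Sum>m\<in>Poly_Mapping.keys p.
     Poly_Mapping.single 0 (Poly_Mapping.lookup p m) * (\<Prod>i\<in>UNIV. F i ^ Poly_Mapping.lookup m i))"


subsection \<open>Rational self-maps of projective 3-space\<close>

text \<open>A rational map is represented by four forms of the same degree, not all zero; two such
  tuples represent the same map iff they are proportional over the function field, that is, iff
  all 2-by-2 minors vanish.\<close>

definition rational_map :: "(4 \<Rightarrow> poly4) \<Rightarrow> bool" where
  "rational_map F \<longleftrightarrow> (\<exists>e. \<forall>i. homogeneous e (F i)) \<and> (\<exists>i. F i \<noteq> 0)"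

definition same_map :: "(4 \<Rightarrow> poly4) \<Rightarrow> (4 \<Rightarrow> poly4) \<Rightarrow> bool" where
  "same_map F G \<longleftrightarrow> (\<forall>i j. F i * G j = F j * G i)"

definition comp_map :: "(4 \<Rightarrow> poly4) \<Rightarrow> (4 \<Rightarrow> poly4) \<Rightarrow> 4 \<Rightarrow> poly4" where
  "comp_map G F = (\<lambda>i. subst_poly (G i) F)"

text \<open>The tuple \<open>X\<close> represents the identity map. Requiring \<open>rational_map (comp_map G F)\<close> says that
  the composite is defined, i.e. that the image of \<open>F\<close> is not in the base locus of \<open>G\<close>.\<close>

definition inverse_maps :: "(4 \<Rightarrow> poly4) \<Rightarrow> (4 \<Rightarrow> poly4) \<Rightarrow> bool" where
  "inverse_maps G F \<longleftrightarrow> rational_map F \<and> rational_map G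
     \<and> rational_map (comp_map G F) \<and> same_map (comp_map G F) X
     \<and> rational_map (comp_map F G) \<and> same_map (comp_map F G) X"

definition birational :: "(4 \<Rightarrow> poly4) \<Rightarrow> bool" where
  "birational F \<longleftrightarrow> (\<exists>G. inverse_maps G F)"

definition no_common_factor :: "(4 \<Rightarrow> poly4) \<Rightarrow> bool" where
  "no_common_factor F \<longleftrightarrow> (\<forall>p. (\<forall>i. p dvd F i) \<longrightarrow> p dvd 1)"

definition monomial_map :: "(4 \<Rightarrow> 4 \<Rightarrow> nat) \<Rightarrow> 4 \<Rightarrow> poly4" where
  "monomial_map a = (\<lambda>i. \<Prod>j\<in>UNIV. X j ^ a i j)"

text \<open>Used only for birational monomial maps, where the inverse is again monomial and its tuple
  without common factor is unique.\<close>

definition inverse_degree :: "(4 \<Rightarrow> 4 \<Rightarrow> nat) \<Rightarrow> nat" where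
  "inverse_degree a = (THE e. \<exists>b. (\<forall>i. (\<Sum>j\<in>UNIV. b i j) = e)
     \<and> no_common_factor (monomial_map b) \<and> inverse_maps (monomial_map b) (monomial_map a))"


subsection \<open>The integers attached to a surface\<close>

definition ideal2 :: "poly4 \<Rightarrow> poly4 \<Rightarrow> poly4 set" where
  "ideal2 p q = {r * p + s * q | r s. True}"

definition radical :: "poly4 set \<Rightarrow> poly4 set" where
  "radical I = {p. \<exists>n. p ^ n \<in> I}"

text \<open>A curve in the plane \<open>V(X i)\<close> is cut out there by a single form, unique modulo \<open>X i\<close> up to a
  nonzero scalar; its degree is the degree of that form. The argument \<open>I\<close> is the homogeneous ideal
  of the curve in projective 3-space.\<close>

definition plane_curve_degree :: "4 \<Rightarrow> poly4 set \<Rightarrow> nat" where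
  "plane_curve_degree i I = (THE k. \<exists>g. homogeneous k g \<and> I = ideal2 (X i) g)"

text \<open>The scheme \<open>V(f) \<inter> V(X i)\<close> has the ideal \<open>(f, X i)\<close>, and its reduced structure is given by
  the radical of this ideal.\<close>

definition k_num :: "poly4 \<Rightarrow> 4 \<Rightarrow> nat" where
  "k_num f i = plane_curve_degree i (radical (ideal2 f (X i)))"

text \<open>Points of projective space are given by their nonzero vectors of homogeneous coordinates.\<close>

definition V :: "poly4 \<Rightarrow> (complex ^ 4) set" where
  "V p = {x. x \<noteq> 0 \<and> eval_poly p x = 0}"

definition l_num :: "poly4 \<Rightarrow> 4 \<Rightarrow> 4 \<Rightarrow> nat" where
  "l_num f i j = (if V (X i) \<inter> V (X j) \<subseteq> V f then 1 else 0)"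


subsection \<open>The extremal map\<close>

text \<open>The exponent matrix of
  \<open>(x\<^sub>0\<^sup>d : x\<^sub>0\<^sup>d\<^sup>-\<^sup>1 x\<^sub>1 : x\<^sub>1\<^sup>d\<^sup>-\<^sup>1 x\<^sub>2 : x\<^sub>2\<^sup>d\<^sup>-\<^sup>1 x\<^sub>3)\<close>.\<close>

definition phi3 :: "nat \<Rightarrow> 4 \<Rightarrow> 4 \<Rightarrow> nat" where
  "phi3 d i j = (if i = 0 then (if j = 0 then d else 0)
     else if j = i - 1 then d - 1 else if j = i then 1 else 0)"

definition equal_up_to_permutation :: "(4 \<Rightarrow> 4 \<Rightarrow> nat) \<Rightarrow> (4 \<Rightarrow> 4 \<Rightarrow> nat) \<Rightarrow> bool" where
  "equal_up_to_permutation a b \<longleftrightarrow>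
     (\<exists>\<sigma> \<tau>. bij \<sigma> \<and> bij \<tau> \<and> (\<forall>i j. a (\<sigma> i) (\<tau> j) = b i j))"

end

theory Submission
  imports Defs
begin

text \<open>
  A monomial map is a matrix \<open>a\<close> of exponents with constant row sums \<open>d\<close>. A birational one has a monomial inverse:
  there is a matrix \<open>b\<close> of natural numbers, with row sums \<open>d'\<close>, such that \<open>a b\<close> and \<open>b a\<close> agree with
  the identity up to a constant in each column (locale \<open>inverse_pair\<close>). Everything in the theorem can be read off from
  \<open>a\<close> and \<open>b\<close>.

  The section of the surface by the plane \<open>X i = 0\<close> is the sum of the monomials with exponent zero at \<open>i\<close>, a common
  monomial times a rest. The inverse map turns the rest into a plane up to monomial factors, so the rest is reduced, and
  the support only forgets multiplicities in the common monomial (\<open>k_num_eq\<close>). A line of two coordinate planes lies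
  on the surface iff no row of \<open>a\<close> vanishes in both columns (\<open>l_num_eq\<close>). Hence \<open>K - L\<close> is \<open>4 * d\<close> minus a
  number \<open>defect a\<close> that depends only on the matrix, and the first inequality says \<open>defect a \<ge> d - 1\<close>.

  The proof shows a gap: the extremal map has defect \<open>d - 1\<close> and inverse degree \<open>d\<^sup>2 - d + 1\<close>
  (\<open>phi3_values\<close>), and any other map has \<open>defect a \<ge> d\<close> and \<open>d' \<le> d\<^sup>2 - d\<close> (\<open>dichotomy\<close>). This gives both
  inequalities and both descriptions of equality.

  If some column of \<open>a\<close> has a single zero, the row sum of that row already accounts for \<open>d\<close> in the defect, and
  the bound on \<open>d'\<close> is a Bezout bound (\<open>degree_bound\<close>): the preimage of a line lies on surfaces of degrees \<open>d\<close> and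
  \<open>d - 1\<close>. It is proved by comparing Hilbert functions. If all columns have at least two zeros, the
  matrix is sparse. Its determinant is \<open>\<plusminus>d\<close> (\<open>det_labels\<close>), which excludes most patterns; those that remain
  are the extremal map, one pattern with a pure power \<open>X i ^ d\<close> among the monomials, and one whose nonzero
  entries form a cycle of length eight. In the last two, \<open>b\<close> can be computed with Cramer's rule.
\<close>

abbreviation lk :: "('a \<Rightarrow>\<^sub>0 'b::zero) \<Rightarrow> 'a \<Rightarrow> 'b" where "lk \<equiv> Poly_Mapping.lookup"
abbreviation sg :: "'a \<Rightarrow> 'b \<Rightarrow> 'a \<Rightarrow>\<^sub>0 'b::zero" where "sg \<equiv> Poly_Mapping.single"

section \<open>Substitution homomorphisms\<close>

lemma poly_mapping_sum_single:
  "(p :: 'a \<Rightarrow>\<^sub>0 'b::comm_monoid_add) = (\<Sum>m\<in>Poly_Mapping.keys p. sg m (lk p m))"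
proof (rule poly_mapping_eqI)
  fix k
  have "(\<Sum>m\<in>Poly_Mapping.keys p. lk (sg m (lk p m)) k)
      = (\<Sum>m\<in>Poly_Mapping.keys p. if m = k then lk p m else 0)"
    by (rule sum.cong) (auto simp: lookup_single when_def)
  then show "lk p k = lk (\<Sum>m\<in>Poly_Mapping.keys p. sg m (lk p m)) k"
    by (simp add: lookup_sum in_keys_iff)
qed

lemma mult_sum_single:
  fixes p q :: "'a::monoid_add \<Rightarrow>\<^sub>0 'b::semiring_0"
  shows "p * q = (\<Sum>m\<in>Poly_Mapping.keys p. \<Sum>n\<in>Poly_Mapping.keys q. sg (m + n) (lk p m * lk q n))"
proof -
  have "p * q = (\<Sum>m\<in>Poly_Mapping.keys p. sg m (lk p m)) * (\<Sum>n\<in>Poly_Mapping.keys q. sg n (lk q n))"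
    using poly_mapping_sum_single[of p] poly_mapping_sum_single[of q] by simp
  then show ?thesis
    by (simp add: sum_product mult_single)
qed

text \<open>Polynomials are evaluated in three rings: in the polynomial ring itself, in the complex numbers
  and in polynomials in two variables. The map \<open>\<kappa>\<close> embeds the constants.\<close>

locale coeff_hom =
  fixes \<kappa> :: "complex \<Rightarrow> 'r::comm_ring_1"
  assumes hom_add: "\<kappa> (a + b) = \<kappa> a + \<kappa> b"
    and hom_mult: "\<kappa> (a * b) = \<kappa> a * \<kappa> b"
    and hom_1: "\<kappa> 1 = 1"
begin

lemma hom_0: "\<kappa> 0 = 0"
  using hom_add[of 0 0] by simp

definition ins :: "(4 \<Rightarrow> 'r) \<Rightarrow> poly4 \<Rightarrow> 'r" where
  "ins F p = (\<Sum>m\<in>Poly_Mapping.keys p. \<kappa> (lk p m) * (\<Prod>i\<in>UNIV. F i ^ lk m i))"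

lemma ins_superset:
  "finite A \<Longrightarrow> Poly_Mapping.keys p \<subseteq> A \<Longrightarrow> ins F p = (\<Sum>m\<in>A. \<kappa> (lk p m) * (\<Prod>i\<in>UNIV. F i ^ lk m i))"
  unfolding ins_def by (rule sum.mono_neutral_left) (auto simp: in_keys_iff hom_0)

lemma ins_add: "ins F (p + q) = ins F p + ins F q"
proof -
  let ?A = "Poly_Mapping.keys p \<union> Poly_Mapping.keys q"
  have "ins F r = (\<Sum>m\<in>?A. \<kappa> (lk r m) * (\<Prod>i\<in>UNIV. F i ^ lk m i))"
    if "Poly_Mapping.keys r \<subseteq> ?A" for r
    using that by (intro ins_superset) auto
  from this[of p] this[of q] this[of "p + q"] show ?thesis
    using keys_add[of p q] by (simp add: lookup_add hom_add algebra_simps sum.distrib)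
qed

lemma ins_0: "ins F 0 = 0"
  by (simp add: ins_def)

lemma ins_sum: "ins F (sum g A) = (\<Sum>x\<in>A. ins F (g x))"
  by (induction A rule: infinite_finite_induct) (auto simp: ins_0 ins_add)

lemma ins_single: "ins F (sg m c) = \<kappa> c * (\<Prod>i\<in>UNIV. F i ^ lk m i)"
  by (subst ins_superset[of "{m}"]) auto

lemma ins_mult: "ins F (p * q) = ins F p * ins F q"
proof -
  have "ins F (p * q) = (\<Sum>m\<in>Poly_Mapping.keys p. \<Sum>n\<in>Poly_Mapping.keys q.
     (\<kappa> (lk p m) * (\<Prod>i\<in>UNIV. F i ^ lk m i)) * (\<kappa> (lk q n) * (\<Prod>i\<in>UNIV. F i ^ lk n i)))"
    unfolding mult_sum_single[of p q] ins_sum ins_single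
    by (simp add: hom_mult lookup_add power_add prod.distrib ac_simps)
  then show ?thesis
    by (simp add: ins_def sum_product)
qed

lemma ins_const: "ins F (sg 0 c) = \<kappa> c"
  by (simp add: ins_single)

lemma ins_1: "ins F 1 = 1"
  using ins_const[of F 1] by (simp add: hom_1)

lemma ins_uminus: "ins F (- p) = - ins F p"
  using ins_add[of F p "- p"] by (simp add: ins_0 add_eq_0_iff)

lemma ins_diff: "ins F (p - q) = ins F p - ins F q"
  using ins_add[of F p "- q"] by (simp add: ins_uminus)

lemma ins_power: "ins F (p ^ n) = ins F p ^ n"
  by (induction n) (auto simp: ins_1 ins_mult)

lemma ins_prod: "ins F (prod g A) = (\<Prod>x\<in>A. ins F (g x))"
  by (induction A rule: infinite_finite_induct) (auto simp: ins_1 ins_mult)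

lemma ins_X: "ins F (X i) = F i"
proof -
  have "(\<Prod>j\<in>UNIV. F j ^ lk (sg i 1) j) = (\<Prod>j\<in>UNIV. if j = i then F j else 1)"
    by (rule prod.cong) (auto simp: lookup_single when_def)
  then show ?thesis by (simp add: X_def ins_single hom_1)
qed

lemmas ins_simps = ins_add ins_mult ins_0 ins_1 ins_uminus ins_diff ins_power ins_sum ins_prod ins_X ins_const

lemma ins_dvd: "p dvd q \<Longrightarrow> ins F p dvd ins F q"
  by (auto simp: dvd_def ins_mult)

lemma ins_subst: "ins F (subst_poly p G) = ins (\<lambda>i. ins F (G i)) p"
  unfolding subst_poly_def ins_sum by (simp add: ins_simps ins_def[of _ p])

text \<open>Two substitutions that agree modulo \<open>r\<close> have results that agree modulo \<open>r\<close>. This is how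
  divisibility by a linear form is proved: one variable is eliminated.\<close>

lemma ins_cong_mod:
  assumes "\<And>i. r dvd F i - G i"
  shows "r dvd ins F p - ins G p"
proof -
  have mult: "r dvd a * c - b * d" if "r dvd a - b" "r dvd c - d" for a b c d :: 'r
  proof -
    have "a * c - b * d = (a - b) * c + b * (c - d)" by (simp add: algebra_simps)
    then show ?thesis using that by simp
  qed
  have pow: "r dvd F i ^ n - G i ^ n" for i n
    by (induction n) (auto intro: mult assms)
  have "r dvd (\<Prod>i\<in>A. F i ^ f i) - (\<Prod>i\<in>A. G i ^ f i)" for A and f :: "4 \<Rightarrow> nat"
    by (induction A rule: infinite_finite_induct) (auto intro: mult pow)
  then show ?thesis
    unfolding ins_def sum_subtractf[symmetric] right_diff_distrib[symmetric]
    by (intro dvd_sum dvd_mult)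
qed

end

interpretation subst: coeff_hom "sg 0 :: complex \<Rightarrow> poly4"
  rewrites "coeff_hom.ins (sg 0 :: complex \<Rightarrow> poly4) = (\<lambda>F p. subst_poly p F)"
proof -
  show *: "coeff_hom (sg 0 :: complex \<Rightarrow> poly4)"
    by unfold_locales (auto simp: single_add mult_single)
  show "coeff_hom.ins (sg 0) = (\<lambda>F p. subst_poly p F)"
    by (simp add: fun_eq_iff coeff_hom.ins_def[OF *] subst_poly_def)
qed

interpretation eval: coeff_hom "\<lambda>c::complex. c"
  by unfold_locales auto

lemma eval_poly_eq: "eval_poly p x = eval.ins (($) x) p"
  by (simp add: eval_poly_def eval.ins_def)

lemma subst_X [simp]: "subst_poly p X = p"
proof -
  have "(\<Prod>i\<in>A. X i ^ f i) = sg (\<Sum>i\<in>A. sg i (f i)) 1" for A :: "4 set" and f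
  proof (induction A rule: infinite_finite_induct)
    case (insert x F)
    have "X x ^ n = sg (sg x n) 1" for n
      by (induction n) (auto simp: X_def mult_single simp flip: single_add)
    then show ?case using insert by (simp add: mult_single)
  qed auto
  moreover have "(\<Sum>i\<in>UNIV. sg i (lk m i)) = m" for m :: "4 \<Rightarrow>\<^sub>0 nat"
  proof (rule poly_mapping_eqI)
    fix k
    have "(\<Sum>i\<in>UNIV. lk (sg i (lk m i)) k) = (\<Sum>i\<in>UNIV. if i = k then lk m i else 0)"
      by (rule sum.cong) (auto simp: lookup_single when_def)
    then show "lk (\<Sum>i\<in>UNIV. sg i (lk m i)) k = lk m k" by (simp add: lookup_sum)
  qed
  ultimately have "subst_poly p X = (\<Sum>m\<in>Poly_Mapping.keys p. sg m (lk p m))"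
    by (simp add: subst_poly_def mult_single)
  then show ?thesis using poly_mapping_sum_single[of p] by simp
qed

section \<open>Monomials\<close>

definition expv :: "(4 \<Rightarrow> nat) \<Rightarrow> 4 \<Rightarrow>\<^sub>0 nat" where
  "expv f = Abs_poly_mapping f"

lemma lookup_expv [simp]: "lk (expv f) = f"
  by (simp add: expv_def Abs_poly_mapping_inverse)

lemma expv_lookup [simp]: "expv (lk m) = m"
  by (simp add: expv_def lookup_inverse)

lemma expv_eq_iff [simp]: "expv f = expv g \<longleftrightarrow> f = g"
  by (metis lookup_expv)

lemma eq_expv_iff: "m = expv f \<longleftrightarrow> lk m = f"
  by (metis lookup_expv expv_lookup)

lemma expv_add: "expv f + expv g = expv (\<lambda>i. f i + g i)"
  by (simp add: eq_expv_iff fun_eq_iff lookup_add)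

lemma expv_0: "expv (\<lambda>_. 0) = 0"
  by (metis expv_lookup lookup_zero ext)

definition mon :: "(4 \<Rightarrow> nat) \<Rightarrow> poly4" where
  "mon f = sg (expv f) 1"

lemma mon_mult: "mon f * mon g = mon (\<lambda>i. f i + g i)"
  by (simp add: mon_def mult_single expv_add)

lemma mon_0: "mon (\<lambda>_. 0) = 1"
  by (simp add: mon_def expv_0)

lemma mon_power: "mon f ^ n = mon (\<lambda>i. n * f i)"
  by (induction n) (auto simp: mon_0 mon_mult)

lemma mon_prod: "(\<Prod>x\<in>A. mon (f x)) = mon (\<lambda>i. \<Sum>x\<in>A. f x i)"
  by (induction A rule: infinite_finite_induct) (auto simp: mon_0 mon_mult)

lemma X_eq_mon: "X i = mon (\<lambda>j. if j = i then 1 else 0)"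
proof -
  have "sg i 1 = expv (\<lambda>j. if j = i then 1 else 0)"
    by (auto simp: eq_expv_iff fun_eq_iff lookup_single when_def)
  then show ?thesis by (simp add: X_def mon_def)
qed

lemma monomial_map_eq: "monomial_map a i = mon (a i)"
proof -
  have "(\<Sum>x\<in>UNIV. a i x * (if j = x then 1 else 0)) = a i j" for j
  proof -
    have "(\<Sum>x\<in>UNIV. a i x * (if j = x then 1 else 0)) = (\<Sum>x\<in>UNIV. if j = x then a i x else 0)"
      by (rule sum.cong) auto
    then show ?thesis by simp
  qed
  then show ?thesis
    by (simp add: monomial_map_def X_eq_mon mon_power mon_prod)
qed

lemma mon_nz [simp]: "mon f \<noteq> 0"
  by (metis mon_def lookup_single_eq lookup_zero zero_neq_one)

lemma mon_eq_iff [simp]: "mon f = mon g \<longleftrightarrow> f = g"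
proof
  assume "mon f = mon g"
  then have "lk (mon f) (expv f) = lk (mon g) (expv f)" by simp
  then show "f = g" by (auto simp: mon_def lookup_single when_def split: if_splits)
qed auto

lemma keys_mon [simp]: "Poly_Mapping.keys (mon f) = {expv f}"
  by (simp add: mon_def)

lemma lookup_mon: "lk (mon f) m = (if m = expv f then 1 else 0)"
  by (auto simp: mon_def lookup_single when_def)

lemma subst_mon: "subst_poly (mon f) (\<lambda>i. mon (a i)) = mon (\<lambda>j. \<Sum>i\<in>UNIV. f i * a i j)"
  unfolding mon_def[of f] subst.ins_single by (simp add: mon_power mon_prod)

lemma X_nz [simp]: "X i \<noteq> 0"
  by (simp add: X_eq_mon)

lemma mon_dvd: "(\<And>i. f i \<le> g i) \<Longrightarrow> mon f dvd mon g"
  by (rule dvdI[of _ _ "mon (\<lambda>i. g i - f i)"]) (simp add: mon_mult)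

lemma mon_eq_prod: "mon f = (\<Prod>j\<in>UNIV. X j ^ f j)"
  using monomial_map_eq[of "\<lambda>_. f" 0] by (simp add: monomial_map_def)

lemma homogeneous_mon: "homogeneous (\<Sum>i\<in>UNIV. f i) (mon f)"
  by (simp add: homogeneous_def)

lemma homogeneous_sum: "(\<And>x. x \<in> A \<Longrightarrow> homogeneous e (g x)) \<Longrightarrow> homogeneous e (sum g A)"
  unfolding homogeneous_def
proof
  fix m assume *: "\<And>x. x \<in> A \<Longrightarrow> \<forall>m\<in>Poly_Mapping.keys (g x). (\<Sum>i\<in>UNIV. lk m i) = e"
    and m: "m \<in> Poly_Mapping.keys (sum g A)"
  from m have "(\<Sum>x\<in>A. lk (g x) m) \<noteq> 0" by (simp add: in_keys_iff lookup_sum)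
  then obtain x where "x \<in> A" "lk (g x) m \<noteq> 0" by (meson sum.not_neutral_contains_not_neutral)
  then show "(\<Sum>i\<in>UNIV. lk m i) = e" using * by (auto simp: in_keys_iff)
qed

lemma homogeneous_mult: "homogeneous d p \<Longrightarrow> homogeneous e q \<Longrightarrow> homogeneous (d + e) (p * q)"
  unfolding homogeneous_def
proof
  fix m assume p: "\<forall>m\<in>Poly_Mapping.keys p. (\<Sum>i\<in>UNIV. lk m i) = d"
    and q: "\<forall>m\<in>Poly_Mapping.keys q. (\<Sum>i\<in>UNIV. lk m i) = e"
    and m: "m \<in> Poly_Mapping.keys (p * q)"
  then obtain u v where "m = u + v" "u \<in> Poly_Mapping.keys p" "v \<in> Poly_Mapping.keys q"
    using keys_mult[of p q] by blast
  then show "(\<Sum>i\<in>UNIV. lk m i) = d + e" using p q by (simp add: lookup_add sum.distrib)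
qed

text \<open>A sum of monomials has no cancellation, because the coefficients count the summands.\<close>

lemma lookup_sum_mon:
  "finite A \<Longrightarrow> lk (\<Sum>r\<in>A. mon (f r)) m = of_nat (card {r \<in> A. m = expv (f r)})"
  by (simp add: lookup_sum lookup_mon flip: sum.inter_filter)

lemma keys_sum_mon: "finite A \<Longrightarrow> Poly_Mapping.keys (\<Sum>r\<in>A. mon (f r)) = (\<lambda>r. expv (f r)) ` A"
  by (auto simp: in_keys_iff lookup_sum_mon)

section \<open>Leading monomials and divisibility by variables\<close>

text \<open>A monomial of a product can cancel only if it arises in two ways, and a sum of two extreme
  exponent vectors arises in one way only.\<close>

lemma lookup_mult_extremal:
  fixes p q :: "'a::monoid_add \<Rightarrow>\<^sub>0 'b::semiring_0"
  assumes "u \<in> Poly_Mapping.keys p" "v \<in> Poly_Mapping.keys q"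
    and "\<And>m n. m \<in> Poly_Mapping.keys p \<Longrightarrow> n \<in> Poly_Mapping.keys q \<Longrightarrow> m + n = u + v \<Longrightarrow> m = u \<and> n = v"
  shows "lk (p * q) (u + v) = lk p u * lk q v"
proof -
  have "lk (p * q) (u + v) = (\<Sum>m\<in>Poly_Mapping.keys p. \<Sum>n\<in>Poly_Mapping.keys q.
      lk (sg (m + n) (lk p m * lk q n)) (u + v))"
    by (subst mult_sum_single) (simp add: lookup_sum)
  also have "\<dots> = (\<Sum>m\<in>Poly_Mapping.keys p. \<Sum>n\<in>Poly_Mapping.keys q.
      if m = u then if n = v then lk p m * lk q n else 0 else 0)"
    using assms(3) by (intro sum.cong refl) (auto simp: lookup_single when_def)
  also have "\<dots> = (\<Sum>m\<in>Poly_Mapping.keys p. if m = u then \<Sum>n\<in>Poly_Mapping.keys q.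
      if n = v then lk p m * lk q n else 0 else 0)"
    by (intro sum.cong) auto
  finally show ?thesis using assms(1,2) by simp
qed

lemma add_eq_extremal:
  fixes a b u v :: "'a::{ordered_cancel_comm_monoid_add, linorder}"
  assumes "a + b = u + v" "a \<le> u" "b \<le> v"
  shows "a = u \<and> b = v"
proof -
  have "\<not> a < u"
  proof
    assume "a < u"
    then have "a + b < u + b" by (rule add_strict_right_mono)
    also have "\<dots> \<le> u + v" using assms(3) by (rule add_left_mono)
    finally show False using assms(1) by simp
  qed
  then have "a = u" using assms by auto
  then show ?thesis using assms by simp
qed

lemma Max_keys_mult:
  fixes p q :: poly4
  assumes "p \<noteq> 0" "q \<noteq> 0"
  shows "Max (Poly_Mapping.keys p) + Max (Poly_Mapping.keys q) \<in> Poly_Mapping.keys (p * q)"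
proof -
  let ?u = "Max (Poly_Mapping.keys p)" and ?v = "Max (Poly_Mapping.keys q)"
  have u: "?u \<in> Poly_Mapping.keys p" and v: "?v \<in> Poly_Mapping.keys q"
    using assms by (auto intro!: Max_in)
  have "lk (p * q) (?u + ?v) = lk p ?u * lk q ?v"
  proof (rule lookup_mult_extremal[OF u v])
    fix m n assume mn: "m \<in> Poly_Mapping.keys p" "n \<in> Poly_Mapping.keys q" "m + n = ?u + ?v"
    then have "m \<le> ?u" "n \<le> ?v" by auto
    then show "m = ?u \<and> n = ?v"
      using mn(3) by (intro add_eq_extremal)
  qed
  then show ?thesis using u v by (simp add: in_keys_iff)
qed

lemma Min_keys_mult:
  fixes p q :: poly4
  assumes "p \<noteq> 0" "q \<noteq> 0"
  shows "Min (Poly_Mapping.keys p) + Min (Poly_Mapping.keys q) \<in> Poly_Mapping.keys (p * q)"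
proof -
  let ?u = "Min (Poly_Mapping.keys p)" and ?v = "Min (Poly_Mapping.keys q)"
  have u: "?u \<in> Poly_Mapping.keys p" and v: "?v \<in> Poly_Mapping.keys q"
    using assms by (auto intro!: Min_in)
  have "lk (p * q) (?u + ?v) = lk p ?u * lk q ?v"
  proof (rule lookup_mult_extremal[OF u v])
    fix m n assume mn: "m \<in> Poly_Mapping.keys p" "n \<in> Poly_Mapping.keys q" "m + n = ?u + ?v"
    then have "?u \<le> m" "?v \<le> n" by auto
    then show "m = ?u \<and> n = ?v"
      using mn(3) add_eq_extremal[of ?u ?v m n] by simp
  qed
  then show ?thesis using u v by (simp add: in_keys_iff)
qed

text \<open>The products of the largest and of the smallest monomials of a factor and its cofactor both
  survive in the product. If the product is a single monomial, then largest and smallest agree.\<close>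

lemma dvd_mon_is_monomial:
  assumes "p dvd mon f"
  obtains c g where "c \<noteq> 0" "p = sg (expv g) c" "\<And>i. g i \<le> f i"
proof -
  obtain q where q: "mon f = p * q" using assms by blast
  then have nz: "p \<noteq> 0" "q \<noteq> 0" by (auto dest: sym)
  define M N M' N' where "M = Max (Poly_Mapping.keys p)" "N = Min (Poly_Mapping.keys p)"
    "M' = Max (Poly_Mapping.keys q)" "N' = Min (Poly_Mapping.keys q)"
  note MN = this
  have in_keys: "M \<in> Poly_Mapping.keys p" "N \<in> Poly_Mapping.keys p"
      "M' \<in> Poly_Mapping.keys q" "N' \<in> Poly_Mapping.keys q"
    using nz by (auto simp: MN intro!: Max_in Min_in)
  have eq: "M + M' = expv f" "N + N' = expv f"
    using Max_keys_mult[OF nz] Min_keys_mult[OF nz] by (auto simp: MN simp flip: q)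
  have le: "N \<le> m \<and> m \<le> M" if "m \<in> Poly_Mapping.keys p" for m
    using that by (auto simp: MN)
  have "N \<le> M" "N' \<le> M'" using in_keys by (auto simp: MN)
  then have "N = M"
    using eq add_eq_extremal[of N N' M M'] by simp
  then have "Poly_Mapping.keys p = {M}" using le in_keys by fastforce
  then have p: "p = sg M (lk p M)" "lk p M \<noteq> 0"
    using poly_mapping_sum_single[of p] by (auto simp: in_keys_iff)
  have "lk M i \<le> f i" for i
    using arg_cong[OF eq(1), of "\<lambda>m. lk m i"] by (simp add: lookup_add)
  then show thesis using p by (intro that[of "lk p M" "lk M"]) auto
qed

lemma X_dvd_diff_subst: "X i dvd p - subst_poly p (X(i := 0))"
  using subst.ins_cong_mod[of "X i" X "X(i := 0)" p] by simp

text \<open>Setting \<open>X i\<close> to \<open>0\<close> is a homomorphism into a domain, so its kernel, the ideal of \<open>X i\<close>, is prime.\<close>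

lemma X_dvd_iff: "X i dvd p \<longleftrightarrow> subst_poly p (X(i := 0)) = 0"
proof
  assume "X i dvd p"
  then show "subst_poly p (X(i := 0)) = 0"
    using subst.ins_dvd[of "X i" p "X(i := 0)"] by (simp add: subst.ins_X)
qed (use X_dvd_diff_subst[of i p] in auto)

lemma X_dvd_mult: "X i dvd p * q \<Longrightarrow> X i dvd p \<or> X i dvd q"
  by (simp add: X_dvd_iff subst.ins_mult)

lemma X_dvd_power: "X i dvd p ^ n \<Longrightarrow> X i dvd p"
  by (simp add: X_dvd_iff subst.ins_power)

lemma X_not_unit: "\<not> X i dvd 1"
  by (simp add: X_dvd_iff subst.ins_1)

lemma X_dvd_keys: "X i dvd p \<Longrightarrow> m \<in> Poly_Mapping.keys p \<Longrightarrow> lk m i > 0"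
proof -
  assume "X i dvd p" and m: "m \<in> Poly_Mapping.keys p"
  then obtain q where "p = X i * q" by blast
  then have "m \<in> {u + v |u v. u \<in> Poly_Mapping.keys (X i) \<and> v \<in> Poly_Mapping.keys q}"
    using m keys_mult[of "X i" q] by blast
  then show "lk m i > 0" by (auto simp: X_def lookup_add)
qed

lemma lookup_subst_zero:
  "lk (subst_poly p (X(i := 0))) m = (if lk m i = 0 then lk p m else 0)"
proof -
  have "sg 0 (lk p n) * (\<Prod>j\<in>UNIV. (X(i := 0)) j ^ lk n j) = (if lk n i = 0 then sg n (lk p n) else 0)" for n
  proof (cases "lk n i = 0")
    case True
    have "(\<Prod>j\<in>UNIV. (X(i := 0)) j ^ lk n j) = mon (lk n)"
      unfolding mon_eq_prod by (rule prod.cong) (use True in auto)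
    then show ?thesis using True by (simp add: mon_def mult_single)
  next
    case False
    then have "(X(i := 0)) i ^ lk n i = 0" by simp
    then have "(\<Prod>j\<in>UNIV. (X(i := 0)) j ^ lk n j) = 0" by (intro prod_zero) auto
    then show ?thesis using False by (simp only: mult_zero_right if_False)
  qed
  then have "lk (subst_poly p (X(i := 0))) m = (\<Sum>n\<in>Poly_Mapping.keys p. if n = m then (if lk m i = 0 then lk p m else 0) else 0)"
    unfolding subst_poly_def lookup_sum by (intro sum.cong) (auto simp: lookup_single when_def)
  then show ?thesis by (simp add: in_keys_iff)
qed

text \<open>Variables are prime, so the monomial can be cancelled one variable at a time.\<close>

lemma cancel_mon_dvd:
  assumes "h dvd mon f * p" "\<And>i. f i > 0 \<Longrightarrow> \<not> X i dvd h"
  shows "h dvd p"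
proof -
  have pow: "h dvd y" if "h dvd X i ^ n * y" "n > 0 \<Longrightarrow> \<not> X i dvd h" for i n and y :: poly4
    using that
  proof (induction n)
    case (Suc n)
    then obtain s where s: "X i * (X i ^ n * y) = h * s" by (auto simp: dvd_def ac_simps)
    then have "X i dvd s" using X_dvd_mult[of i h s] Suc.prems(2) by (metis dvd_triv_left zero_less_Suc)
    then obtain s' where "s = X i * s'" by blast
    then have "X i ^ n * y = h * s'" using s by (simp add: ac_simps)
    then show ?case using Suc by auto
  qed auto
  have "h dvd (\<Prod>j\<in>A. X j ^ f j) * p \<Longrightarrow> h dvd p" if "finite A" for A
    using that
  proof (induction A)
    case (insert x F)
    then have "h dvd X x ^ f x * ((\<Prod>j\<in>F. X j ^ f j) * p)" by (simp add: ac_simps)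
    then have "h dvd (\<Prod>j\<in>F. X j ^ f j) * p" using pow assms(2) by blast
    then show ?case using insert by blast
  qed auto
  then show ?thesis using assms(1) by (simp add: mon_eq_prod)
qed

section \<open>Exponent matrices of birational monomial maps\<close>

definition delta :: "4 \<Rightarrow> 4 \<Rightarrow> nat" where
  "delta i j = (if i = j then 1 else 0)"

lemma sum_delta [simp]:
  fixes f :: "4 \<Rightarrow> 'a::comm_semiring_1"
  shows "(\<Sum>k\<in>UNIV. f k * of_nat (delta k j)) = f j" "(\<Sum>k\<in>UNIV. f k * of_nat (delta j k)) = f j"
    "(\<Sum>k\<in>UNIV. of_nat (delta k j) * f k) = f j" "(\<Sum>k\<in>UNIV. of_nat (delta j k) * f k) = f j"
proof -
  have "(\<Sum>k\<in>UNIV. f k * of_nat (delta k j)) = (\<Sum>k\<in>UNIV. if k = j then f k else 0)"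
    by (rule sum.cong) (auto simp: delta_def)
  then show "(\<Sum>k\<in>UNIV. f k * of_nat (delta k j)) = f j" by simp
  then show "(\<Sum>k\<in>UNIV. f k * of_nat (delta j k)) = f j"
    "(\<Sum>k\<in>UNIV. of_nat (delta k j) * f k) = f j" "(\<Sum>k\<in>UNIV. of_nat (delta j k) * f k) = f j"
    by (simp_all add: delta_def eq_commute mult.commute[of _ "f _"])
qed

lemma sum_delta_nat [simp]:
  fixes f :: "4 \<Rightarrow> nat"
  shows "(\<Sum>k\<in>UNIV. f k * delta k j) = f j" "(\<Sum>k\<in>UNIV. f k * delta j k) = f j"
    "(\<Sum>k\<in>UNIV. delta k j * f k) = f j" "(\<Sum>k\<in>UNIV. delta j k * f k) = f j"
  using sum_delta[where f=f and j=j] by simp_all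

lemma sum_delta_1 [simp]: "(\<Sum>k\<in>UNIV. delta j k) = 1" "(\<Sum>k\<in>UNIV. delta k j) = 1"
  by (simp_all add: delta_def)

lemma X_eq_delta: "X i = mon (delta i)"
proof -
  have "(\<lambda>j. if j = i then 1 else 0) = delta i" by (auto simp: delta_def)
  then show ?thesis by (simp add: X_eq_mon)
qed

lemma ex_other: "\<exists>i::4. i \<noteq> j"
  by (rule exI[of _ "j + 1"]) auto

text \<open>The matrix \<open>b\<close> describes the inverse of the map with exponent matrix \<open>a\<close>. The product
  \<open>b a\<close> is the identity matrix only up to constant columns: a common monomial \<open>X ^ c'\<close> of the coordinates of the composite
  does not change the map of projective space.\<close>

locale inverse_pair =
  fixes a b :: "4 \<Rightarrow> 4 \<Rightarrow> nat" and d e :: nat and c c' :: "4 \<Rightarrow> nat"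
  assumes d_pos: "d > 0"
    and row_a: "(\<Sum>j\<in>UNIV. a i j) = d"
    and row_b: "(\<Sum>j\<in>UNIV. b i j) = e"
    and zero_a: "\<exists>i. a i j = 0"
    and zero_b: "\<exists>i. b i j = 0"
    and ab: "(\<Sum>k\<in>UNIV. a i k * b k j) = c j + delta i j"
    and ba: "(\<Sum>k\<in>UNIV. b i k * a k j) = c' j + delta i j"

text \<open>Up to a constant, a common factor of monomials is itself a monomial.\<close>

lemma no_common_factor_mon: "no_common_factor (monomial_map b) \<longleftrightarrow> (\<forall>j. \<exists>i. b i j = 0)"
proof safe
  fix j assume ncf: "no_common_factor (monomial_map b)"
  show "\<exists>i. b i j = 0"
  proof (rule ccontr)
    assume *: "\<nexists>i. b i j = 0"
    then have "X j dvd monomial_map b i" for i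
      unfolding monomial_map_eq X_eq_delta by (intro mon_dvd) (use * in \<open>auto simp: delta_def Suc_le_eq\<close>)
    then show False using ncf X_not_unit by (auto simp: no_common_factor_def)
  qed
next
  assume z: "\<forall>j. \<exists>i. b i j = 0"
  show "no_common_factor (monomial_map b)"
    unfolding no_common_factor_def
  proof safe
    fix p assume "\<forall>i. p dvd monomial_map b i"
    then have p: "p dvd mon (b i)" for i by (simp add: monomial_map_eq)
    obtain u g where ug: "u \<noteq> 0" "p = sg (expv g) u" using dvd_mon_is_monomial[OF p[of 0]] by metis
    have "g j = 0" for j
    proof -
      obtain i where "b i j = 0" using z by blast
      moreover obtain u' g' where ug': "u' \<noteq> 0" "p = sg (expv g') u'" "\<And>j. g' j \<le> b i j"
        using dvd_mon_is_monomial[OF p[of i]] by metis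
      moreover have "g = g'"
      proof -
        have "Poly_Mapping.keys p = {expv g}" "Poly_Mapping.keys p = {expv g'}"
          using ug ug'(1) by (simp, subst ug'(2), simp)
        then show ?thesis by simp
      qed
      ultimately show ?thesis by (metis le_zero_eq)
    qed
    then have "g = (\<lambda>_. 0)" by auto
    then have "p = sg 0 u" using ug by (simp add: expv_0)
    then have "p * sg 0 (1 / u) = 1" using ug(1) by (simp add: mult_single)
    then show "p dvd 1" by (metis dvd_triv_left)
  qed
qed

lemma keys_subst_monomial_map:
  assumes "k \<in> Poly_Mapping.keys (subst_poly p (monomial_map a))"
  obtains m where "m \<in> Poly_Mapping.keys p" "k = expv (\<lambda>j. \<Sum>i\<in>UNIV. lk m i * a i j)"
proof -
  have "subst_poly p (monomial_map a)
      = (\<Sum>m\<in>Poly_Mapping.keys p. sg (expv (\<lambda>j. \<Sum>i\<in>UNIV. lk m i * a i j)) (lk p m))"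
    by (simp add: subst_poly_def monomial_map_eq mon_power mon_prod) (simp add: mon_def mult_single)
  then have "k \<in> (\<Union>m\<in>Poly_Mapping.keys p.
      Poly_Mapping.keys (sg (expv (\<lambda>j. \<Sum>i\<in>UNIV. lk m i * a i j)) (lk p m)))"
  proof -
    assume eq: "subst_poly p (monomial_map a)
      = (\<Sum>m\<in>Poly_Mapping.keys p. sg (expv (\<lambda>j. \<Sum>i\<in>UNIV. lk m i * a i j)) (lk p m))" 
    have "lk (subst_poly p (monomial_map a)) k \<noteq> 0" using assms by (simp add: in_keys_iff)
    then obtain m where "m \<in> Poly_Mapping.keys p" 
       "lk (sg (expv (\<lambda>j. \<Sum>i\<in>UNIV. lk m i * a i j)) (lk p m)) k \<noteq> 0"
      unfolding eq lookup_sum by (meson sum.not_neutral_contains_not_neutral)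
    then show ?thesis by (auto simp: in_keys_iff lookup_single when_def split: if_splits)
  qed
  then show thesis using that by (auto split: if_splits)
qed

text \<open>The given inverse \<open>G\<close> may be any tuple of forms. One monomial of one coordinate of the composite,
  transported by the proportionality with \<open>X\<close>, gives a monomial in every coordinate, and a monomial
  of \<open>G i\<close> after substitution comes from a monomial of \<open>G i\<close>. These monomials of \<open>G\<close> form an
  inverse.\<close>

lemma birational_left_inverse:
  assumes "birational (monomial_map a)"
  obtains M c' where "\<And>i j. (\<Sum>k\<in>UNIV. M i k * a k j) = c' j + delta i j"
proof -
  from assms obtain G where G: "inverse_maps G (monomial_map a)" by (auto simp: birational_def)
  define H where "H i = subst_poly (G i) (monomial_map a)" for i
  have nz: "\<exists>i. H i \<noteq> 0" and propor: "\<And>i j. H i * X j = H j * X i"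
    using G by (auto simp: inverse_maps_def rational_map_def same_map_def comp_map_def H_def)
  obtain i0 where "H i0 \<noteq> 0" using nz by blast
  then obtain k0 where k0: "k0 \<in> Poly_Mapping.keys (H i0)"
    by (metis equals0I keys_eq_empty)
  have "\<exists>n. \<forall>j. (\<Sum>k\<in>UNIV. n k * a k j) + delta i0 j = lk k0 j + delta i j" for i
  proof -
    have "lk (H i0 * X i) (k0 + expv (delta i)) = lk (H i0) k0 * lk (X i) (expv (delta i))"
      by (rule lookup_mult_extremal[OF k0]) (auto simp: X_eq_delta)
    then have "lk (H i0 * X i) (k0 + expv (delta i)) \<noteq> 0"
      using k0 by (simp add: X_eq_delta lookup_mon in_keys_iff)
    then have "k0 + expv (delta i) \<in> Poly_Mapping.keys (H i * X i0)"
      using propor[of i0 i] by (simp add: in_keys_iff)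
    then obtain k where k: "k \<in> Poly_Mapping.keys (H i)" "k0 + expv (delta i) = k + expv (delta i0)"
      using keys_mult[of "H i" "X i0"] by (auto simp: X_eq_delta)
    obtain m where "k = expv (\<lambda>j. \<Sum>l\<in>UNIV. lk m l * a l j)"
      using keys_subst_monomial_map[OF k(1)[unfolded H_def]] by blast
    then have "(\<Sum>l\<in>UNIV. lk m l * a l j) + delta i0 j = lk k0 j + delta i j" for j
      using arg_cong[OF k(2), of "\<lambda>x. lk x j"] by (simp add: lookup_add)
    then show ?thesis by blast
  qed
  then obtain M where M: "\<And>i j. (\<Sum>k\<in>UNIV. M i k * a k j) + delta i0 j = lk k0 j + delta i j"
    by metis
  have "delta i0 j \<le> lk k0 j" for j
  proof -
    obtain i :: 4 where "i \<noteq> j" using ex_other by blast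
    then show ?thesis using M[of i j] by (simp add: delta_def)
  qed
  then have "(\<Sum>k\<in>UNIV. M i k * a k j) = (lk k0 j - delta i0 j) + delta i j" for i j
    using M[of i j] by (metis Nat.add_diff_assoc2 diff_add_inverse2)
  then show thesis by (rule that)
qed

text \<open>Division of the inverse by the common factor of its coordinates.\<close>

lemma left_inverse_normalize:
  assumes M: "\<And>i j. (\<Sum>k\<in>UNIV. M i k * a k j) = c' j + delta i (j::4)"
  obtains b c'' where "\<And>i j. (\<Sum>k\<in>UNIV. b i k * a k j) = c'' j + delta i j" "\<And>j. \<exists>i. b i j = 0"
proof -
  define mn where "mn j = Min (range (\<lambda>i. M i j))" for j
  have le: "mn j \<le> M i j" for i j by (auto simp: mn_def)
  have ex: "\<exists>i. M i j = mn j" for j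
  proof -
    have "mn j \<in> range (\<lambda>i. M i j)" unfolding mn_def by (rule Min_in) auto
    then show ?thesis by (metis rangeE)
  qed
  define b where "b i j = M i j - mn j" for i j
  define t where "t j = (\<Sum>k\<in>UNIV. mn k * a k j)" for j
  have bt: "(\<Sum>k\<in>UNIV. b i k * a k j) + t j = c' j + delta i j" for i j
  proof -
    have "(\<Sum>k\<in>UNIV. b i k * a k j) + t j = (\<Sum>k\<in>UNIV. M i k * a k j)"
      unfolding t_def sum.distrib[symmetric] b_def
      by (rule sum.cong) (use le in \<open>auto simp flip: add_mult_distrib\<close>)
    then show ?thesis using M by simp
  qed
  have "t j \<le> c' j" for j
  proof -
    obtain i :: 4 where "i \<noteq> j" using ex_other by blast
    then show ?thesis using bt[of i j] by (simp add: delta_def)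
  qed
  then have "(\<Sum>k\<in>UNIV. b i k * a k j) = (c' j - t j) + delta i j" for i j
    using bt[of i j] by (metis Nat.add_diff_assoc2 diff_add_inverse2)
  moreover have "\<exists>i. b i j = 0" for j
    using ex[of j] by (metis b_def diff_self_eq_0)
  ultimately show thesis by (rule that)
qed

text \<open>The matrix \<open>delta + c'\<close> is a perturbation of the identity by rank one with an explicit real
  inverse. Hence \<open>a\<close> is invertible over the reals, and a left inverse of \<open>a\<close> is also a right inverse.
  All entries of a column of \<open>b\<close> differ by the same amount from those of the real inverse of \<open>a\<close>,
  and the rows of \<open>a\<close> have equal sums, so \<open>a b\<close> differs from the identity by constant columns.\<close>

lemma inverse_pair_from_left:
  assumes d: "d > 0" and ra: "\<And>i. (\<Sum>j\<in>UNIV. a i j) = d" and za: "\<And>j. \<exists>i. a i j = 0"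
    and ba: "\<And>i j. (\<Sum>k\<in>UNIV. b i k * a k j) = c' j + delta i (j::4)" and zb: "\<And>j. \<exists>i. b i j = 0"
  obtains e c where "inverse_pair a b d e c c'"
proof -
  define s where "s = (\<Sum>j\<in>UNIV. c' j) + 1"
  have rb: "(\<Sum>k\<in>UNIV. b i k) * d = s" for i
  proof -
    have "(\<Sum>k\<in>UNIV. b i k) * d = (\<Sum>k\<in>UNIV. \<Sum>j\<in>UNIV. b i k * a k j)"
      using ra by (simp add: sum_distrib_right flip: sum_distrib_left)
    also have "\<dots> = (\<Sum>j\<in>UNIV. \<Sum>k\<in>UNIV. b i k * a k j)" by (rule sum.swap)
    also have "\<dots> = s" by (simp add: ba s_def sum.distrib)
    finally show ?thesis .
  qed
  define e where "e = (\<Sum>k\<in>UNIV. b 0 k)"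
  have rb': "(\<Sum>k\<in>UNIV. b i k) = e" for i
    using rb[of i] rb[of 0] d unfolding e_def by (metis mult_cancel2 less_not_refl2)
  define A :: "real^4^4" where "A = (\<chi> i j. real (a i j))"
  define B :: "real^4^4" where "B = (\<chi> i j. real (b i j))"
  \<comment> \<open>The inverse of \<open>delta + c'\<close>.\<close>
  define L :: "real^4^4" where "L = (\<chi> i j. real (delta i j) - real (c' j) / real s)"
  have "s > 0" by (simp add: s_def)
  then have s0: "real s > 0" by simp
  have BA: "B ** A = (\<chi> i j. real (c' j) + real (delta i j))"
    unfolding vec_eq_iff matrix_matrix_mult_def A_def B_def
    using ba by (simp flip: of_nat_mult of_nat_sum of_nat_add)
  have "L ** (B ** A) = mat 1"
    unfolding vec_eq_iff
  proof safe
    fix i j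
    have sc: "(\<Sum>k\<in>UNIV. real (c' k)) = real s - 1" by (simp add: s_def)
    have d1: "(\<Sum>k\<in>UNIV. real (delta i k)) = 1" by (simp flip: of_nat_sum)
    have "(L ** (B ** A)) $ i $ j
        = (\<Sum>k\<in>UNIV. (real (delta i k) - real (c' k) / real s) * (real (c' j) + real (delta k j)))"
      by (simp add: BA) (simp add: matrix_matrix_mult_def L_def)
    also have "\<dots> = (\<Sum>k\<in>UNIV. real (delta i k) * real (c' j)) + (\<Sum>k\<in>UNIV. real (delta i k) * real (delta k j))
       - (\<Sum>k\<in>UNIV. real (c' k) / real s * real (c' j)) - (\<Sum>k\<in>UNIV. real (c' k) / real s * real (delta k j))"
      by (simp add: algebra_simps sum.distrib sum_subtractf)
    also have "\<dots> = real (c' j) + real (delta i j) - (real s - 1) / real s * real (c' j) - real (c' j) / real s"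
      by (simp add: sc d1 flip: sum_distrib_right sum_divide_distrib)
    also have "\<dots> = real (delta i j)" using s0 by (simp add: field_simps)
    also have "\<dots> = mat 1 $ i $ j" by (simp add: delta_def mat_def)
    finally show "(L ** (B ** A)) $ i $ j = mat 1 $ i $ j" .
  qed
  then have "(L ** B) ** A = mat 1" by (simp add: matrix_mul_assoc)
  then have AL: "A ** (L ** B) = mat 1" by (simp add: matrix_left_right_inverse)
  define q where "q j = (\<Sum>k\<in>UNIV. real (c' k) * real (b k j)) / real s" for j
  have LB: "(L ** B) $ k $ j = real (b k j) - q j" for k j
    by (simp add: matrix_matrix_mult_def L_def B_def q_def algebra_simps sum_subtractf sum_divide_distrib)
  have key: "real (\<Sum>k\<in>UNIV. a i k * b k j) = real (delta i j) + real d * q j" for i j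
  proof -
    have "real (delta i j) = (A ** (L ** B)) $ i $ j" unfolding AL by (simp add: delta_def mat_def)
    also have "\<dots> = (\<Sum>k\<in>UNIV. real (a i k) * (real (b k j) - q j))"
      by (subst matrix_matrix_mult_def) (simp add: LB, simp add: A_def)
    also have "\<dots> = real (\<Sum>k\<in>UNIV. a i k * b k j) - real (\<Sum>k\<in>UNIV. a i k) * q j"
      by (simp add: algebra_simps sum_subtractf sum_distrib_left)
    finally show ?thesis using ra by simp
  qed
  define c where "c j = (\<Sum>k\<in>UNIV. a (j + 1) k * b k j)" for j
  have "(\<Sum>k\<in>UNIV. a i k * b k j) = c j + delta i j" for i j
  proof -
    have "real (c j) = real d * q j" using key[of "j + 1" j] by (simp add: c_def delta_def)
    then have "real (\<Sum>k\<in>UNIV. a i k * b k j) = real (c j + delta i j)" using key[of i j] by simp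
    then show ?thesis using of_nat_eq_iff by blast
  qed
  then have "inverse_pair a b d e c c'"
    by unfold_locales (use assms rb' in auto)
  then show thesis by (rule that)
qed

context inverse_pair
begin

lemma inverse_maps_mon: "inverse_maps (monomial_map b) (monomial_map a)"
proof -
  have hom: "rational_map (\<lambda>i. mon (f i))" if "\<And>i. (\<Sum>j\<in>UNIV. f i j) = n" for f n
    unfolding rational_map_def using that homogeneous_mon by (intro conjI exI[of _ n]) (metis, simp)
  have same: "same_map (\<lambda>i. mon (\<lambda>j. u j + delta i j)) X" for u
    by (auto simp: same_map_def X_eq_delta mon_mult algebra_simps)
  have sub: "subst_poly (mon (f i)) (\<lambda>i. mon (g i)) = mon (\<lambda>j. \<Sum>k\<in>UNIV. f i k * g k j)" for f g and i :: 4
    by (simp add: subst_mon)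
  have mm: "monomial_map f = (\<lambda>i. mon (f i))" for f by (rule ext) (simp add: monomial_map_eq)
  show ?thesis
    unfolding inverse_maps_def comp_map_def mm sub ab ba
    by (intro conjI same hom) (auto simp: row_a row_b sum.distrib)
qed

text \<open>Two monomial inverses differ by a constant in each column, and this constant is zero if both columns
  have minimum zero.\<close>

lemma inverse_unique:
  assumes "\<And>i. (\<Sum>j\<in>UNIV. b2 i j) = e2" "no_common_factor (monomial_map b2)"
    "inverse_maps (monomial_map b2) (monomial_map a)"
  shows "b2 = b"
proof -
  have mm: "monomial_map f = (\<lambda>i. mon (f i))" for f by (rule ext) (simp add: monomial_map_eq)
  have "same_map (comp_map (monomial_map b2) (monomial_map a)) X"
    using assms(3) by (simp add: inverse_maps_def)
  then have "mon (\<lambda>j. (\<Sum>k\<in>UNIV. b2 i k * a k j) + delta i' j) = mon (\<lambda>j. (\<Sum>k\<in>UNIV. b2 i' k * a k j) + delta i j)" for i i'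
    by (simp add: same_map_def comp_map_def mm subst_mon X_eq_delta mon_mult)
  then have eq: "(\<Sum>k\<in>UNIV. b2 i k * a k j) + delta i' j = (\<Sum>k\<in>UNIV. b2 i' k * a k j) + delta i j" for i i' j
    by (simp add: fun_eq_iff)
  define c2 where "c2 j = int (\<Sum>k\<in>UNIV. b2 0 k * a k j) - int (delta 0 j)" for j
  have b2a: "int (\<Sum>k\<in>UNIV. b2 i k * a k j) = c2 j + int (delta i j)" for i j
    using eq[of i j 0] by (simp add: c2_def del: of_nat_sum) 
  have "int (b2 i j) + int e2 * int (c j) = int (b i j) + (\<Sum>k\<in>UNIV. c2 k * int (b k j))" for i j
  proof -
    have "(\<Sum>l\<in>UNIV. (\<Sum>k\<in>UNIV. int (b2 i k) * int (a k l)) * int (b l j))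
        = (\<Sum>k\<in>UNIV. int (b2 i k) * (\<Sum>l\<in>UNIV. int (a k l) * int (b l j)))"
      by (simp add: sum_distrib_left sum_distrib_right mult.assoc) (rule sum.swap)
    moreover have "(\<Sum>k\<in>UNIV. int (b2 i k) * int (a k l)) = c2 l + int (delta i l)" for l
      using b2a[of i l] by simp
    moreover have "(\<Sum>l\<in>UNIV. int (a k l) * int (b l j)) = int (c j) + int (delta k j)" for k
      using ab[of k j] by (simp flip: of_nat_mult of_nat_sum of_nat_add)
    ultimately have "(\<Sum>l\<in>UNIV. (c2 l + int (delta i l)) * int (b l j))
        = (\<Sum>k\<in>UNIV. int (b2 i k) * (int (c j) + int (delta k j)))" by simp
    moreover have "(\<Sum>k\<in>UNIV. int (b2 i k)) = int e2" using assms(1)[of i] by (simp flip: of_nat_sum)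
    ultimately show ?thesis
      by (simp add: distrib_left distrib_right sum.distrib flip: sum_distrib_right)
  qed
  note eqn = this
  define g where "g j = (\<Sum>k\<in>UNIV. c2 k * int (b k j)) - int e2 * int (c j)" for j
  have g: "int (b2 i j) - int (b i j) = g j" for i j
    using eqn[of i j] unfolding g_def by linarith
  show ?thesis
  proof (intro ext)
    fix i j
    obtain i1 i2 where "b2 i1 j = 0" "b i2 j = 0"
      using assms(2) zero_b no_common_factor_mon by metis
    then have "g j = 0" using g[of i1 j] g[of i2 j] by simp
    then show "b2 i j = b i j" using g[of i j] by simp
  qed
qed

lemma inverse_degree_eq: "inverse_degree a = e"
  unfolding inverse_degree_def
proof (rule the_equality)
  show "\<exists>b. (\<forall>i. (\<Sum>j\<in>UNIV. b i j) = e) \<and> no_common_factor (monomial_map b)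
     \<and> inverse_maps (monomial_map b) (monomial_map a)"
    using row_b zero_b inverse_maps_mon by (intro exI[of _ b]) (simp add: no_common_factor_mon)
  fix e2 assume "\<exists>b. (\<forall>i. (\<Sum>j\<in>UNIV. b i j) = e2) \<and> no_common_factor (monomial_map b)
     \<and> inverse_maps (monomial_map b) (monomial_map a)"
  then show "e2 = e" using inverse_unique row_b by metis
qed

end

theorem birational_imp_inverse_pair:
  assumes "d > 0" "\<And>i. (\<Sum>j\<in>UNIV. a i j) = d" "no_common_factor (monomial_map a)"
    "birational (monomial_map a)"
  obtains b e c c' where "inverse_pair a b d e c c'"
proof -
  obtain M c' where M: "\<And>i j. (\<Sum>k\<in>UNIV. M i k * a k j) = c' j + delta i j"
    using birational_left_inverse[OF assms(4)] by metis
  obtain b c'' where b: "\<And>i j. (\<Sum>k\<in>UNIV. b i k * a k j) = c'' j + delta i j" "\<And>j. \<exists>i. b i j = 0"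
    using left_inverse_normalize[OF M] by metis
  show thesis
    using inverse_pair_from_left[OF assms(1,2) _ b] assms(3) that by (metis no_common_factor_mon)
qed

section \<open>Homogeneous components\<close>

definition mdeg :: "(4 \<Rightarrow>\<^sub>0 nat) \<Rightarrow> nat" where
  "mdeg m = (\<Sum>i\<in>UNIV. lk m i)"

lemma mdeg_add: "mdeg (m + n) = mdeg m + mdeg n"
  by (simp add: mdeg_def lookup_add sum.distrib)

lemma homogeneous_iff: "homogeneous k p \<longleftrightarrow> (\<forall>m\<in>Poly_Mapping.keys p. mdeg m = k)"
  by (simp add: homogeneous_def mdeg_def)

text \<open>Homogeneous components are needed because the composite of a map with its inverse multiplies
  every variable by the same monomial, hence components of different degrees by different ones.\<close>

definition hcomp :: "nat \<Rightarrow> poly4 \<Rightarrow> poly4" where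
  "hcomp k p = (\<Sum>m\<in>{m\<in>Poly_Mapping.keys p. mdeg m = k}. sg m (lk p m))"

lemma lookup_hcomp: "lk (hcomp k p) m = (if mdeg m = k then lk p m else 0)"
proof -
  have "lk (hcomp k p) m = (\<Sum>n\<in>{n\<in>Poly_Mapping.keys p. mdeg n = k}. if n = m then lk p n else 0)"
    unfolding hcomp_def lookup_sum by (rule sum.cong) (auto simp: lookup_single when_def)
  then show ?thesis by (simp add: in_keys_iff)
qed

lemma hcomp_sum: "hcomp k (sum g A) = (\<Sum>x\<in>A. hcomp k (g x))"
  by (rule poly_mapping_eqI) (simp add: lookup_hcomp lookup_sum)

lemma hcomp_homogeneous: "homogeneous e p \<Longrightarrow> hcomp k p = (if k = e then p else 0)"
  by (rule poly_mapping_eqI) (auto simp: lookup_hcomp homogeneous_iff in_keys_iff)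

lemma dvd_hcomps:
  assumes "\<And>k. h dvd hcomp k p"
  shows "h dvd p"
proof -
  have "p = (\<Sum>k\<in>mdeg ` Poly_Mapping.keys p. hcomp k p)"
  proof (rule poly_mapping_eqI)
    fix m
    show "lk p m = lk (\<Sum>k\<in>mdeg ` Poly_Mapping.keys p. hcomp k p) m"
      by (auto simp: lookup_sum lookup_hcomp in_keys_iff)
  qed
  then show ?thesis using assms by (metis dvd_sum)
qed

lemma homogeneous_dvd_hcomp:
  assumes "homogeneous e f" "f dvd q"
  shows "f dvd hcomp k q"
proof -
  obtain s where "q = f * s" using assms(2) by blast
  also have "\<dots> = (\<Sum>m\<in>Poly_Mapping.keys s. f * sg m (lk s m))"
    by (subst poly_mapping_sum_single[of s]) (simp add: sum_distrib_left)
  finally have "hcomp k q = (\<Sum>m\<in>Poly_Mapping.keys s. hcomp k (f * sg m (lk s m)))"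
    by (simp add: hcomp_sum)
  moreover have "f dvd hcomp k (f * sg m (lk s m))" for m
  proof -
    have "homogeneous (e + mdeg m) (f * sg m (lk s m))"
      using assms(1) by (rule homogeneous_mult) (simp add: homogeneous_iff)
    then show ?thesis by (auto simp: hcomp_homogeneous)
  qed
  ultimately show ?thesis by (simp add: dvd_sum)
qed

lemma subst_rescale:
  "subst_poly p (\<lambda>i. mon u * X i) = (\<Sum>m\<in>Poly_Mapping.keys p. mon (\<lambda>i. mdeg m * u i) * sg m (lk p m))"
proof -
  have "sg 0 (lk p m) * (\<Prod>i\<in>UNIV. (mon u * X i) ^ lk m i) = mon (\<lambda>i. mdeg m * u i) * sg m (lk p m)" for m
  proof -
    have "(\<Prod>i\<in>UNIV. (mon u * X i) ^ lk m i) = mon u ^ mdeg m * mon (lk m)"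
      by (simp add: power_mult_distrib prod.distrib mdeg_def power_sum mon_eq_prod[of "lk m"])
    then show ?thesis by (simp add: mon_power) (simp add: mon_def mult_single add.commute)
  qed
  then show ?thesis by (simp add: subst_poly_def)
qed

lemma homogeneous_subst_rescale:
  assumes "homogeneous k p"
  shows "subst_poly p (\<lambda>i. mon u * X i) = mon (\<lambda>i. k * u i) * p"
proof -
  have "subst_poly p (\<lambda>i. mon u * X i) = (\<Sum>m\<in>Poly_Mapping.keys p. mon (\<lambda>i. k * u i) * sg m (lk p m))"
    unfolding subst_rescale using assms by (intro sum.cong) (auto simp: homogeneous_iff)
  also have "\<dots> = mon (\<lambda>i. k * u i) * (\<Sum>m\<in>Poly_Mapping.keys p. sg m (lk p m))"
    by (simp add: sum_distrib_left)
  finally show ?thesis using poly_mapping_sum_single[of p] by simp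
qed

lemma hcomp_rescale:
  "hcomp (k * Suc (\<Sum>i\<in>UNIV. u i)) (subst_poly p (\<lambda>i. mon u * X i)) = mon (\<lambda>i. k * u i) * hcomp k p"
proof -
  let ?U = "\<Sum>i\<in>UNIV. u i"
  have hom: "homogeneous (mdeg m * Suc ?U) (mon (\<lambda>i. mdeg m * u i) * sg m (lk p m))" for m
  proof -
    have "homogeneous (mdeg m * ?U + mdeg m) (mon (\<lambda>i. mdeg m * u i) * sg m (lk p m))"
      by (rule homogeneous_mult)
        (use homogeneous_mon[of "\<lambda>i. mdeg m * u i"] in \<open>simp_all add: homogeneous_iff sum_distrib_left\<close>)
    then show ?thesis by (simp add: add.commute)
  qed
  have "hcomp (k * Suc ?U) (subst_poly p (\<lambda>i. mon u * X i))
    = (\<Sum>m\<in>Poly_Mapping.keys p. if mdeg m = k then mon (\<lambda>i. mdeg m * u i) * sg m (lk p m) else 0)"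
    unfolding subst_rescale hcomp_sum
    by (rule sum.cong) (auto simp: hcomp_homogeneous[OF hom] simp del: mult_Suc_right)
  also have "\<dots> = (\<Sum>m\<in>{m\<in>Poly_Mapping.keys p. mdeg m = k}. mon (\<lambda>i. k * u i) * sg m (lk p m))"
    by (simp add: sum.inter_filter flip: sum.inter_filter)
  finally show ?thesis by (simp add: hcomp_def sum_distrib_left)
qed

lemma homogeneous_degree_mono:
  assumes "homogeneous k p" "homogeneous k' (s * p)" "s * p \<noteq> 0"
  shows "k \<le> k'"
proof -
  have nz: "s \<noteq> 0" "p \<noteq> 0" using assms(3) by auto
  have "mdeg (Max (Poly_Mapping.keys s) + Max (Poly_Mapping.keys p)) = k'"
    using assms(2) Max_keys_mult[OF nz] by (simp add: homogeneous_iff)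
  moreover have "mdeg (Max (Poly_Mapping.keys p)) = k"
    using assms(1) nz by (simp add: homogeneous_iff)
  ultimately show ?thesis by (simp add: mdeg_add)
qed

section \<open>Plane sections of the surface\<close>

text \<open>Expressing one variable of the sum by the others is a homomorphism into a domain whose kernel is
  generated by the sum.\<close>

lemma sum_X_dvd_power:
  assumes "A \<noteq> {}" "(\<Sum>r\<in>A. X r) dvd p ^ n"
  shows "(\<Sum>r\<in>A. X r) dvd p"
proof -
  let ?l = "\<Sum>r\<in>A. X r"
  obtain r0 where r0: "r0 \<in> A" using assms(1) by blast
  define F where "F = X(r0 := - (\<Sum>r\<in>A - {r0}. X r))"
  have split: "?l = X r0 + (\<Sum>r\<in>A - {r0}. X r)"
    using r0 by (simp add: sum.remove)
  have "?l dvd X i - F i" for i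
    by (cases "i = r0") (auto simp: F_def split)
  then have diff: "?l dvd p - subst_poly p F" for p
    using subst.ins_cong_mod[of ?l X F p] by simp
  have "(\<Sum>r\<in>A - {r0}. F r) = (\<Sum>r\<in>A - {r0}. X r)"
    by (rule sum.cong) (auto simp: F_def)
  then have "subst_poly ?l F = 0"
    unfolding split by (simp add: subst.ins_simps F_def)
  then have "subst_poly p F = 0"
    using assms(2) subst.ins_dvd[of ?l "p ^ n" F] by (simp add: subst.ins_power)
  then show ?thesis using diff[of p] by simp
qed

text \<open>The exponent of \<open>X j\<close> in the greatest common monomial of the restriction of the surface to
  the plane \<open>X i = 0\<close>.\<close>

definition mu :: "(4 \<Rightarrow> 4 \<Rightarrow> nat) \<Rightarrow> 4 \<Rightarrow> 4 \<Rightarrow> nat" where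
  "mu a i j = Min ((\<lambda>r. a r j) ` {r. a r i = 0})"

text \<open>Distinct variables are non-associated primes.\<close>

lemma prod_X_dvd:
  assumes "\<And>l. l \<in> A \<Longrightarrow> X l dvd s"
  shows "(\<Prod>l\<in>A. X l) dvd s"
  using finite[of A] assms
proof (induction A)
  case (insert x A)
  then obtain t where t: "s = (\<Prod>l\<in>A. X l) * t" by (auto simp: dvd_def)
  have ndvd: "\<not> X x dvd X l" if "l \<noteq> x" for l
    using that X_dvd_keys[of x "X l" "expv (delta l)"] by (auto simp: X_eq_delta delta_def)
  have "\<not> X x dvd (\<Prod>l\<in>B. X l)" if "x \<notin> B" for B
    using finite[of B] that
  proof (induction B)
    case empty
    then show ?case using X_not_unit by simp
  next
    case (insert y B)
    then show ?case using X_dvd_mult[of x "X y" "\<Prod>l\<in>B. X l"] ndvd[of y] by auto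
  qed
  then have "X x dvd t"
    using insert X_dvd_mult[of x "\<Prod>l\<in>A. X l" t] t by auto
  then show ?case using t insert(2) by (auto simp: mult.commute[of "X x"] intro: mult_dvd_mono)
qed auto

context inverse_pair
begin

lemma mu_le: "a r i = 0 \<Longrightarrow> mu a i j \<le> a r j"
  by (auto simp: mu_def)

lemma mu_attained: obtains r where "a r i = 0" "a r j = mu a i j"
proof -
  have "mu a i j \<in> (\<lambda>r. a r j) ` {r. a r i = 0}"
    unfolding mu_def using zero_a[of i] by (intro Min_in) auto
  then show thesis using that by auto
qed

lemma mu_self: "mu a i i = 0"
  using mu_attained[of i i] by metis

text \<open>The ideal generated by the restriction of \<open>f\<close> becomes, after the substitution of the
  inverse map, the ideal of a plane; planes are reduced, and substituting the map itself leads
  back, up to monomial factors that differ from one homogeneous component to the other.\<close>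

lemma restriction_dvd_power:
  assumes "(\<Sum>r\<in>{r. a r i = 0}. mon (a r)) dvd p ^ n"
  shows "\<exists>u. (\<Sum>r\<in>{r. a r i = 0}. mon (a r)) dvd mon u * hcomp k p"
proof -
  let ?Z = "{r. a r i = 0}" 
  define F where "F = (\<Sum>r\<in>?Z. mon (a r))"
  define l where "l = (\<Sum>r\<in>?Z. X r)"
  define P where "P = subst_poly p (\<lambda>k. mon (b k))"
  have "subst_poly F (\<lambda>k. mon (b k)) = mon c * l"
    unfolding F_def l_def subst.ins_sum sum_distrib_left
    by (simp add: subst_mon ab X_eq_delta mon_mult)
  then have "mon c * l dvd P ^ n"
    using subst.ins_dvd[OF assms, of "\<lambda>k. mon (b k)"] by (simp add: F_def P_def subst.ins_power)
  then have lP: "l dvd P ^ n" by (rule dvd_mult_right)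
  have "?Z \<noteq> {}" using zero_a[of i] by simp
  then have "l dvd P" using lP unfolding l_def by (rule sum_X_dvd_power)
  then have "subst_poly l (\<lambda>k. mon (a k)) dvd subst_poly P (\<lambda>k. mon (a k))"
    by (rule subst.ins_dvd)
  moreover have "subst_poly l (\<lambda>k. mon (a k)) = F"
    by (simp add: l_def F_def subst.ins_simps)
  moreover have "subst_poly P (\<lambda>k. mon (a k)) = subst_poly p (\<lambda>k. mon c' * X k)"
    unfolding P_def subst.ins_subst subst_mon ba by (simp add: X_eq_delta mon_mult)
  ultimately have "F dvd subst_poly p (\<lambda>k. mon c' * X k)" by simp
  moreover have "homogeneous d F"
    unfolding F_def by (rule homogeneous_sum) (use homogeneous_mon row_a in metis)
  ultimately have "F dvd hcomp (k * Suc (\<Sum>i\<in>UNIV. c' i)) (subst_poly p (\<lambda>k. mon c' * X k))"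
    by (intro homogeneous_dvd_hcomp)
  then show ?thesis unfolding hcomp_rescale F_def by blast
qed

text \<open>The restriction \<open>F\<close> of the surface to the plane \<open>X i = 0\<close> is the product of its common monomial,
  with exponents \<open>mu a i\<close>, and a form \<open>h\<close> without a monomial factor. The form \<open>h\<close> is already reduced, so passing
  to the support cuts every exponent of the common monomial down to at most one.\<close>

theorem k_num_eq: "k_num (\<Sum>r\<in>UNIV. mon (a r)) i + (\<Sum>j\<in>UNIV. mu a i j - 1) = d"
proof -
  let ?Z = "{r. a r i = 0}"
  define f where "f = (\<Sum>r\<in>UNIV. mon (a r))"
  define F where "F = (\<Sum>r\<in>?Z. mon (a r))"
  define h where "h = (\<Sum>r\<in>?Z. mon (\<lambda>j. a r j - mu a i j))"
  define nu where "nu j = min (mu a i j) 1" for j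
  define g where "g = mon nu * h"
  have Z: "?Z \<noteq> {}" using zero_a[of i] by auto
  have F_eq: "F = mon (mu a i) * h"
    unfolding F_def h_def sum_distrib_left mon_mult
    by (rule sum.cong) (auto simp: mu_le)
  have ndvd_h: "\<not> X l dvd h" for l
  proof
    assume "X l dvd h"
    moreover obtain r where "a r i = 0" "a r l = mu a i l" by (rule mu_attained)
    moreover from this have "expv (\<lambda>j. a r j - mu a i j) \<in> Poly_Mapping.keys h"
      by (auto simp: h_def keys_sum_mon)
    ultimately show False using X_dvd_keys by fastforce
  qed
  have sum_mu: "(\<Sum>j\<in>UNIV. mu a i j) \<le> d"
    using Z mu_le row_a by (metis (mono_tags, lifting) mem_Collect_eq ex_in_conv sum_mono)
  have sum_nu: "(\<Sum>j\<in>UNIV. mu a i j - 1) + (\<Sum>j\<in>UNIV. nu j) = (\<Sum>j\<in>UNIV. mu a i j)"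
    unfolding sum.distrib[symmetric] by (rule sum.cong) (auto simp: nu_def)
  define k where "k = d - (\<Sum>j\<in>UNIV. mu a i j - 1)"
  have hom_h: "homogeneous (d - (\<Sum>j\<in>UNIV. mu a i j)) h"
    unfolding h_def
  proof (rule homogeneous_sum)
    fix r assume "r \<in> ?Z"
    then have "(\<Sum>j\<in>UNIV. a r j - mu a i j) = d - (\<Sum>j\<in>UNIV. mu a i j)"
      using mu_le row_a by (subst sum_subtractf_nat) auto
    then show "homogeneous (d - (\<Sum>j\<in>UNIV. mu a i j)) (mon (\<lambda>j. a r j - mu a i j))"
      using homogeneous_mon by metis
  qed
  have hom_g: "homogeneous k g"
  proof -
    have "k = (\<Sum>j\<in>UNIV. nu j) + (d - (\<Sum>j\<in>UNIV. mu a i j))"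
      using sum_mu sum_nu by (simp add: k_def)
    then show ?thesis unfolding g_def using homogeneous_mult[OF homogeneous_mon hom_h] by simp
  qed
  have g_dvd: "g dvd p" if Fp: "F dvd p ^ n" for p n
  proof -
    have "h dvd hcomp k p" for k
    proof -
      obtain u where "F dvd mon u * hcomp k p"
        using restriction_dvd_power[of i p n k] Fp unfolding F_def by blast
      then have "h dvd mon u * hcomp k p" unfolding F_eq by (rule dvd_mult_right)
      then show ?thesis by (rule cancel_mon_dvd) (rule ndvd_h)
    qed
    then have "h dvd p" by (rule dvd_hcomps)
    then obtain s where s: "p = h * s" by blast
    have "(\<Prod>l\<in>{l. mu a i l > 0}. X l) dvd s"
    proof (rule prod_X_dvd, safe)
      fix l assume "mu a i l > 0"
      then have "X l dvd mon (mu a i)"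
        unfolding X_eq_delta by (intro mon_dvd) (auto simp: delta_def)
      then have "X l dvd F" unfolding F_eq by (rule dvd_mult2)
      then have "X l dvd p ^ n" using Fp dvd_trans by blast
      then show "X l dvd s" using X_dvd_power X_dvd_mult ndvd_h s by metis
    qed
    moreover have "(\<Prod>l\<in>{l. mu a i l > 0}. X l) = mon nu"
      unfolding mon_eq_prod by (rule prod.mono_neutral_cong_left) (auto simp: nu_def)
    ultimately show ?thesis using s by (auto simp: g_def mult.commute[of h] intro: mult_dvd_mono)
  qed
  \<comment> \<open>Any exponent that is at least all \<open>mu a i j\<close> and positive serves.\<close>
  define N where "N = Suc (\<Sum>j\<in>UNIV. mu a i j)"
  have F_dvd: "F dvd g ^ N"
  proof -
    have "mu a i j \<le> N * nu j" for j
      using member_le_sum[of j UNIV "mu a i"] by (cases "mu a i j") (auto simp: N_def nu_def)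
    then have "mon (mu a i) dvd mon nu ^ N" by (auto simp: mon_power intro!: mon_dvd)
    moreover have "h dvd h ^ N" by (simp add: N_def)
    ultimately show ?thesis by (simp add: F_eq g_def power_mult_distrib mult_dvd_mono)
  qed
  define rho where "rho p = subst_poly p (X(i := 0))" for p
  have rho_simps: "rho (p + q) = rho p + rho q" "rho (p * q) = rho p * rho q" "rho (p ^ n) = rho p ^ n"
    "rho (X i) = 0" for p q n
    by (simp_all add: rho_def subst.ins_simps)
  have rho_dvd: "X i dvd p - rho p" for p by (simp add: rho_def X_dvd_diff_subst)
  have fF: "X i dvd f - F"
  proof -
    have "f - F = (\<Sum>r\<in>UNIV - ?Z. mon (a r))"
      unfolding f_def F_def by (simp add: sum_diff)
    moreover have "X i dvd mon (a r)" if "r \<in> UNIV - ?Z" for r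
      unfolding X_eq_delta using that by (intro mon_dvd) (auto simp: delta_def Suc_le_eq)
    ultimately show ?thesis by (auto intro!: dvd_sum)
  qed
  have rho_mon: "rho (mon u) = mon u" if "u i = 0" for u
    unfolding rho_def mon_eq_prod subst.ins_prod
    by (rule prod.cong) (use that in \<open>auto simp: subst.ins_simps\<close>)
  have rho_f: "rho f = F"
  proof -
    have "rho (f - F) = 0" using fF by (simp add: rho_def X_dvd_iff)
    moreover have "rho F = F"
      unfolding F_def rho_def subst.ins_sum
      by (rule sum.cong) (use rho_mon in \<open>auto simp: rho_def\<close>)
    ultimately show ?thesis by (simp add: rho_def subst.ins_simps)
  qed
  have rad: "radical (ideal2 f (X i)) = ideal2 (X i) g"
  proof (intro equalityI subsetI)
    fix p assume "p \<in> radical (ideal2 f (X i))"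
    then obtain n r s where "p ^ n = r * f + s * X i" by (auto simp: radical_def ideal2_def)
    then have "rho (p ^ n) = rho (r * f + s * X i)" by simp
    then have "rho p ^ n = rho r * F" by (simp add: rho_simps rho_f)
    then have "g dvd rho p" by (intro g_dvd[of _ n]) auto
    moreover obtain t where "p - rho p = X i * t" using rho_dvd[of p] by blast
    moreover from calculation(1) obtain q where "rho p = g * q" by (rule dvdE)
    ultimately have "p = t * X i + q * g" by (simp add: algebra_simps)
    then show "p \<in> ideal2 (X i) g" unfolding ideal2_def by blast
  next
    fix p assume "p \<in> ideal2 (X i) g"
    then obtain r s where p: "p = r * X i + s * g" by (auto simp: ideal2_def)
    have "X i dvd p ^ N - (s * g) ^ N"
    proof -
      have "p - s * g dvd p ^ N - (s * g) ^ N" by (simp add: power_diff_sumr2)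
      moreover have "X i dvd p - s * g" by (simp add: p)
      ultimately show ?thesis by (rule dvd_trans[rotated])
    qed
    then obtain v where v: "p ^ N = (s * g) ^ N + X i * v" by (auto simp: dvd_def algebra_simps)
    obtain t where t: "(s * g) ^ N = F * t"
      using F_dvd by (auto simp: power_mult_distrib dvd_def intro: that[of "s ^ N * _"])
    obtain u where "f - F = X i * u" using fF by blast
    then have f_eq: "f = F + X i * u" by (simp add: algebra_simps)
    have "p ^ N = t * f + (v - u * t) * X i" unfolding v t f_eq by (simp add: algebra_simps)
    then show "p \<in> radical (ideal2 f (X i))" unfolding radical_def ideal2_def by blast
  qed
  have rho_hom: "homogeneous e (rho q)" if "homogeneous e q" for e q
    using that unfolding homogeneous_iff rho_def by (auto simp: in_keys_iff lookup_subst_zero split: if_splits)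
  have g_nz: "rho g \<noteq> 0"
  proof -
    have "\<not> X i dvd mon nu"
      using X_dvd_keys[of i "mon nu" "expv nu"] by (auto simp: nu_def mu_self)
    then show ?thesis using ndvd_h X_dvd_mult by (auto simp: rho_def g_def simp flip: X_dvd_iff)
  qed
  have mem: "q \<in> ideal2 (X i) q" for q
    unfolding ideal2_def by (rule CollectI) (rule exI[of _ 0], rule exI[of _ 1], simp)
  have "k_num f i = k"
    unfolding k_num_def plane_curve_degree_def rad
  proof (rule the_equality)
    show "\<exists>g'. homogeneous k g' \<and> ideal2 (X i) g = ideal2 (X i) g'" using hom_g by blast
    fix k' assume "\<exists>g'. homogeneous k' g' \<and> ideal2 (X i) g = ideal2 (X i) g'"
    then obtain g' where g': "homogeneous k' g'" "ideal2 (X i) g = ideal2 (X i) g'" by blast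
    then obtain r s r' s' where "g = r * X i + s * g'" "g' = r' * X i + s' * g"
      using mem[of g] mem[of g'] unfolding ideal2_def by blast
    then have "rho g = rho (r * X i + s * g')" "rho g' = rho (r' * X i + s' * g)" by simp_all
    then have eq: "rho g = rho s * rho g'" "rho g' = rho s' * rho g"
      by (simp_all add: rho_simps)
    have g'_nz: "rho g' \<noteq> 0" using eq(1) g_nz by auto
    have "k' \<le> k"
      using homogeneous_degree_mono[of k' "rho g'" k "rho s"] rho_hom[OF hom_g] rho_hom[OF g'(1)] g_nz
      unfolding eq(1)[symmetric] by blast
    moreover have "k \<le> k'"
      using homogeneous_degree_mono[of k "rho g" k' "rho s'"] rho_hom[OF hom_g] rho_hom[OF g'(1)] g'_nz
      unfolding eq(2)[symmetric] by blast
    ultimately show "k' = k" by simp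
  qed
  moreover have "(\<Sum>j\<in>UNIV. mu a i j - 1) \<le> d" using sum_mu sum_nu by linarith
  ultimately show ?thesis by (simp add: k_def f_def)
qed

end

text \<open>The point with coordinates \<open>0\<close> at \<open>i\<close> and \<open>j\<close>, and \<open>1\<close> elsewhere, decides whether the line lies
  on the surface: all coefficients are \<open>1\<close>, so the value there counts the monomials
  that do not vanish on the line.\<close>

lemma l_num_eq:
  fixes a :: "4 \<Rightarrow> 4 \<Rightarrow> nat"
  assumes "i \<noteq> j"
  shows "l_num (\<Sum>r\<in>UNIV. mon (a r)) i j = (if \<exists>r. a r i = 0 \<and> a r j = 0 then 0 else 1)"
proof -
  have ev: "eval_poly (\<Sum>r\<in>UNIV. mon (a r)) x = (\<Sum>r\<in>UNIV. \<Prod>k\<in>UNIV. x $ k ^ a r k)" for x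
    by (simp add: eval_poly_eq eval.ins_simps mon_eq_prod)
  have V: "V (X i) \<inter> V (X j) = {x. x \<noteq> 0 \<and> x $ i = 0 \<and> x $ j = 0}" for i j
    by (auto simp: V_def eval_poly_eq eval.ins_X)
  show ?thesis
  proof (cases "\<exists>r. a r i = 0 \<and> a r j = 0")
    case True
    define x :: "complex^4" where "x = (\<chi> k. if k = i \<or> k = j then 0 else 1)"
    have "card (UNIV - {i, j} :: 4 set) \<noteq> 0" using assms by (subst card_Diff_subset) auto
    then have "UNIV - {i, j} \<noteq> {}" by (metis card.empty)
    then obtain k where "k \<noteq> i" "k \<noteq> j" by auto
    then have "x $ k \<noteq> 0" by (simp add: x_def)
    then have "x \<noteq> 0" by auto
    then have x: "x \<in> V (X i) \<inter> V (X j)" by (simp add: V x_def)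
    have "(\<Prod>k\<in>UNIV. x $ k ^ a r k) = (if a r i = 0 \<and> a r j = 0 then 1 else 0)" for r
    proof (cases "a r i = 0 \<and> a r j = 0")
      case True
      then have "(\<Prod>k\<in>UNIV. x $ k ^ a r k) = (\<Prod>k\<in>(UNIV :: 4 set). 1)"
        by (intro prod.cong) (auto simp: x_def)
      then show ?thesis using True by simp
    next
      case False
      then obtain k where "k = i \<or> k = j" "a r k \<noteq> 0" by auto
      then have "x $ k ^ a r k = 0" by (simp add: x_def)
      then have "(\<Prod>k\<in>UNIV. x $ k ^ a r k) = 0" by (intro prod_zero) auto
      then show ?thesis by (simp only: if_not_P[OF False])
    qed
    then have "eval_poly (\<Sum>r\<in>UNIV. mon (a r)) x = of_nat (card {r. a r i = 0 \<and> a r j = 0})"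
      using sum.inter_filter[of UNIV "\<lambda>_. 1::complex" "\<lambda>r. a r i = 0 \<and> a r j = 0"]
      by (simp add: ev)
    moreover have "card {r. a r i = 0 \<and> a r j = 0} \<noteq> 0" using True by auto
    ultimately have "eval_poly (\<Sum>r\<in>UNIV. mon (a r)) x \<noteq> 0" by simp
    then have "x \<notin> V (\<Sum>r\<in>UNIV. mon (a r))" by (simp add: V_def)
    then show ?thesis using x True by (auto simp: l_num_def)
  next
    case False
    have "V (X i) \<inter> V (X j) \<subseteq> V (\<Sum>r\<in>UNIV. mon (a r))"
    proof
      fix x assume "x \<in> V (X i) \<inter> V (X j)"
      then have x: "x \<noteq> 0" "x $ i = 0" "x $ j = 0" by (auto simp: V)
      have "(\<Prod>k\<in>UNIV. x $ k ^ a r k) = 0" for r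
      proof -
        obtain k where "k = i \<or> k = j" "a r k \<noteq> 0" using False by blast
        then have "x $ k ^ a r k = 0" using x by auto
        then show ?thesis by (intro prod_zero) auto
      qed
      then have "(\<Sum>r\<in>UNIV. \<Prod>k\<in>UNIV. x $ k ^ a r k) = 0" by (simp only: sum.neutral_const)
      then show "x \<in> V (\<Sum>r\<in>UNIV. mon (a r))" using x(1) by (simp only: V_def ev mem_Collect_eq simp_thms)
    qed
    then show ?thesis using False by (auto simp: l_num_def)
  qed
qed

section \<open>Counting\<close>

text \<open>A homogeneous linear system with more unknowns than equations has a nontrivial solution, by
  elimination of one unknown per equation.\<close>

lemma homogeneous_system_nontrivial:
  fixes M :: "'s \<Rightarrow> 'b \<Rightarrow> 'k::field"
  assumes "finite B" "finite S" "card B < card S"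
  shows "\<exists>\<gamma>. (\<exists>s\<in>S. \<gamma> s \<noteq> 0) \<and> (\<forall>v\<in>B. (\<Sum>s\<in>S. \<gamma> s * M s v) = 0)"
  using assms
proof (induction B arbitrary: S M rule: finite_induct)
  case empty
  then have "S \<noteq> {}" by auto
  then show ?case by (intro exI[of _ "\<lambda>_. 1"]) auto
next
  case (insert w B)
  show ?case
  proof (cases "\<forall>s\<in>S. M s w = 0")
    case True
    then show ?thesis using insert.IH[of S M] insert.prems insert.hyps by auto
  next
    case False
    then obtain s0 where s0: "s0 \<in> S" "M s0 w \<noteq> 0" by blast
    define S' where "S' = S - {s0}"
    have "card B < card S'" "finite S'"
      using insert.prems insert.hyps s0 by (auto simp: S'_def)
    then obtain \<gamma> where \<gamma>: "\<exists>s\<in>S'. \<gamma> s \<noteq> 0"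
      "\<And>v. v \<in> B \<Longrightarrow> (\<Sum>s\<in>S'. \<gamma> s * (M s v - M s w / M s0 w * M s0 v)) = 0"
      using insert.IH[of S' "\<lambda>s v. M s v - M s w / M s0 w * M s0 v"] by auto
    define t where "t = - (\<Sum>s\<in>S'. \<gamma> s * M s w) / M s0 w"
    define \<gamma>' where "\<gamma>' = \<gamma>(s0 := t)"
    have sum: "(\<Sum>s\<in>S. \<gamma>' s * M s v) = t * M s0 v + (\<Sum>s\<in>S'. \<gamma> s * M s v)" for v
    proof -
      have "(\<Sum>s\<in>S. \<gamma>' s * M s v) = \<gamma>' s0 * M s0 v + (\<Sum>s\<in>S'. \<gamma>' s * M s v)"
        unfolding S'_def using insert.prems(1) s0(1) by (rule sum.remove)
      moreover have "(\<Sum>s\<in>S'. \<gamma>' s * M s v) = (\<Sum>s\<in>S'. \<gamma> s * M s v)"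
        by (rule sum.cong) (auto simp: \<gamma>'_def S'_def)
      ultimately show ?thesis by (simp add: \<gamma>'_def)
    qed
    have "(\<Sum>s\<in>S. \<gamma>' s * M s w) = 0" unfolding sum using s0 by (simp add: t_def)
    moreover have "(\<Sum>s\<in>S. \<gamma>' s * M s v) = 0" if "v \<in> B" for v
    proof -
      have "(\<Sum>s\<in>S'. \<gamma> s * (M s w / M s0 w * M s0 v)) = (\<Sum>s\<in>S'. \<gamma> s * M s w) / M s0 w * M s0 v"
        by (simp add: sum_distrib_right sum_divide_distrib mult.assoc)
      then show ?thesis using \<gamma>(2)[OF that] unfolding sum
        by (simp add: right_diff_distrib sum_subtractf t_def)
    qed
    moreover have "\<exists>s\<in>S. \<gamma>' s \<noteq> 0" using \<gamma>(1) by (auto simp: \<gamma>'_def S'_def)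
    ultimately have "\<forall>v\<in>insert w B. (\<Sum>s\<in>S. \<gamma>' s * M s v) = 0" "\<exists>s\<in>S. \<gamma>' s \<noteq> 0"
      by (simp_all only: ball_simps simp_thms) blast+
    then show ?thesis by blast
  qed
qed

lemma four_labels:
  assumes "distinct [p, q, r, s :: 4]"
  shows "UNIV = {p, q, r, s}"
  by (rule card_subset_eq[symmetric]) (use assms in auto)

lemma sum_labels:
  assumes "distinct [p, q, r, s :: 4]"
  shows "sum f UNIV = f p + f q + f r + (f s :: 'a::comm_monoid_add)"
  unfolding four_labels[OF assms] using assms by (simp add: ac_simps)

lemma prod_labels:
  assumes "distinct [p, q, r, s :: 4]"
  shows "prod f UNIV = f p * f q * f r * (f s :: 'a::comm_monoid_mult)"
  unfolding four_labels[OF assms] using assms by (simp add: ac_simps)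

lemma UNIV_4': "(UNIV :: 4 set) = {0, 1, 2, 3}"
  by (rule four_labels) simp

lemma sum_4': "sum f (UNIV :: 4 set) = f 0 + f 1 + f 2 + f (3::4)"
  unfolding UNIV_4' by (simp add: ac_simps)

lemma card_exponents: "card {n :: 4 \<Rightarrow> nat. (\<Sum>i\<in>UNIV. n i) = N} = (N + 3) choose 3"
  and finite_exponents: "finite {n :: 4 \<Rightarrow> nat. (\<Sum>i\<in>UNIV. n i) = N}"
proof -
  let ?A = "{n :: 4 \<Rightarrow> nat. (\<Sum>i\<in>UNIV. n i) = N}" and ?L = "{l :: nat list. length l = 4 \<and> sum_list l = N}"
  let ?f = "\<lambda>n :: 4 \<Rightarrow> nat. [n 0, n 1, n 2, n 3]"
  have inj: "inj_on ?f ?A"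
  proof (rule inj_onI)
    fix m n :: "4 \<Rightarrow> nat" assume "?f m = ?f n"
    then have "\<forall>i\<in>UNIV. m i = n i" unfolding UNIV_4' by simp
    then show "m = n" by auto
  qed
  have "?f ` ?A = ?L"
  proof (intro equalityI subsetI)
    fix l assume l: "l \<in> ?L"
    then obtain p q r s where l': "l = [p, q, r, s]"
      by (auto simp: length_Suc_conv eval_nat_numeral)
    define n :: "4 \<Rightarrow> nat" where "n i = (if i = 0 then p else if i = 1 then q else if i = 2 then r else s)" for i
    have "n 0 = p" "n 1 = q" "n 2 = r" "n 3 = s" by (auto simp: n_def)
    then have "l = ?f n" "n \<in> ?A" using l l' by (simp_all add: sum_4')
    then show "l \<in> ?f ` ?A" by blast
  qed (auto simp: sum_4')
  then have bij: "bij_betw ?f ?A ?L" using inj by (auto simp: bij_betw_def)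
  have card_L: "card ?L = (N + 3) choose N"
    using card_length_sum_list[of 4 N] by (simp add: add.commute)
  moreover have "(N + 3) choose N = (N + 3) choose 3" using binomial_symmetric[of N "N + 3"] by simp
  ultimately show "card ?A = (N + 3) choose 3" using bij_betw_same_card[OF bij] by simp
  have "card ?L > 0" using card_L by simp
  then have "finite ?L" by (rule card_ge_0_finite)
  then show "finite ?A" using bij bij_betw_finite by blast
qed

text \<open>The exponent vectors on the right count a basis of the forms of degree \<open>M + e\<close> modulo the
  multiples of a form of degree \<open>e\<close> with leading exponent \<open>\<beta>\<close>. This is the Hilbert function of a
  surface of degree \<open>e\<close>, whose leading term is \<open>e * M\<^sup>2 / 2\<close>.\<close>

lemma card_exponents_not_above:
  assumes "(\<Sum>i\<in>UNIV. \<beta> i) = e"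
  shows "e * M\<^sup>2 \<le> 2 * card {n :: 4 \<Rightarrow> nat. (\<Sum>i\<in>UNIV. n i) = M + e \<and> \<not> (\<forall>i. \<beta> i \<le> n i)}"
proof -
  let ?A = "\<lambda>N. {n :: 4 \<Rightarrow> nat. (\<Sum>i\<in>UNIV. n i) = N}"
  let ?U = "{n \<in> ?A (M + e). \<forall>i. \<beta> i \<le> n i}"
  have "bij_betw (\<lambda>n i. n i + \<beta> i) (?A M) ?U"
    by (rule bij_betw_byWitness[of _ "\<lambda>n i. n i - \<beta> i"])
      (use assms in \<open>auto simp: sum.distrib sum_subtractf_nat fun_eq_iff\<close>)
  from bij_betw_same_card[OF this] have "card ?U = (M + 3) choose 3"
    by (simp only: card_exponents)
  moreover have "{n :: 4 \<Rightarrow> nat. (\<Sum>i\<in>UNIV. n i) = M + e \<and> \<not> (\<forall>i. \<beta> i \<le> n i)} = ?A (M + e) - ?U"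
    by auto
  moreover have "card (?A (M + e) - ?U) = card (?A (M + e)) - card ?U"
    by (rule card_Diff_subset) (auto intro: finite_subset[OF _ finite_exponents])
  moreover have "2 * ((M + 3) choose 3) + e * M\<^sup>2 \<le> 2 * ((M + e + 3) choose 3)"
  proof (induction e)
    case (Suc e)
    have "(M + Suc e + 3) choose 3 = ((M + e + 3) choose 2) + ((M + e + 3) choose 3)"
      by (simp add: numeral_3_eq_3 numeral_2_eq_2)
    moreover have "M\<^sup>2 \<le> 2 * ((M + e + 3) choose 2)"
    proof -
      have "2 * ((M + e + 3) choose 2) = (M + e + 3) * (M + e + 2)"
        using Suc_times_binomial[of 1 "M + e + 2"] by (simp add: numeral_3_eq_3 numeral_2_eq_2)
      moreover have "M * M \<le> (M + e + 3) * (M + e + 2)" by (rule mult_le_mono) auto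
      ultimately show ?thesis by (simp add: power2_eq_square)
    qed
    ultimately show ?case using Suc by simp
  qed simp
  ultimately show ?thesis by (simp add: card_exponents)
qed

section \<open>Polynomials in an affine chart\<close>

interpretation aff: coeff_hom "\<lambda>c::complex. [:[:c:]:]"
  by unfold_locales (auto simp: one_pCons)

lemma coeff_order_0: "p \<noteq> 0 \<Longrightarrow> coeff p (order 0 p) \<noteq> (0::'a::idom)"
proof -
  assume "p \<noteq> 0"
  then obtain q where q: "p = [:- 0, 1:] ^ order 0 p * q" "\<not> [:- 0, 1:] dvd q"
    using order_decomp by blast
  have "p = monom 1 (order 0 p) * q" using q(1) by (simp add: monom_altdef)
  then have "coeff p (order 0 p) = coeff q 0" by (metis coeff_monom_mult diff_self_eq_0 less_irrefl mult_1)
  moreover have "coeff q 0 \<noteq> 0" using q(2) by (metis minus_zero poly_0_coeff_0 poly_eq_0_iff_dvd)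
  ultimately show ?thesis by simp
qed

text \<open>Behaviour of a power of a linear system along the line \<open>t = 0\<close>: the coefficient of \<open>t ^ j\<close> of an
  element of the \<open>N\<close>-th power is divisible by \<open>q ^ (N - j)\<close> and loses \<open>\<beta> * (N - j)\<close> degrees
  at infinity. The condition is multiplicative.\<close>

definition along_line :: "complex poly \<Rightarrow> nat \<Rightarrow> nat \<Rightarrow> nat \<Rightarrow> complex poly poly \<Rightarrow> bool" where
  "along_line q \<beta> D N F \<longleftrightarrow> (\<forall>j. coeff F j \<noteq> 0 \<longrightarrow>
     q ^ (N - j) dvd coeff F j \<and> degree (coeff F j) + j + \<beta> * (N - j) \<le> D)"

lemma along_line_mult:
  assumes F: "along_line q \<beta> D N F" and G: "along_line q \<beta> D' N' G"
  shows "along_line q \<beta> (D + D') (N + N') (F * G)"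
  unfolding along_line_def
proof safe
  fix j assume nz: "coeff (F * G) j \<noteq> 0"
  let ?term = "\<lambda>i. coeff F i * coeff G (j - i)"
  have eq: "coeff (F * G) j = (\<Sum>i\<le>j. ?term i)" by (simp add: coeff_mult)
  have exp: "N + N' - j \<le> (N - i) + (N' - (j - i))" if "i \<le> j" for i using that by auto
  show "q ^ (N + N' - j) dvd coeff (F * G) j"
    unfolding eq
  proof (rule dvd_sum)
    fix i assume "i \<in> {..j}"
    then have i: "i \<le> j" by simp
    show "q ^ (N + N' - j) dvd ?term i"
    proof (cases "?term i = 0")
      case False
      then have "q ^ (N - i) * q ^ (N' - (j - i)) dvd ?term i"
        using F G by (intro mult_dvd_mono) (auto simp: along_line_def)
      then show ?thesis
        using le_imp_power_dvd[OF exp[OF i], of q] dvd_trans unfolding power_add by blast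
    qed (simp only: dvd_0_right)
  qed
  have deg: "degree (?term i) + j + \<beta> * (N + N' - j) \<le> D + D'" if i: "i \<le> j" and "?term i \<noteq> 0" for i
  proof -
    have "degree (coeff F i) + i + \<beta> * (N - i) \<le> D"
      "degree (coeff G (j - i)) + (j - i) + \<beta> * (N' - (j - i)) \<le> D'"
      using F G that by (auto simp: along_line_def)
    moreover have "degree (?term i) \<le> degree (coeff F i) + degree (coeff G (j - i))"
      by (rule degree_mult_le)
    moreover have "\<beta> * (N + N' - j) \<le> \<beta> * (N - i) + \<beta> * (N' - (j - i))"
      using exp[OF i] by (metis distrib_left mult_le_mono2)
    ultimately show ?thesis using i by linarith
  qed
  obtain i0 where "i0 \<in> {..j}" "?term i0 \<noteq> 0"
    using nz unfolding eq by (meson sum.not_neutral_contains_not_neutral)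
  with deg[of i0] have le: "j + \<beta> * (N + N' - j) \<le> D + D'" by simp
  have "degree (coeff (F * G) j) \<le> D + D' - (j + \<beta> * (N + N' - j))"
    unfolding eq
  proof (rule degree_sum_le)
    fix i assume "i \<in> {..j}"
    then show "degree (?term i) \<le> D + D' - (j + \<beta> * (N + N' - j))"
      using deg[of i] by (cases "?term i = 0") auto
  qed simp
  then show "degree (coeff (F * G) j) + j + \<beta> * (N + N' - j) \<le> D + D'" using le by linarith
qed

lemma along_line_const: "along_line q \<beta> 0 0 [:[:c:]:]"
  by (auto simp: along_line_def coeff_pCons split: nat.split)

lemma along_line_power: "along_line q \<beta> D N F \<Longrightarrow> along_line q \<beta> (n * D) (n * N) (F ^ n)"
proof (induction n)
  case 0
  then show ?case using along_line_const[of q \<beta> 1] by (simp add: one_pCons)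
qed (auto intro: along_line_mult)

lemma along_line_prod:
  "finite A \<Longrightarrow> (\<And>x. x \<in> A \<Longrightarrow> along_line q \<beta> (D x) (N x) (F x)) \<Longrightarrow>
    along_line q \<beta> (\<Sum>x\<in>A. D x) (\<Sum>x\<in>A. N x) (\<Prod>x\<in>A. F x)"
proof (induction A rule: finite_induct)
  case empty
  then show ?case using along_line_const[of q \<beta> 1] by (simp add: one_pCons)
qed (auto intro: along_line_mult)

lemma along_line_sum:
  assumes "\<And>x. x \<in> A \<Longrightarrow> along_line q \<beta> D N (F x)"
  shows "along_line q \<beta> D N (sum F A)"
  unfolding along_line_def
proof safe
  fix j assume nz: "coeff (sum F A) j \<noteq> 0"
  have eq: "coeff (sum F A) j = (\<Sum>x\<in>A. coeff (F x) j)" by (simp add: coeff_sum)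
  have fin: "finite A" using nz by (metis coeff_0 sum.infinite)
  show "q ^ (N - j) dvd coeff (sum F A) j"
    unfolding eq by (rule dvd_sum) (use assms in \<open>force simp: along_line_def\<close>)
  obtain x where x: "x \<in> A" "coeff (F x) j \<noteq> 0"
    using nz unfolding eq by (meson sum.not_neutral_contains_not_neutral)
  have le: "j + \<beta> * (N - j) \<le> D" using assms[OF x(1)] x(2) unfolding along_line_def by fastforce
  have "degree (coeff (sum F A) j) \<le> D - (j + \<beta> * (N - j))"
    unfolding eq
  proof (rule degree_sum_le[OF fin])
    fix x assume "x \<in> A"
    then show "degree (coeff (F x) j) \<le> D - (j + \<beta> * (N - j))"
      using assms[of x] unfolding along_line_def by (cases "coeff (F x) j = 0") auto
  qed
  then show "degree (coeff (sum F A) j) + j + \<beta> * (N - j) \<le> D" using le by linarith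
qed

text \<open>The pairs \<open>(j, i)\<close> such that \<open>t ^ j * x ^ i\<close> can be the lowest term in \<open>x\<close> of the coefficient of
  \<open>t ^ j\<close>. In column \<open>j\<close> this leaves the degree \<open>d * N - j\<close> of a form on the line minus its \<open>d * (N - j)\<close>
  prescribed zeros, counted at the three points \<open>x = 0\<close>, \<open>x = -1\<close> and infinity.\<close>

definition coeff_box :: "nat \<Rightarrow> nat \<Rightarrow> nat \<Rightarrow> (nat \<times> nat) set" where
  "coeff_box \<alpha> d N = Sigma {0..d * N} (\<lambda>j. {\<alpha> * (N - j)..\<alpha> * (N - j) + (d * N - j - d * (N - j))})"

text \<open>The order of vanishing at \<open>x = 0\<close> of a nonzero coefficient is at least \<open>\<alpha> * (N - j)\<close>, and it
  exceeds this number by at most the degree of the part without prescribed zeros.\<close>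

lemma coeff_box_nonzero:
  assumes F: "along_line ([:0, 1:] ^ \<alpha> * [:1, 1:] ^ \<gamma>) \<beta> (d * N) N F" "F \<noteq> 0" and d: "\<alpha> + \<beta> + \<gamma> = d"
  shows "\<exists>(j, i)\<in>coeff_box \<alpha> d N. coeff (coeff F j) i \<noteq> 0"
proof -
  obtain j where j: "coeff F j \<noteq> 0" using F(2) by (metis leading_coeff_0_iff)
  let ?L = "coeff F j" and ?n = "N - j"
  have dvd: "([:0, 1:] ^ \<alpha> * [:1, 1:] ^ \<gamma>) ^ ?n dvd ?L" and deg: "degree ?L + j + \<beta> * ?n \<le> d * N"
    using F(1) j by (auto simp: along_line_def)
  then obtain L' where "?L = ([:0, 1:] ^ \<alpha> * [:1, 1:] ^ \<gamma>) ^ ?n * L'" by blast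
  then have L: "?L = [:0, 1:] ^ (\<alpha> * ?n) * ([:1, 1:] ^ (\<gamma> * ?n) * L')"
    by (simp add: power_mult_distrib power_mult ac_simps)
  have L': "L' \<noteq> 0" using L j by auto
  have ord: "order 0 ?L = \<alpha> * ?n + order 0 L'"
  proof -
    have "order 0 ([:0, 1:] ^ (\<alpha> * ?n) :: complex poly) = \<alpha> * ?n"
      using order_power_n_n[of "0::complex" "\<alpha> * ?n"] by simp
    moreover have "order 0 ([:1, 1:] ^ (\<gamma> * ?n) :: complex poly) = 0" by (rule order_0I) simp
    ultimately show ?thesis using L' unfolding L by (simp add: order_mult)
  qed
  have "degree ?L = \<alpha> * ?n + \<gamma> * ?n + degree L'"
    using L' unfolding L by (simp add: degree_mult_eq degree_power_eq)
  then have "degree L' + (d * ?n + j) \<le> d * N"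
    using deg d by (auto simp: algebra_simps)
  moreover have "order 0 L' \<le> degree L'" using L' by (rule order_degree)
  ultimately have "(j, order 0 ?L) \<in> coeff_box \<alpha> d N"
    by (auto simp: coeff_box_def ord)
  then show ?thesis using coeff_order_0[OF j] by blast
qed

lemma card_coeff_box:
  assumes "d > 0"
  shows "2 * card (coeff_box \<alpha> d N) \<le> d * (d - 1) * N\<^sup>2 + 2 * d * N + 2"
proof -
  obtain k where k: "d = Suc k" using assms by (cases d) auto
  have gauss: "2 * (\<Sum>i\<le>n. i) = n * (n + 1)" for n :: nat by (induction n) auto
  have "card (coeff_box \<alpha> d N) = (\<Sum>j\<in>{0..d * N}. d * N - j - d * (N - j) + 1)"
    by (simp add: coeff_box_def)
  also have "{0..d * N} = {..N} \<union> {N<..N + k * N}" by (auto simp: k)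
  also have "(\<Sum>j\<in>{..N} \<union> {N<..N + k * N}. d * N - j - d * (N - j) + 1)
     = (\<Sum>j\<in>{..N}. d * N - j - d * (N - j) + 1) + (\<Sum>j\<in>{N<..N + k * N}. d * N - j - d * (N - j) + 1)"
    by (rule sum.union_disjoint) auto
  also have "(\<Sum>j\<in>{..N}. d * N - j - d * (N - j) + 1) = (\<Sum>j\<le>N. k * j + 1)"
  proof (rule sum.cong)
    fix j assume "j \<in> {..N}"
    then obtain m where "N = j + m" by (auto simp: le_iff_add)
    then show "d * N - j - d * (N - j) + 1 = k * j + 1" by (simp add: k algebra_simps)
  qed simp
  also have "(\<Sum>j\<in>{N<..N + k * N}. d * N - j - d * (N - j) + 1) = (\<Sum>i\<in>{0<..k * N}. i)"
    by (rule sum.reindex_bij_witness[of _ "\<lambda>i. N + k * N + 1 - i" "\<lambda>j. N + k * N + 1 - j"])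
      (auto simp: k)
  also have "(\<Sum>i\<in>{0<..k * N}. i) = (\<Sum>i\<le>k * N. i)"
    by (rule sum.mono_neutral_left) auto
  also have "(\<Sum>j\<le>N. k * j + 1) = k * (\<Sum>j\<le>N. j) + (N + 1)"
    by (simp add: sum_Suc sum_distrib_left)
  finally have "2 * card (coeff_box \<alpha> d N) = k * (2 * (\<Sum>j\<le>N. j)) + 2 * (N + 1) + 2 * (\<Sum>i\<le>k * N. i)"
    by simp
  then have "2 * card (coeff_box \<alpha> d N) = k * (N * (N + 1)) + 2 * (N + 1) + k * N * (k * N + 1)"
    by (simp only: gauss)
  then show ?thesis by (simp add: k power2_eq_square algebra_simps)
qed

text \<open>Only the quadratic terms matter for large \<open>M\<close>.\<close>

lemma quadratic_growth_bound:
  assumes "\<And>M::nat. e * M\<^sup>2 \<le> P * (M + e)\<^sup>2 + 2 * d * (M + e) + 2"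
  shows "e \<le> P"
proof (rule ccontr)
  assume "\<not> e \<le> P"
  then have e: "Suc P \<le> e" by simp
  define A where "A = 2 * P * e + 2 * d"
  define C where "C = P * e\<^sup>2 + 2 * d * e + 2"
  \<comment> \<open>Large enough for \<open>M\<^sup>2\<close> to exceed \<open>A * M + C\<close>.\<close>
  define M where "M = A + C + 1"
  have "Suc P * M\<^sup>2 \<le> P * (M + e)\<^sup>2 + 2 * d * (M + e) + 2"
    using assms[of M] e by (meson le_trans mult_le_mono1)
  also have "\<dots> = P * M\<^sup>2 + A * M + C"
    by (simp add: A_def C_def power2_eq_square algebra_simps)
  finally have "M\<^sup>2 \<le> A * M + C" by simp
  moreover have "M\<^sup>2 = A * M + C * M + M" by (simp add: M_def power2_eq_square algebra_simps)
  moreover have "C \<le> C * M" by (simp add: M_def)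
  moreover have "M > 0" by (simp add: M_def)
  ultimately show False by linarith
qed

lemma homogeneous_add: "homogeneous k p \<Longrightarrow> homogeneous k q \<Longrightarrow> homogeneous k (p + q)"
  using keys_add[of p q] unfolding homogeneous_iff by blast

lemma homogeneous_uminus: "homogeneous k (- p) \<longleftrightarrow> homogeneous k p"
  by (simp add: homogeneous_iff in_keys_iff)

lemma homogeneous_subst_linear:
  assumes "homogeneous k p" "\<And>i. homogeneous 1 (F i)"
  shows "homogeneous k (subst_poly p F)"
  unfolding subst_poly_def
proof (rule homogeneous_sum)
  fix m assume m: "m \<in> Poly_Mapping.keys p"
  have pow: "homogeneous n (F i ^ n)" for i n
  proof (induction n)
    case (Suc n)
    then show ?case using homogeneous_mult[OF assms(2) Suc] by simp
  qed (simp add: homogeneous_iff mdeg_def)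
  have "homogeneous (\<Sum>i\<in>A. lk m i) (\<Prod>i\<in>A. F i ^ lk m i)" for A
  proof (induction A rule: infinite_finite_induct)
    case (insert x A)
    then show ?case using homogeneous_mult[OF pow insert.IH] by simp
  qed (simp_all add: homogeneous_iff mdeg_def)
  moreover have "(\<Sum>i\<in>UNIV. lk m i) = k" using assms(1) m by (simp add: homogeneous_def)
  ultimately have "homogeneous (0 + k) (sg 0 (lk p m) * (\<Prod>i\<in>UNIV. F i ^ lk m i))"
    by (intro homogeneous_mult) (auto simp: homogeneous_iff mdeg_def)
  then show "homogeneous k (sg 0 (lk p m) * (\<Prod>i\<in>UNIV. F i ^ lk m i))" by simp
qed

section \<open>A Bezout bound for the degree of the inverse\<close>

locale chart =
  fixes t x y z :: 4
  assumes dist: "distinct [t, x, y, z]"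
begin

text \<open>Coordinates on the plane \<open>X 0 + X 1 + X 2 + X 3 = 0\<close> with \<open>X y = 1\<close>.\<close>

definition tau :: "4 \<Rightarrow> complex poly poly" where
  "tau i = (if i = t then [:0, 1:] else if i = x then [:[:0, 1:]:] else if i = y then 1 else [:- [:1, 1:], - 1:])"

lemma tau_simps: "tau t = [:0, 1:]" "tau x = [:[:0, 1:]:]" "tau y = 1" "tau z = [:- [:1, 1:], - 1:]"
  using dist by (auto simp: tau_def)

lemma along_line_tau: "along_line q \<beta> 1 0 (tau i)"
  by (auto simp: tau_def along_line_def coeff_pCons split: nat.splits if_splits)

lemma along_line_tau_t: "along_line q \<beta> 1 1 (tau t)"
  by (auto simp: tau_simps along_line_def coeff_pCons split: nat.splits if_splits)

text \<open>Modulo the sum of the variables \<open>X z\<close> can be eliminated, and a form in the three remaining variables is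
  determined by its values for \<open>X y = 1\<close>.\<close>

lemma sum_X_dvd_if_chart_zero:
  assumes H: "homogeneous k H" and zero: "aff.ins tau H = 0"
  shows "(\<Sum>i\<in>UNIV. X i) dvd H"
proof -
  let ?s = "\<Sum>i\<in>UNIV. X i"
  define F where "F = X(z := - (X t + X x + X y))"
  define Q where "Q = subst_poly H F"
  have "X z - F z = ?s" by (simp add: F_def sum_labels[OF dist] algebra_simps)
  then have "?s dvd X i - F i" for i
    by (cases "i = z") (simp_all add: F_def)
  then have diff: "?s dvd H - Q"
    using subst.ins_cong_mod[of ?s X F H] by (simp add: Q_def)
  have "aff.ins tau (F i) = tau i" for i
    using dist by (auto simp: F_def aff.ins_simps tau_simps one_pCons)
  then have Q0: "aff.ins tau Q = 0" using zero by (simp add: Q_def aff.ins_subst)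
  have X_hom: "homogeneous 1 (X i)" for i
    by (simp add: homogeneous_iff X_eq_delta mdeg_def)
  have "homogeneous 1 (- (X t + X x + X y))"
    by (simp only: homogeneous_uminus) (intro homogeneous_add X_hom)
  then have F_hom: "homogeneous 1 (F i)" for i using X_hom by (simp add: F_def)
  have Q_hom: "homogeneous k Q" unfolding Q_def using H F_hom by (rule homogeneous_subst_linear)
  have "subst_poly (F i) (X(z := 0)) = F i" for i
    using dist by (auto simp: F_def subst.ins_simps)
  then have "subst_poly Q (X(z := 0)) = Q" by (simp add: Q_def subst.ins_subst)
  then have Q_z: "lk m z = 0" if "m \<in> Poly_Mapping.keys Q" for m
    using lookup_subst_zero[of Q z m] that by (auto simp: in_keys_iff split: if_splits)
  have "Q = 0"
  proof (rule ccontr)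
    assume "Q \<noteq> 0"
    then obtain m0 where m0: "m0 \<in> Poly_Mapping.keys Q" by (metis equals0I keys_eq_empty)
    have trm: "[:[:lk Q m:]:] * (\<Prod>i\<in>UNIV. tau i ^ lk m i) = monom (monom (lk Q m) (lk m x)) (lk m t)"
      if "m \<in> Poly_Mapping.keys Q" for m
    proof -
      have const_pow: "[:u:] ^ n = [:u ^ n:]" for n :: nat and u :: "complex poly"
        by (induction n) (auto simp: one_pCons)
      have "[:[:lk Q m:]:] * (\<Prod>i\<in>UNIV. tau i ^ lk m i)
          = [:[:lk Q m:]:] * ([:0, 1:] ^ lk m t * [:[:0, 1:] ^ lk m x:])"
        using Q_z[OF that] by (simp add: prod_labels[OF dist] tau_simps const_pow del: mult_pCons_left mult_pCons_right)
      also have "\<dots> = smult ([:lk Q m:] * [:0, 1:] ^ lk m x) ([:0, 1:] ^ lk m t)"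
        by (simp add: ac_simps)
      also have "[:lk Q m:] * [:0, 1:] ^ lk m x = monom (lk Q m) (lk m x)"
        by (simp add: monom_altdef)
      also have "smult (monom (lk Q m) (lk m x)) ([:0, 1:] ^ lk m t) = monom (monom (lk Q m) (lk m x)) (lk m t)"
        by (simp only: monom_altdef)
      finally show ?thesis .
    qed
    have "coeff (coeff (aff.ins tau Q) (lk m0 t)) (lk m0 x)
      = (\<Sum>m\<in>Poly_Mapping.keys Q. coeff (coeff ([:[:lk Q m:]:] * (\<Prod>i\<in>UNIV. tau i ^ lk m i)) (lk m0 t)) (lk m0 x))"
      by (simp add: aff.ins_def coeff_sum)
    also have "\<dots> = (\<Sum>m\<in>Poly_Mapping.keys Q. if m = m0 then lk Q m else 0)"
    proof (rule sum.cong)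
      fix m assume m: "m \<in> Poly_Mapping.keys Q"
      have "m = m0" if "lk m t = lk m0 t" "lk m x = lk m0 x"
      proof (rule poly_mapping_eqI)
        fix i
        have "lk m z = lk m0 z" using Q_z m m0 by simp
        moreover have "(\<Sum>i\<in>UNIV. lk m i) = (\<Sum>i\<in>UNIV. lk m0 i)"
          using Q_hom m m0 by (simp add: homogeneous_def)
        ultimately have "lk m y = lk m0 y" using that by (simp add: sum_labels[OF dist])
        moreover have "i \<in> {t, x, y, z}" using four_labels[OF dist] by auto
        ultimately show "lk m i = lk m0 i" using that \<open>lk m z = lk m0 z\<close> by auto
      qed
      then show "coeff (coeff ([:[:lk Q m:]:] * (\<Prod>i\<in>UNIV. tau i ^ lk m i)) (lk m0 t)) (lk m0 x)
          = (if m = m0 then lk Q m else 0)"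
        unfolding trm[OF m] by auto
    qed simp
    also have "\<dots> = lk Q m0" using m0 by simp
    finally show False using Q0 m0 by (simp add: in_keys_iff)
  qed
  then show ?thesis using diff by simp
qed

end

text \<open>Every monomial of the map except \<open>r\<close> is divisible by \<open>X t\<close>. Therefore, eliminating the
  monomial \<open>r\<close> from two general members of the linear system leaves \<open>X t\<close> times a form of degree \<open>d - 1\<close>.
  The preimage of a general line, a curve of degree \<open>e\<close>, then lies on surfaces of degrees \<open>d\<close> and \<open>d - 1\<close>, which suggests
  \<open>e \<le> d * (d - 1)\<close>. Instead of intersecting surfaces, the proof below compares dimensions: the
  products of \<open>N\<close> monomials of the map, restricted to the plane \<open>\<Sum>i. X i = 0\<close>, span a space
  of dimension about \<open>e * N\<^sup>2 / 2\<close>, because the image of this plane is a surface of degree \<open>e\<close>; their behaviour along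
  the line \<open>X t = 0\<close> of the plane bounds the dimension by about \<open>d * (d - 1) * N\<^sup>2 / 2\<close>.\<close>

locale inverse_pair_chart = inverse_pair + chart +
  fixes r :: 4
  assumes at: "\<And>r'. a r' t = 0 \<longleftrightarrow> r' = r"
begin

definition W :: "4 \<Rightarrow> complex poly poly" where
  "W r' = aff.ins tau (mon (a r'))"

lemma W_eq: "W r' = (\<Prod>i\<in>UNIV. tau i ^ a r' i)"
  by (simp add: W_def mon_eq_prod aff.ins_simps)

lemma along_line_W:
  "along_line ([:0, 1:] ^ a r x * [:1, 1:] ^ a r z) (a r y) d 1 (W r')"
proof -
  let ?q = "[:0, 1:] ^ a r x * [:1, 1:] ^ a r z :: complex poly"
  have tau_pow: "along_line ?q (a r y) n 0 (tau i ^ n)" for i n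
    using along_line_power[OF along_line_tau, of ?q "a r y" n i] by simp
  show ?thesis
  proof (cases "r' = r")
    case False
    then obtain m where m: "a r' t = Suc m" using at[of r'] by (cases "a r' t") auto
    have "W r' = tau t * (tau t ^ m * tau x ^ a r' x * tau y ^ a r' y * tau z ^ a r' z)"
      by (simp add: W_eq prod_labels[OF dist] m ac_simps)
    moreover have "along_line ?q (a r y) (1 + (m + a r' x + a r' y + a r' z)) (1 + (0 + 0 + 0 + 0))
       (tau t * (tau t ^ m * tau x ^ a r' x * tau y ^ a r' y * tau z ^ a r' z))"
      by (intro along_line_mult along_line_tau_t tau_pow)
    moreover have "1 + (m + a r' x + a r' y + a r' z) = d"
      using row_a[of r'] by (simp add: sum_labels[OF dist] m)
    ultimately show ?thesis by simp
  next
    case True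
    have "along_line ?q (a r y) (\<Sum>i\<in>UNIV. a r i) (\<Sum>i\<in>(UNIV :: 4 set). 0) (W r)"
      unfolding W_eq by (rule along_line_prod) (auto intro: tau_pow)
    then have TD: "along_line ?q (a r y) d 0 (W r)" by (simp add: row_a)
    have d: "d = a r x + a r y + a r z"
      using row_a[of r] at[of r] by (simp add: sum_labels[OF dist])
    have "coeff (W r) 0 = poly (W r) 0" by (simp add: poly_0_coeff_0)
    also have "\<dots> = [:0, 1:] ^ a r x * (- [:1, 1:]) ^ a r z"
      using at[of r] by (simp add: W_eq prod_labels[OF dist] tau_simps)
    finally have c0: "coeff (W r) 0 = [:0, 1:] ^ a r x * (- [:1, 1:]) ^ a r z" .
    have "?q dvd coeff (W r) 0"
      unfolding c0 by (intro mult_dvd_mono dvd_refl dvd_power_same) (simp only: dvd_minus_iff dvd_refl)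
    moreover have "degree (coeff (W r) 0) \<le> a r x + a r z"
    proof -
      have "degree (coeff (W r) 0) \<le> degree ([:0, 1:] ^ a r x :: complex poly) + degree ((- [:1, 1:]) ^ a r z :: complex poly)"
        unfolding c0 by (rule degree_mult_le)
      moreover have "degree ([:0, 1:] ^ a r x :: complex poly) \<le> a r x"
        using degree_power_le[of "[:0, 1::complex:]" "a r x"] by simp
      moreover have "degree ((- [:1, 1:]) ^ a r z :: complex poly) \<le> a r z"
        using degree_power_le[of "- [:1, 1::complex:]" "a r z"] by simp
      ultimately show ?thesis by linarith
    qed
    ultimately have "along_line ?q (a r y) d 1 (W r)"
      unfolding along_line_def
    proof (intro allI impI)
      fix j assume nz: "coeff (W r) j \<noteq> 0"
      show "?q ^ (1 - j) dvd coeff (W r) j \<and> degree (coeff (W r) j) + j + a r y * (1 - j) \<le> d"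
      proof (cases j)
        case 0
        then show ?thesis using \<open>?q dvd coeff (W r) 0\<close> \<open>degree (coeff (W r) 0) \<le> a r x + a r z\<close> d by simp
      next
        case (Suc i)
        then show ?thesis using TD nz by (auto simp: along_line_def)
      qed
    qed
    then show ?thesis using True by simp
  qed
qed

text \<open>The image of the plane under the map is the surface \<open>\<Sum>k. X^(b k) = 0\<close> of degree \<open>e\<close>. A form that
  vanishes on it is a multiple of this equation, so a form without multiples of its leading
  monomial does not vanish on it.\<close>

definition lead :: "4 \<Rightarrow> nat" where
  "lead = lk (Max (Poly_Mapping.keys (\<Sum>k\<in>UNIV. mon (b k))))"

lemma sum_lead: "(\<Sum>i\<in>UNIV. lead i) = e"
proof -
  have "Max (Poly_Mapping.keys (\<Sum>k\<in>UNIV. mon (b k))) \<in> (\<lambda>k. expv (b k)) ` UNIV"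
    unfolding keys_sum_mon[OF finite] by (rule Max_in) auto
  then show ?thesis unfolding lead_def using row_b by auto
qed

lemma restricted_monomials_independent:
  assumes S: "finite S" "\<And>n. n \<in> S \<Longrightarrow> (\<Sum>i\<in>UNIV. n i) = N \<and> \<not> (\<forall>i. lead i \<le> n i)"
    and zero: "(\<Sum>n\<in>S. [:[:\<gamma> n:]:] * (\<Prod>k\<in>UNIV. W k ^ n k)) = 0" and n: "n \<in> S"
  shows "\<gamma> n = 0"
proof -
  define G where "G = (\<Sum>n\<in>S. sg (expv n) (\<gamma> n))"
  define H where "H = subst_poly G (\<lambda>k. mon (a k))"
  let ?g = "\<Sum>k\<in>UNIV. mon (b k)"
  have G_hom: "homogeneous N G"
    unfolding G_def by (rule homogeneous_sum) (use S(2) in \<open>auto simp: homogeneous_def\<close>)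
  have "aff.ins tau H = aff.ins W G"
    unfolding H_def aff.ins_subst W_def[abs_def] ..
  also have "\<dots> = 0" using zero by (simp add: G_def aff.ins_sum aff.ins_single)
  finally have H0: "aff.ins tau H = 0" .
  have "homogeneous (d * N) H"
    unfolding H_def subst_poly_def
  proof (rule homogeneous_sum)
    fix m assume "m \<in> Poly_Mapping.keys G"
    then have m: "(\<Sum>i\<in>UNIV. lk m i) = N" using G_hom by (simp add: homogeneous_def)
    have "(\<Sum>j\<in>UNIV. \<Sum>k\<in>UNIV. lk m k * a k j) = (\<Sum>k\<in>UNIV. \<Sum>j\<in>UNIV. lk m k * a k j)" by (rule sum.swap)
    also have "\<dots> = N * d" using m by (simp add: row_a flip: sum_distrib_left sum_distrib_right)
    finally have "mdeg (expv (\<lambda>j. \<Sum>k\<in>UNIV. lk m k * a k j)) = d * N" by (simp add: mdeg_def)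
    moreover have "sg 0 (lk G m) * (\<Prod>k\<in>UNIV. mon (a k) ^ lk m k) = sg (expv (\<lambda>j. \<Sum>k\<in>UNIV. lk m k * a k j)) (lk G m)"
      by (simp add: mon_power mon_prod) (simp add: mon_def mult_single)
    ultimately show "homogeneous (d * N) (sg 0 (lk G m) * (\<Prod>k\<in>UNIV. mon (a k) ^ lk m k))"
      by (simp add: homogeneous_iff)
  qed
  then have "(\<Sum>i\<in>UNIV. X i) dvd H" using H0 by (rule sum_X_dvd_if_chart_zero)
  then have "subst_poly (\<Sum>i\<in>UNIV. X i) (\<lambda>k. mon (b k)) dvd subst_poly H (\<lambda>k. mon (b k))"
    by (rule subst.ins_dvd)
  moreover have "subst_poly (\<Sum>i\<in>UNIV. X i) (\<lambda>k. mon (b k)) = ?g" by (simp add: subst.ins_simps)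
  moreover have "subst_poly H (\<lambda>k. mon (b k)) = subst_poly G (\<lambda>k. mon c * X k)"
    unfolding H_def subst.ins_subst subst_mon ab by (simp add: X_eq_delta mon_mult)
  ultimately have "?g dvd mon (\<lambda>i. N * c i) * G"
    using homogeneous_subst_rescale[OF G_hom] by simp
  moreover have "\<not> X l dvd ?g" for l
  proof
    assume "X l dvd ?g"
    moreover obtain k where "b k l = 0" using zero_b by blast
    moreover have "expv (b k) \<in> Poly_Mapping.keys ?g" by (auto simp: keys_sum_mon)
    ultimately show False using X_dvd_keys by fastforce
  qed
  ultimately have "?g dvd G" by (rule cancel_mon_dvd)
  then obtain h where h: "G = ?g * h" by blast
  have "G = 0"
  proof (rule ccontr)
    assume "G \<noteq> 0"
    then have nz: "?g \<noteq> 0" "h \<noteq> 0" using h by auto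
    then have "Max (Poly_Mapping.keys ?g) + Max (Poly_Mapping.keys h) \<in> Poly_Mapping.keys G"
      unfolding h by (rule Max_keys_mult)
    moreover have "Poly_Mapping.keys G \<subseteq> expv ` S"
    proof
      fix m assume "m \<in> Poly_Mapping.keys G"
      then have "(\<Sum>n\<in>S. lk (sg (expv n) (\<gamma> n)) m) \<noteq> 0" by (simp add: G_def in_keys_iff lookup_sum)
      then obtain n where "n \<in> S" "lk (sg (expv n) (\<gamma> n)) m \<noteq> 0" by (meson sum.not_neutral_contains_not_neutral)
      then show "m \<in> expv ` S" by (auto simp: lookup_single when_def split: if_splits)
    qed
    ultimately obtain n where n: "n \<in> S" "Max (Poly_Mapping.keys ?g) + Max (Poly_Mapping.keys h) = expv n" by blast
    then have "n = lk (Max (Poly_Mapping.keys ?g) + Max (Poly_Mapping.keys h))" by simp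
    then have "lead i \<le> n i" for i by (simp add: lead_def lookup_add)
    then show False using S(2)[OF n(1)] by blast
  qed
  moreover have "lk G (expv n) = (\<Sum>m\<in>S. if m = n then \<gamma> m else 0)"
    unfolding G_def lookup_sum by (rule sum.cong) (auto simp: lookup_single when_def)
  ultimately show ?thesis using n S(1) by simp
qed

text \<open>If there were more independent products than positions in \<open>coeff_box\<close>, some nontrivial combination of
  them would vanish at all these positions and hence be zero.\<close>

lemma degree_bound: "e \<le> d * (d - 1)"
proof (rule quadratic_growth_bound)
  fix M :: nat
  define N where "N = M + e"
  let ?S = "{n :: 4 \<Rightarrow> nat. (\<Sum>i\<in>UNIV. n i) = N \<and> \<not> (\<forall>i. lead i \<le> n i)}"
  let ?B = "coeff_box (a r x) d N"
  let ?q = "[:0, 1:] ^ a r x * [:1, 1:] ^ a r z :: complex poly"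
  define P where "P n = (\<Prod>k\<in>UNIV. W k ^ n k)" for n
  have fin_S: "finite ?S" by (rule finite_subset[OF _ finite_exponents[of N]]) auto
  have fin_B: "finite ?B" by (auto simp: coeff_box_def)
  have sum_r: "a r x + a r y + a r z = d"
    using row_a[of r] at[of r] by (simp add: sum_labels[OF dist])
  have "card ?S \<le> card ?B"
  proof (rule ccontr)
    assume "\<not> card ?S \<le> card ?B"
    then have "card ?B < card ?S" by simp
    then obtain \<gamma> where \<gamma>: "\<exists>n\<in>?S. \<gamma> n \<noteq> 0"
      "\<And>v. v \<in> ?B \<Longrightarrow> (\<Sum>n\<in>?S. \<gamma> n * coeff (coeff (P n) (fst v)) (snd v)) = 0"
      using homogeneous_system_nontrivial[OF fin_B fin_S, of "\<lambda>n v. coeff (coeff (P n) (fst v)) (snd v)"] by auto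
    define F where "F = (\<Sum>n\<in>?S. [:[:\<gamma> n:]:] * P n)"
    have "along_line ?q (a r y) (d * N) N F"
      unfolding F_def
    proof (rule along_line_sum)
      fix n assume n: "n \<in> ?S"
      have "along_line ?q (a r y) (\<Sum>k\<in>UNIV. n k * d) (\<Sum>k\<in>UNIV. n k * 1) (P n)"
        unfolding P_def by (rule along_line_prod) (auto intro!: along_line_power[OF along_line_W, simplified])
      moreover have "(\<Sum>k\<in>UNIV. n k * d) = d * N" "(\<Sum>k\<in>UNIV. n k * 1) = N"
        using n by (simp_all flip: sum_distrib_right)
      ultimately have "along_line ?q (a r y) (d * N) N (P n)" by (simp only:)
      then show "along_line ?q (a r y) (d * N) N ([:[:\<gamma> n:]:] * P n)"
        using along_line_mult[OF along_line_const] by fastforce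
    qed
    then have nz: "F \<noteq> 0 \<Longrightarrow> \<exists>(j, i)\<in>?B. coeff (coeff F j) i \<noteq> 0"
      by (rule coeff_box_nonzero[OF _ _ sum_r])
    have "coeff (coeff F j) i = 0" if "(j, i) \<in> ?B" for j i
      using \<gamma>(2)[OF that] by (simp add: F_def coeff_sum)
    then have "F = 0" using nz by auto
    have "\<gamma> n = 0" if "n \<in> ?S" for n
    proof (rule restricted_monomials_independent[OF fin_S _ _ that])
      show "(\<Sum>n\<in>?S. [:[:\<gamma> n:]:] * (\<Prod>k\<in>UNIV. W k ^ n k)) = 0"
        using \<open>F = 0\<close> by (simp only: F_def P_def)
    qed simp
    then show False using \<gamma>(1) by blast
  qed
  moreover have "e * M\<^sup>2 \<le> 2 * card ?S"
    unfolding N_def using sum_lead by (rule card_exponents_not_above)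
  ultimately show "e * M\<^sup>2 \<le> d * (d - 1) * (M + e)\<^sup>2 + 2 * d * (M + e) + 2"
    using card_coeff_box[OF d_pos, of "a r x" N] unfolding N_def by linarith
qed

end

section \<open>The determinant\<close>

text \<open>Written out, so that the zeros of a pattern of exponents simplify the determinant at once.\<close>

definition det4 :: "int \<Rightarrow> int \<Rightarrow> int \<Rightarrow> int \<Rightarrow> int \<Rightarrow> int \<Rightarrow> int \<Rightarrow> int \<Rightarrow>
    int \<Rightarrow> int \<Rightarrow> int \<Rightarrow> int \<Rightarrow> int \<Rightarrow> int \<Rightarrow> int \<Rightarrow> int \<Rightarrow> int" where
  "det4 x00 x01 x02 x03 x10 x11 x12 x13 x20 x21 x22 x23 x30 x31 x32 x33 =
    x00 * x11 * x22 * x33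
    + x00 * x12 * x23 * x31
    + x00 * x13 * x21 * x32
    + x01 * x10 * x23 * x32
    + x01 * x12 * x20 * x33
    + x01 * x13 * x22 * x30
    + x02 * x10 * x21 * x33
    + x02 * x11 * x23 * x30
    + x02 * x13 * x20 * x31
    + x03 * x10 * x22 * x31
    + x03 * x11 * x20 * x32
    + x03 * x12 * x21 * x30
    - x00 * x11 * x23 * x32
    - x00 * x12 * x21 * x33
    - x00 * x13 * x22 * x31
    - x01 * x10 * x22 * x33
    - x01 * x12 * x23 * x30
    - x01 * x13 * x20 * x32
    - x02 * x10 * x23 * x31
    - x02 * x11 * x20 * x33
    - x02 * x13 * x21 * x30
    - x03 * x10 * x21 * x32
    - x03 * x11 * x22 * x30
    - x03 * x12 * x20 * x31"

lemma det_eq_det4: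
  fixes M :: "int^4^4"
  shows "det M = det4 (M $ 0 $ 0) (M $ 0 $ 1) (M $ 0 $ 2) (M $ 0 $ 3) (M $ 1 $ 0) (M $ 1 $ 1) (M $ 1 $ 2) (M $ 1 $ 3) (M $ 2 $ 0) (M $ 2 $ 1) (M $ 2 $ 2) (M $ 2 $ 3) (M $ 3 $ 0) (M $ 3 $ 1) (M $ 3 $ 2) (M $ 3 $ 3)"
proof -
  have f: "finite {1, 2, 3 :: 4}" "0 \<notin> {1, 2, 3 :: 4}" "finite {2, 3 :: 4}" "1 \<notin> {2, 3 :: 4}"
    "finite {3 :: 4}" "2 \<notin> {3 :: 4}"
    by auto
  show ?thesis
    unfolding det_def UNIV_4' det4_def
    unfolding sum_over_permutations_insert[OF f(1,2)]
    unfolding sum_over_permutations_insert[OF f(3,4)]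
    unfolding sum_over_permutations_insert[OF f(5,6)]
    unfolding permutes_sing
    by (simp add: sign_swap_id permutation_swap_id sign_compose permutation_compose sign_id swap_id_eq)
qed

text \<open>Modulo \<open>D\<close> the columns add up to zero.\<close>

lemma det4_row_sums:
  assumes "x00 + x01 + x02 + x03 = D" "x10 + x11 + x12 + x13 = D" "x20 + x21 + x22 + x23 = D" "x30 + x31 + x32 + x33 = D"
  shows "D dvd det4 x00 x01 x02 x03 x10 x11 x12 x13 x20 x21 x22 x23 x30 x31 x32 x33"
proof -
  have eq: "x03 = D - x00 - x01 - x02" "x13 = D - x10 - x11 - x12" "x23 = D - x20 - x21 - x22" "x33 = D - x30 - x31 - x32"
    using assms by auto
  have "det4 x00 x01 x02 x03 x10 x11 x12 x13 x20 x21 x22 x23 x30 x31 x32 x33 = D * det4 x00 x01 x02 1 x10 x11 x12 1 x20 x21 x22 1 x30 x31 x32 1"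
    unfolding eq det4_def by (simp add: algebra_simps)
  then show ?thesis by simp
qed

lemma labels_index:
  assumes "distinct [p, q, r, s :: 4]"
  obtains f :: "4 \<Rightarrow> 4" where "bij f" "f 0 = p" "f 1 = q" "f 2 = r" "f 3 = s"
proof -
  define f :: "4 \<Rightarrow> 4" where "f i = (if i = 0 then p else if i = 1 then q else if i = 2 then r else s)" for i
  have f: "f 0 = p" "f 1 = q" "f 2 = r" "f 3 = s" by (auto simp: f_def)
  have "surj f"
  proof -
    have "{p, q, r, s} \<subseteq> range f" using f by (metis insert_subset empty_subsetI rangeI)
    then show ?thesis using four_labels[OF assms] by auto
  qed
  then have "bij f" by (simp add: bij_def finite_UNIV_surj_inj)
  then show thesis using f by (rule that)
qed

context inverse_pair
begin

lemma sum_c: "(\<Sum>j\<in>UNIV. c j) + 1 = d * e"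
proof -
  have "(\<Sum>j\<in>UNIV. c j + delta 0 j) = (\<Sum>j\<in>UNIV. \<Sum>k\<in>UNIV. a 0 k * b k j)" by (simp add: ab)
  also have "\<dots> = (\<Sum>k\<in>UNIV. \<Sum>j\<in>UNIV. a 0 k * b k j)" by (rule sum.swap)
  also have "\<dots> = d * e" by (simp add: row_a row_b flip: sum_distrib_left sum_distrib_right)
  finally show ?thesis by (simp add: sum.distrib)
qed

text \<open>Constant row sums make \<open>d\<close> a divisor of the determinant of \<open>a\<close>, and \<open>e\<close> a divisor of that of \<open>b\<close>. The
  product of the two is the determinant of \<open>delta + c\<close>, which is \<open>1 + \<Sum>c = d * e\<close>. So both quotients
  are units.\<close>

lemma det_labels:
  assumes rows: "distinct [p, q, r, s]" and cols: "distinct [i, j, k, l]"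
  shows "\<bar>det4 (int (a p i)) (int (a p j)) (int (a p k)) (int (a p l)) (int (a q i)) (int (a q j)) (int (a q k)) (int (a q l)) (int (a r i)) (int (a r j)) (int (a r k)) (int (a r l)) (int (a s i)) (int (a s j)) (int (a s k)) (int (a s l))\<bar> = int d"
proof -
  obtain f :: "4 \<Rightarrow> 4" where f: "bij f" "f 0 = p" "f 1 = q" "f 2 = r" "f 3 = s" by (rule labels_index[OF rows])
  obtain g :: "4 \<Rightarrow> 4" where g: "bij g" "g 0 = i" "g 1 = j" "g 2 = k" "g 3 = l" by (rule labels_index[OF cols])
  define A :: "int^4^4" where "A = (\<chi> u v. int (a (f u) (g v)))"
  define B :: "int^4^4" where "B = (\<chi> u v. int (b (g u) (f v)))"
  have "(A ** B) $ u $ v = int (c (f v)) + int (delta u v)" for u v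
  proof -
    have "(A ** B) $ u $ v = int (\<Sum>w\<in>UNIV. a (f u) (g w) * b (g w) (f v))"
      by (simp add: matrix_matrix_mult_def A_def B_def)
    also have "(\<Sum>w\<in>UNIV. a (f u) (g w) * b (g w) (f v)) = (\<Sum>w\<in>UNIV. a (f u) w * b w (f v))"
      using sum.reindex_bij_betw[OF g(1)] .
    also have "\<dots> = c (f v) + delta u v"
      using ab f(1) by (simp add: delta_def bij_def inj_eq)
    finally show ?thesis by simp
  qed
  then have "det (A ** B) = det4 (int (c p) + 1) (int (c q)) (int (c r)) (int (c s))
      (int (c p)) (int (c q) + 1) (int (c r)) (int (c s))
      (int (c p)) (int (c q)) (int (c r) + 1) (int (c s))
      (int (c p)) (int (c q)) (int (c r)) (int (c s) + 1)"
    by (simp add: det_eq_det4 f delta_def)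
  also have "\<dots> = int (c p) + int (c q) + int (c r) + int (c s) + 1"
    by (simp add: det4_def algebra_simps)
  also have "\<dots> = int d * int e"
    using sum_c unfolding sum_labels[OF rows] by (simp flip: of_nat_mult)
  finally have prod: "det A * det B = int d * int e" by (simp add: det_mul)
  have rows_a: "int (a u i) + int (a u j) + int (a u k) + int (a u l) = int d" for u
    using row_a[of u] unfolding sum_labels[OF cols] by simp
  have rows_b: "int (b u p) + int (b u q) + int (b u r) + int (b u s) = int e" for u
    using row_b[of u] unfolding sum_labels[OF rows] by simp
  have detA: "det A = det4 (int (a p i)) (int (a p j)) (int (a p k)) (int (a p l)) (int (a q i)) (int (a q j)) (int (a q k)) (int (a q l)) (int (a r i)) (int (a r j)) (int (a r k)) (int (a r l)) (int (a s i)) (int (a s j)) (int (a s k)) (int (a s l))"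
    unfolding det_eq_det4 by (simp add: A_def f g)
  have "int d dvd det A" unfolding detA by (rule det4_row_sums) (rule rows_a)+
  moreover have "int e dvd det B"
    unfolding det_eq_det4 by (rule det4_row_sums) (simp_all add: B_def f g rows_b)
  ultimately obtain x y where xy: "det A = int d * x" "det B = int e * y" by (auto simp: dvd_def)
  have "e \<noteq> 0"
  proof
    assume "e = 0"
    then show False using sum_c by simp
  qed
  then have "x * y = 1" using prod d_pos by (simp add: xy)
  then have "\<bar>x\<bar> = 1" by (metis abs_1 abs_mult zmult_eq_1_iff abs_minus_cancel)
  then show ?thesis unfolding detA[symmetric] xy by (simp add: abs_mult)
qed

end

section \<open>The defect\<close>

text \<open>The number \<open>l_num\<close> in terms of exponents: the zeros of columns \<open>i\<close> and \<open>j\<close> are in disjoint rows.\<close>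

definition disj :: "(4 \<Rightarrow> 4 \<Rightarrow> nat) \<Rightarrow> 4 \<Rightarrow> 4 \<Rightarrow> nat" where
  "disj a i j = (if \<exists>r. a r i = 0 \<and> a r j = 0 then 0 else 1)"

text \<open>The multiplicity of \<open>X j\<close> in the plane section \<open>X i = 0\<close> that is lost in the passage to the support.\<close>

definition excess :: "(4 \<Rightarrow> 4 \<Rightarrow> nat) \<Rightarrow> 4 \<Rightarrow> 4 \<Rightarrow> nat" where
  "excess a i j = mu a i j - 1"

text \<open>The amount by which the sum in the theorem falls short of its value \<open>4 * d\<close> for four
  reduced plane sections and no line on the surface.\<close>

definition defect :: "(4 \<Rightarrow> 4 \<Rightarrow> nat) \<Rightarrow> nat" where
  "defect a = (\<Sum>i\<in>UNIV. \<Sum>j\<in>UNIV. excess a i j) + (\<Sum>(i, j)\<in>{(i, j). i < j}. disj a i j)"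

lemma sum_pairs_labels:
  fixes g :: "4 \<Rightarrow> 4 \<Rightarrow> nat"
  assumes sym: "\<And>i j. g i j = g j i" and dist: "distinct [p, q, r, s]"
  shows "(\<Sum>(i, j)\<in>{(i, j). i < j}. g i j) = g p q + g p r + g p s + g q r + g q s + g r s"
proof -
  let ?h = "\<lambda>(i, j). if i = j then 0 else g i j"
  let ?L = "{(i, j :: 4). i < j}" and ?G = "{(i, j :: 4). j < i}" and ?E = "{(i, j :: 4). i = j}"
  have "(\<Sum>i\<in>UNIV. \<Sum>j\<in>UNIV. ?h (i, j)) = sum ?h (UNIV \<times> UNIV)"
    by (simp add: sum.cartesian_product)
  also have "UNIV \<times> UNIV = ?L \<union> (?G \<union> ?E)" by auto
  also have "sum ?h (?L \<union> (?G \<union> ?E)) = sum ?h ?L + (sum ?h ?G + sum ?h ?E)"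
    by (subst sum.union_disjoint, simp, simp, force)+ simp
  also have "sum ?h ?L = (\<Sum>(i, j)\<in>?L. g i j)" by (rule sum.cong) auto
  also have "sum ?h ?G = (\<Sum>(i, j)\<in>?L. g i j)"
    by (rule sum.reindex_bij_witness[of _ "\<lambda>(i, j). (j, i)" "\<lambda>(i, j). (j, i)"]) (auto simp: sym)
  also have "sum ?h ?E = 0" by (rule sum.neutral) auto
  finally have "(\<Sum>i\<in>UNIV. \<Sum>j\<in>UNIV. ?h (i, j)) = 2 * (\<Sum>(i, j)\<in>?L. g i j)" by simp
  moreover have "(\<Sum>i\<in>UNIV. \<Sum>j\<in>UNIV. ?h (i, j)) = 2 * (g p q + g p r + g p s + g q r + g q s + g r s)"
    unfolding sum_labels[OF dist] using dist
    by (auto simp: sym[of q p] sym[of r p] sym[of s p] sym[of r q] sym[of s q] sym[of s r])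
  ultimately show ?thesis by simp
qed

lemma defect_labels:
  assumes "distinct [p, q, r, s]"
  shows "defect a = excess a p p + excess a p q + excess a p r + excess a p s
    + excess a q p + excess a q q + excess a q r + excess a q s
    + excess a r p + excess a r q + excess a r r + excess a r s
    + excess a s p + excess a s q + excess a s r + excess a s s
    + disj a p q + disj a p r + disj a p s + disj a q r + disj a q s + disj a r s"
proof -
  have "disj a i j = disj a j i" for i j
  proof -
    have "(\<exists>r. a r i = 0 \<and> a r j = 0) \<longleftrightarrow> (\<exists>r. a r j = 0 \<and> a r i = 0)" by blast
    then show ?thesis by (simp only: disj_def)
  qed
  from sum_pairs_labels[of "disj a", OF this assms] show ?thesis
    unfolding defect_def by (simp add: sum_labels[OF assms])
qed

context inverse_pair
begin

lemma mu_ge: "(\<And>r. a r i = 0 \<Longrightarrow> v \<le> a r j) \<Longrightarrow> v \<le> mu a i j"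
  by (metis mu_attained)

lemma mu_eq_0: "a r i = 0 \<Longrightarrow> a r j = 0 \<Longrightarrow> mu a i j = 0"
  using mu_le[of r i j] by simp

lemma K_minus_L:
  "(\<Sum>i\<in>UNIV. int (k_num (\<Sum>r\<in>UNIV. mon (a r)) i))
    - (\<Sum>(i, j)\<in>{(i, j). i < j}. int (l_num (\<Sum>r\<in>UNIV. mon (a r)) i j)) = 4 * int d - int (defect a)"
proof -
  have "int (k_num (\<Sum>r\<in>UNIV. mon (a r)) i) = int d - int (\<Sum>j\<in>UNIV. excess a i j)" for i
    using k_num_eq[of i] unfolding excess_def by linarith
  then have "(\<Sum>i\<in>UNIV. int (k_num (\<Sum>r\<in>UNIV. mon (a r)) i)) = 4 * int d - int (\<Sum>i\<in>UNIV. \<Sum>j\<in>UNIV. excess a i j)"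
    by (simp add: sum_subtractf)
  moreover have "(\<Sum>(i, j)\<in>{(i, j). i < j}. int (l_num (\<Sum>r\<in>UNIV. mon (a r)) i j))
      = (\<Sum>(i, j)\<in>{(i, j). i < j}. int (disj a i j))"
    by (rule sum.cong) (auto simp: l_num_eq disj_def)
  ultimately show ?thesis by (simp add: defect_def case_prod_beta)
qed

text \<open>If only row \<open>r\<close> has a zero in column \<open>t\<close>, the section \<open>X t = 0\<close> is the single monomial \<open>r\<close>. Each of its
  variables loses all multiplicity but one, and gives a line on the surface.\<close>

lemma single_zero_defect:
  assumes cols: "distinct [t, x, y, z]" and at: "\<And>r'. a r' t = 0 \<longleftrightarrow> r' = r"
  shows "d \<le> defect a"
proof -
  have "a r j \<le> excess a t j + disj a t j" for j
  proof -
    have "mu a t j = a r j" using mu_attained[of t j] at by metis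
    moreover have "disj a t j = (if a r j = 0 then 0 else 1)" by (auto simp: disj_def at)
    ultimately show ?thesis by (auto simp: excess_def)
  qed
  from this[of x] this[of y] this[of z] have "a r x + a r y + a r z \<le> defect a"
    unfolding defect_labels[OF cols] by linarith
  moreover have "d = a r x + a r y + a r z"
    using row_a[of r] at[of r] by (simp add: sum_labels[OF cols])
  ultimately show ?thesis by simp
qed

lemma single_zero_degree:
  assumes cols: "distinct [t, x, y, z]" and at: "\<And>r'. a r' t = 0 \<longleftrightarrow> r' = r"
  shows "e \<le> d * (d - 1)"
proof -
  interpret inverse_pair_chart a b d e c c' t x y z r
    by unfold_locales (use cols at in auto)
  show ?thesis by (rule degree_bound)
qed

text \<open>The column \<open>v\<close> of \<open>b\<close> is a normal vector of a facet of the simplex of exponents: its product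
  with the rows of \<open>a\<close> is constant except at row \<open>v\<close>. The degree of the inverse is computed from these vectors.\<close>

lemma facet_normal:
  assumes cols: "distinct [i, j, k, l]"
  shows "int (a r i) * int (b i v) + int (a r j) * int (b j v) + int (a r k) * int (b k v) + int (a r l) * int (b l v)
    = int (c v) + int (delta r v)"
  using ab[of r v] unfolding sum_labels[OF cols] by (simp flip: of_nat_add of_nat_mult)

lemma facet_normal_zero:
  assumes cols: "distinct [i, j, k, l]"
  shows "b i v = 0 \<or> b j v = 0 \<or> b k v = 0 \<or> b l v = 0"
  using zero_b[of v] four_labels[OF cols] by (metis UNIV_I empty_iff insert_iff)

end

lemma equal_up_to_permutation_labels:
  assumes rows: "distinct [p, q, r, s]" and cols: "distinct [i, j, k, l]"
    and "a p i = d" "a p j = 0" "a p k = 0" "a p l = 0"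
    and "a q i = d - 1" "a q j = 1" "a q k = 0" "a q l = 0"
    and "a r i = 0" "a r j = d - 1" "a r k = 1" "a r l = 0"
    and "a s i = 0" "a s j = 0" "a s k = d - 1" "a s l = 1"
  shows "equal_up_to_permutation a (phi3 d)"
proof -
  obtain f :: "4 \<Rightarrow> 4" where f: "bij f" "f 0 = p" "f 1 = q" "f 2 = r" "f 3 = s" by (rule labels_index[OF rows])
  obtain g :: "4 \<Rightarrow> 4" where g: "bij g" "g 0 = i" "g 1 = j" "g 2 = k" "g 3 = l" by (rule labels_index[OF cols])
  have "\<forall>u\<in>{0, 1, 2, 3}. \<forall>v\<in>{0, 1, 2, 3}. a (f u) (g v) = phi3 d u v"
    using assms(3-) by (simp add: f g phi3_def)
  then have "a (f u) (g v) = phi3 d u v" for u v unfolding UNIV_4'[symmetric] by blast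
  then show ?thesis unfolding equal_up_to_permutation_def using f(1) g(1) by blast
qed

lemma pos_mult_one: "\<bar>int d * (m * n)\<bar> = int d \<Longrightarrow> d > 0 \<Longrightarrow> m > 0 \<Longrightarrow> n > 0 \<Longrightarrow> m = 1 \<and> n = (1::int)"
  by (auto simp: abs_mult zmult_eq_1_iff)

context inverse_pair
begin

lemma row_sum_labels: "distinct [i, j, k, l] \<Longrightarrow> a u i + a u j + a u k + a u l = d"
  using row_a[of u] by (simp add: sum_labels)

text \<open>The single entry divides every entry of its column in \<open>b a\<close>, and these entries are \<open>c' i\<close> and \<open>c' i + 1\<close>.\<close>

lemma unit_entry:
  assumes "\<And>r'. r' \<noteq> r \<Longrightarrow> a r' i = 0"
  shows "a r i = 1"
proof -
  have "b k r * a r i = c' i + delta k i" for k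
  proof -
    have "(\<Sum>l\<in>UNIV. b k l * a l i) = (\<Sum>l\<in>UNIV. if l = r then b k l * a l i else 0)"
      by (rule sum.cong) (auto simp: assms)
    then show ?thesis using ba[of k i] by simp
  qed
  moreover obtain k where "k \<noteq> i" using ex_other by blast
  ultimately have "b k r * a r i = c' i" "b i r * a r i = c' i + 1" by (auto simp: delta_def)
  then have "a r i dvd c' i" "a r i dvd c' i + 1" by (metis dvd_triv_right)+
  then have "a r i dvd 1" by (metis dvd_add_right_iff)
  then show ?thesis by simp
qed

lemma rows_distinct: "p \<noteq> q \<Longrightarrow> a p \<noteq> a q"
proof
  assume pq: "p \<noteq> q" and "a p = a q"
  then have "c p + delta p p = c p + delta q p" using ab[of p p] ab[of q p] by simp
  then show False using pq by (simp add: delta_def)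
qed

text \<open>Two monomials that are \<open>d\<close>-th powers make both \<open>c v\<close> and \<open>c v + 1\<close> divisible by \<open>d\<close>, for a suitable column.\<close>

lemma pure_row_unique:
  assumes "a p i = d" "a q j = d" "d \<ge> 2" "\<And>k. k \<noteq> i \<Longrightarrow> a p k = 0" "\<And>k. k \<noteq> j \<Longrightarrow> a q k = 0"
  shows "p = q"
proof (rule ccontr)
  assume pq: "p \<noteq> q"
  have pure: "d dvd c v + delta u v" if "a u k = d" "\<And>l. l \<noteq> k \<Longrightarrow> a u l = 0" for u k v
  proof -
    have "(\<Sum>l\<in>UNIV. a u l * b l v) = (\<Sum>l\<in>UNIV. if l = k then a u l * b l v else 0)"
      by (rule sum.cong) (auto simp: that)
    then have "c v + delta u v = d * b k v" using ab[of u v] that by simp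
    then show ?thesis by simp
  qed
  have "d dvd c p + 1" "d dvd c p"
    using pure[OF assms(1,4), of p] pure[OF assms(2,5), of p] pq by (simp_all add: delta_def)
  then have "d dvd 1" by (metis dvd_add_right_iff)
  then show False using assms(3) by simp
qed

section \<open>Maps with a pure power among the monomials\<close>

text \<open>The rows are \<open>p = i\<^sup>d\<close>, \<open>s\<close> with support \<open>{i, x}\<close>, \<open>v\<close> with support \<open>{x, y}\<close>
  and \<open>q\<close> with support \<open>{y, z}\<close>: the determinant forces the extremal map.\<close>

lemma pure_chain:
  assumes rows: "distinct [p, s, v, q]" and cols: "distinct [i, x, y, z]"
    and p: "a p x = 0" "a p y = 0" "a p z = 0"
    and s: "a s x > 0" "a s y = 0" "a s z = 0"
    and v: "a v i = 0" "a v y > 0" "a v z = 0"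
    and q: "a q i = 0" "a q x = 0" "a q z > 0"
  shows "equal_up_to_permutation a (phi3 d)"
proof -
  have pd: "a p i = d" using row_sum_labels[OF cols, of p] p by simp
  have "\<bar>int d * (int (a s x) * (int (a v y) * int (a q z)))\<bar> = int d"
    using det_labels[OF rows cols] by (simp add: det4_def p s v q pd algebra_simps)
  then have sx: "a s x = 1" and "int (a v y) * int (a q z) = 1"
    using pos_mult_one[of d "int (a s x)" "int (a v y) * int (a q z)"] s v q d_pos by auto
  then have "a v y = 1" "a q z = 1" by (auto simp: zmult_eq_1_iff)
  then show ?thesis
    using row_sum_labels[OF cols, of s] row_sum_labels[OF cols, of v] row_sum_labels[OF cols, of q] p s v q sx pd
    by (intro equal_up_to_permutation_labels[OF rows cols]) auto
qed

text \<open>Two rows supported in the same two columns with the same sum contribute a factor \<open>d\<close> to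
  the determinant, in addition to the factor \<open>d\<close> of the pure row.\<close>

lemma pure_two_proportional:
  assumes rows: "distinct [p, s, v, q]" and cols: "distinct [i, x, y, z]" and d: "d \<ge> 2"
    and p: "a p x = 0" "a p y = 0" "a p z = 0"
    and s: "a s y = 0" "a s z = 0"
    and v: "a v i = 0" "a v x = 0"
    and q: "a q i = 0" "a q x = 0"
  shows False
proof -
  have pd: "a p i = d" using row_sum_labels[OF cols, of p] p by simp
  have z: "int (a v z) = int d - int (a v y)" "int (a q z) = int d - int (a q y)"
    using row_sum_labels[OF cols, of v] row_sum_labels[OF cols, of q] v q by auto
  have "\<bar>int d * (int d * (int (a s x) * (int (a v y) - int (a q y))))\<bar> = int d"
    using det_labels[OF rows cols] by (simp add: det4_def p s v q pd z algebra_simps)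
  then have "\<bar>int d * (int (a s x) * (int (a v y) - int (a q y)))\<bar> = 1"
    using d_pos by (simp add: abs_mult)
  then have "int d dvd 1" by (metis abs_dvd_iff dvd_abs_iff dvd_triv_left)
  then show False using d by simp
qed

text \<open>The minor complementary to the pure power is, up to sign, a sum of two positive products, so it is not a unit.\<close>

lemma pure_cycle_contradiction:
  assumes rows: "distinct [p, s, v, q]" and cols: "distinct [i, x, y, z]"
    and p: "a p x = 0" "a p y = 0" "a p z = 0"
    and s: "a s x > 0" "a s y = 0" "a s z > 0"
    and v: "a v i = 0" "a v x > 0" "a v y > 0" "a v z = 0"
    and q: "a q i = 0" "a q x = 0" "a q y > 0" "a q z > 0"
  shows False
proof -
  have pd: "a p i = d" using row_sum_labels[OF cols, of p] p by simp
  have "\<bar>int d * (int (a s x) * int (a v y) * int (a q z) + int (a s z) * int (a v x) * int (a q y))\<bar> = int d"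
    using det_labels[OF rows cols] by (simp add: det4_def p s v q pd algebra_simps)
  then have "\<bar>int (a s x) * int (a v y) * int (a q z) + int (a s z) * int (a v x) * int (a q y)\<bar> = 1"
    using d_pos by (simp add: abs_mult)
  moreover have "int (a s x) * int (a v y) * int (a q z) > 0" "int (a s z) * int (a v x) * int (a q y) > 0"
    using s v q by simp_all
  ultimately show False by linarith
qed

text \<open>The rows are \<open>p = i\<^sup>d\<close>, \<open>s\<close> with support \<open>{i, x}\<close>, \<open>q\<close> with support \<open>{y, z}\<close> and
  \<open>v\<close> with support \<open>{x, y, z}\<close>; here the degree of the inverse is \<open>(d - 1) * a v x + d\<close>.\<close>

lemma pure_full_row_degree:
  assumes cols: "distinct [i, x, y, z]" and rows: "distinct [p, s, v, q]"
    and p: "a p i = d" "a p x = 0" "a p y = 0" "a p z = 0"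
    and s: "a s i = d - 1" "a s x = 1" "a s y = 0" "a s z = 0"
    and v: "a v i = 0" "a v x > 0" "a v y > 0" "a v z > 0"
    and q: "a q i = 0" "a q x = 0" "a q y > 0" "a q z > 0"
    and det: "int (a q y) * int (a v z) - int (a q z) * int (a v y) = 1"
  shows "e \<le> d * (d - 1)"
proof -
  define qy qz vx vy vz where "qy = int (a q y)" "qz = int (a q z)"
    "vx = int (a v x)" "vy = int (a v y)" "vz = int (a v z)"
  note defs = this
  have pos: "qy \<ge> 1" "qz \<ge> 1" "vx \<ge> 1" "vy \<ge> 1" "vz \<ge> 1" using v q by (auto simp: defs)
  have qs: "qy + qz = int d" and vs: "vx + vy + vz = int d"
    using row_sum_labels[OF cols, of q] row_sum_labels[OF cols, of v] v q by (auto simp: defs)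
  have det': "qy * vz - qz * vy = 1" using det by (simp add: defs)
  have d1: "int (d - 1) = int d - 1" "int (d - Suc 0) = int d - 1" using d_pos by simp_all
  have eqs: "int (b x u) = int (b i u) + int (delta s u) - int (delta p u)"
      "int (b y u) - int (b i u) = vz * (int (delta q u) - int (delta p u))
         - qz * (int (delta v u) - int (delta p u) - vx * (int (delta s u) - int (delta p u)))"
      "int (b z u) - int (b i u) = qy * (int (delta v u) - int (delta p u) - vx * (int (delta s u) - int (delta p u)))
         - vy * (int (delta q u) - int (delta p u))"
    for u
  proof -
    define C where "C = int (c u)"
    have E: "int d * int (b i u) = C + int (delta p u)"
      "(int d - 1) * int (b i u) + int (b x u) = C + int (delta s u)"
      "qy * int (b y u) + qz * int (b z u) = C + int (delta q u)"
      "vx * int (b x u) + vy * int (b y u) + vz * int (b z u) = C + int (delta v u)"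
      using facet_normal[OF cols, of p u] facet_normal[OF cols, of s u] facet_normal[OF cols, of q u]
        facet_normal[OF cols, of v u]
      by (simp_all add: p s v q C_def defs d1)
    show X: "int (b x u) = int (b i u) + int (delta s u) - int (delta p u)"
      using E(1,2) by (simp add: algebra_simps)
    define Y Z where "Y = int (b y u) - int (b i u)" "Z = int (b z u) - int (b i u)"
    note YZ = this
    define R1 where "R1 = int (delta q u) - int (delta p u)"
    define R2 where "R2 = int (delta v u) - int (delta p u) - vx * (int (delta s u) - int (delta p u))"
    have "qy * int (b y u) + qz * int (b z u) - (qy + qz) * int (b i u) = R1"
      unfolding qs using E(1,3) by (simp add: R1_def)
    then have r1: "qy * Y + qz * Z = R1" by (simp add: YZ algebra_simps)
    have "vx * int (b x u) + vy * int (b y u) + vz * int (b z u) - (vx + vy + vz) * int (b i u)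
      = int (delta v u) - int (delta p u)"
      unfolding vs using E(1,4) by simp
    then have r2: "vy * Y + vz * Z = R2" unfolding X by (simp add: YZ R2_def algebra_simps)
    \<comment> \<open>Cramer's rule for \<open>r1\<close> and \<open>r2\<close>, whose determinant is \<open>det'\<close>.\<close>
    have "(qy * vz - qz * vy) * Y = vz * R1 - qz * R2" "(qy * vz - qz * vy) * Z = qy * R2 - vy * R1"
      unfolding r1[symmetric] r2[symmetric] by (simp_all add: algebra_simps)
    then have "Y = vz * R1 - qz * R2" "Z = qy * R2 - vy * R1" unfolding det' by simp_all
    then show "int (b y u) - int (b i u) = vz * (int (delta q u) - int (delta p u))
         - qz * (int (delta v u) - int (delta p u) - vx * (int (delta s u) - int (delta p u)))"
      "int (b z u) - int (b i u) = qy * (int (delta v u) - int (delta p u) - vx * (int (delta s u) - int (delta p u)))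
         - vy * (int (delta q u) - int (delta p u))"
      by (simp_all add: YZ R1_def R2_def)
  qed
  have dist: "p \<noteq> s" "p \<noteq> v" "p \<noteq> q" "s \<noteq> v" "s \<noteq> q" "v \<noteq> q" using rows by auto
  have prods: "qz * vx \<ge> 1" "qy * vx \<ge> 1" "qy * (vx - 1) \<ge> 0" "qz * (vx - 1) \<ge> 0"
    using pos mult_mono[of 1 qz 1 vx] mult_mono[of 1 qy 1 vx] by auto
  \<comment> \<open>The differences within each column show where its zero is: at \<open>y\<close> for \<open>p\<close> and \<open>v\<close>, at \<open>z\<close> for \<open>s\<close> and \<open>q\<close>.
    Row \<open>y\<close> of \<open>b\<close> therefore has only two nonzero entries.\<close>
  have up: "b y p = 0"
  proof -
    have "int (b x p) = int (b i p) - 1" "int (b y p) = int (b i p) - vz - qz * (vx - 1)"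
      "int (b z p) = int (b i p) + vy + qy * (vx - 1)"
      using eqs[of p] dist by (simp_all add: delta_def algebra_simps)
    then show ?thesis using facet_normal_zero[OF cols, of p] prods pos by linarith
  qed
  have us: "int (b y s) = int d * vx"
  proof -
    have "int (b x s) = int (b i s) + 1" "int (b y s) = int (b i s) + qz * vx" "int (b z s) = int (b i s) - qy * vx"
      using eqs[of s] dist by (simp_all add: delta_def algebra_simps)
    moreover have "int d * vx = qy * vx + qz * vx" by (simp add: qs[symmetric] algebra_simps)
    ultimately show ?thesis using facet_normal_zero[OF cols, of s] prods pos by linarith
  qed
  have uq: "int (b y q) = vz + vy"
  proof -
    have "int (b x q) = int (b i q)" "int (b y q) = int (b i q) + vz" "int (b z q) = int (b i q) - vy"
      using eqs[of q] dist by (simp_all add: delta_def algebra_simps)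
    then show ?thesis using facet_normal_zero[OF cols, of q] pos by linarith
  qed
  have uv: "b y v = 0"
  proof -
    have "int (b x v) = int (b i v)" "int (b y v) = int (b i v) - qz" "int (b z v) = int (b i v) + qy"
      using eqs[of v] dist by (simp_all add: delta_def algebra_simps)
    then show ?thesis using facet_normal_zero[OF cols, of v] pos by linarith
  qed
  have "int e = int d * vx + int d - vx"
    using row_b[of y] up us uq uv vs unfolding sum_labels[OF rows] by simp
  also have "\<dots> = (int d - 1) * vx + int d" by (simp add: algebra_simps)
  also have "\<dots> \<le> (int d - 1) * (int d - 2) + int d"
    using pos vs by (intro add_mono mult_left_mono) auto
  also have "\<dots> \<le> int d * (int d - 1)" using pos vs by (simp add: algebra_simps)
  finally have "int e \<le> int (d * (d - 1))" using d1 by simp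
  then show ?thesis by (simp only: of_nat_le_iff)
qed

lemma pure_full_row:
  assumes rows: "distinct [p, s, v, q]" and cols: "distinct [i, x, y, z]" and d: "d \<ge> 2"
    and p: "a p x = 0" "a p y = 0" "a p z = 0"
    and s: "a s x > 0" "a s y = 0" "a s z = 0"
    and v: "a v i = 0" "a v x > 0" "a v y > 0" "a v z > 0"
    and q: "a q i = 0" "a q x = 0" "a q y > 0" "a q z > 0"
  shows "d \<le> defect a \<and> e \<le> d * (d - 1)"
proof -
  have pd: "a p i = d" using row_sum_labels[OF cols, of p] p by simp
  define \<epsilon> where "\<epsilon> = int (a q y) * int (a v z) - int (a q z) * int (a v y)"
  have "\<bar>int d * (int (a s x) * \<epsilon>)\<bar> = int d"
    using det_labels[OF rows cols] by (simp add: det4_def p s v q pd \<epsilon>_def algebra_simps abs_minus_commute)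
  then have "\<bar>int (a s x)\<bar> * \<bar>\<epsilon>\<bar> = 1" using d_pos by (simp add: abs_mult)
  then have sx: "a s x = 1" and \<epsilon>: "\<bar>\<epsilon>\<bar> = 1" by (auto simp: zmult_eq_1_iff)
  then have si: "a s i = d - 1" using row_sum_labels[OF cols, of s] s by simp
  have "e \<le> d * (d - 1)"
  proof (cases "\<epsilon> = 1")
    case True
    then show ?thesis
      using pure_full_row_degree[OF cols rows pd p si sx s(2,3) v q] by (simp add: \<epsilon>_def)
  next
    case False
    then have "int (a q z) * int (a v y) - int (a q y) * int (a v z) = 1" using \<epsilon> by (simp add: \<epsilon>_def)
    moreover have "distinct [i, x, z, y]" using cols by auto
    ultimately show ?thesis
      using pure_full_row_degree[of i x z y p s v q] rows pd p si sx s(2,3) v q by simp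
  qed
  moreover have "d \<le> defect a"
  proof -
    have rows_cases: "r' = p \<or> r' = s \<or> r' = v \<or> r' = q" for r' using four_labels[OF rows] by auto
    have "d - 1 \<le> mu a y i"
    proof (rule mu_ge)
      fix r' assume "a r' y = 0"
      then show "d - 1 \<le> a r' i" using rows_cases[of r'] v q pd si by auto
    qed
    then have "d - 2 \<le> excess a y i" by (simp add: excess_def)
    moreover have "d - 1 \<le> mu a z i"
    proof (rule mu_ge)
      fix r' assume "a r' z = 0"
      then show "d - 1 \<le> a r' i" using rows_cases[of r'] v q pd si by auto
    qed
    then have "d - 2 \<le> excess a z i" by (simp add: excess_def)
    moreover have "disj a i y = 1" "disj a i z = 1"
    proof -
      have "\<not> (a r' i = 0 \<and> a r' y = 0)" "\<not> (a r' i = 0 \<and> a r' z = 0)" for r'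
        using rows_cases[of r'] v q pd si d by auto
      then show "disj a i y = 1" "disj a i z = 1" by (auto simp: disj_def)
    qed
    ultimately show ?thesis unfolding defect_labels[OF cols] using d by linarith
  qed
  ultimately show ?thesis by simp
qed

end

section \<open>Maps without a pure power among the monomials\<close>

lemma int_cancel: "x * m = x * n \<Longrightarrow> x > 0 \<Longrightarrow> m = (n :: int)"
  by simp

text \<open>Cramer's rule for a cyclic bidiagonal system with row sums \<open>D\<close> and determinant \<open>s * D\<close>. The
  differences of the unknowns are integral and do not involve \<open>C\<close>.\<close>

lemma cyclic_system:
  fixes D :: int
  assumes sums: "x0 + y0 = D" "x1 + y1 = D" "x2 + y2 = D" "x3 + y3 = D"
    and pos: "x1 > 0" "x2 > 0" "x3 > 0" "D > 0"
    and s: "s * s = 1" "x0 * x1 * x2 * x3 - y0 * y1 * y2 * y3 = s * D"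
    and eqs: "x0 * u0 + y0 * u1 = C + 1" "x1 * u1 + y1 * u2 = C" "x2 * u2 + y2 * u3 = C" "x3 * u3 + y3 * u0 = C"
  shows "s * (u0 - u3) = x1 * x2" "s * (u2 - u3) = x1 * y3" "s * (u2 - u1) = y2 * y3"
proof -
  define w0 w1 w2 w3 where w: "w0 = D * u0 - C" "w1 = D * u1 - C" "w2 = D * u2 - C" "w3 = D * u3 - C"
  have ws: "x * (D * u - C) + y * (D * v - C) = D * (x * u + y * v) - C * (x + y)" for x y u v :: int
    by (simp add: algebra_simps)
  have h: "x0 * w0 + y0 * w1 = D" "x1 * w1 + y1 * w2 = 0" "x2 * w2 + y2 * w3 = 0" "x3 * w3 + y3 * w0 = 0"
    unfolding w ws eqs sums by (simp_all add: algebra_simps)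
  have "(x0 * x1 * x2 * x3 - y0 * y1 * y2 * y3) * w0 = x1 * x2 * x3 * (x0 * w0 + y0 * w1)
      - y0 * x2 * x3 * (x1 * w1 + y1 * w2) + y0 * y1 * x3 * (x2 * w2 + y2 * w3) - y0 * y1 * y2 * (x3 * w3 + y3 * w0)"
    by (simp add: algebra_simps)
  then have "D * (s * w0) = D * (x1 * x2 * x3)" unfolding h s(2) by (simp add: ac_simps)
  then have w0: "s * w0 = x1 * x2 * x3" by (rule int_cancel) (rule pos(4))
  have "x3 * (s * w3) = s * (x3 * w3 + y3 * w0) - y3 * (s * w0)" by (simp add: algebra_simps)
  then have "x3 * (s * w3) = x3 * (- (y3 * x1 * x2))" unfolding h w0 by (simp add: ac_simps)
  then have w3: "s * w3 = - (y3 * x1 * x2)" by (rule int_cancel) (rule pos(3))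
  have "x2 * (s * w2) = s * (x2 * w2 + y2 * w3) - y2 * (s * w3)" by (simp add: algebra_simps)
  then have "x2 * (s * w2) = x2 * (y2 * y3 * x1)" unfolding h w3 by (simp add: ac_simps)
  then have w2: "s * w2 = y2 * y3 * x1" by (rule int_cancel) (rule pos(2))
  have "x1 * (s * w1) = s * (x1 * w1 + y1 * w2) - y1 * (s * w2)" by (simp add: algebra_simps)
  then have "x1 * (s * w1) = x1 * (- (y1 * y2 * y3))" unfolding h w2 by (simp add: ac_simps)
  then have w1: "s * w1 = - (y1 * y2 * y3)" by (rule int_cancel) (rule pos(1))
  have "D * (s * (u0 - u3)) = s * w0 - s * w3" "D * (s * (u2 - u3)) = s * w2 - s * w3"
    "D * (s * (u2 - u1)) = s * w2 - s * w1"
    by (simp_all add: w algebra_simps)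
  moreover have "s * w0 - s * w3 = D * (x1 * x2)"
    unfolding w0 w3 sums(4)[symmetric] by (simp add: algebra_simps)
  moreover have "s * w2 - s * w3 = D * (x1 * y3)"
    unfolding w2 w3 sums(3)[symmetric] by (simp add: algebra_simps)
  moreover have "s * w2 - s * w1 = D * (y2 * y3)"
    unfolding w2 w1 sums(2)[symmetric] by (simp add: algebra_simps)
  ultimately have "D * (s * (u0 - u3)) = D * (x1 * x2)" "D * (s * (u2 - u3)) = D * (x1 * y3)"
    "D * (s * (u2 - u1)) = D * (y2 * y3)" by simp_all
  then show "s * (u0 - u3) = x1 * x2" "s * (u2 - u3) = x1 * y3" "s * (u2 - u1) = y2 * y3"
    using pos by simp_all
qed

text \<open>With constant sums \<open>D\<close>, the differences \<open>y0 * y1 - x0 * x1 = D * (y0 - x1)\<close> and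
  \<open>y2 * y3 - x2 * x3 = D * (y2 - x3)\<close> are positive multiples of \<open>D\<close>, which makes the
  difference of the fourfold products at least \<open>2 * D\<close>.\<close>

lemma cyclic_products_far_apart:
  fixes D :: int
  assumes sums: "x0 + y0 = D" "x1 + y1 = D" "x2 + y2 = D" "x3 + y3 = D"
    and pos: "x0 > 0" "x1 > 0" "y2 > 0" "y3 > 0" "D > 0"
    and less: "x1 < y0" "x3 < y2"
  shows "y0 * y1 * y2 * y3 - x0 * x1 * x2 * x3 > D"
proof -
  have y_eq: "y0 = D - x0" "y1 = D - x1" "y2 = D - x2" "y3 = D - x3" using sums by auto
  have "y0 * y1 - x0 * x1 = D * (y0 - x1)"
    unfolding y_eq by (simp add: algebra_simps)
  moreover have "D * 1 \<le> D * (y0 - x1)" using pos less by (intro mult_left_mono) auto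
  ultimately have 1: "D \<le> y0 * y1 - x0 * x1" by simp
  have "y2 * y3 - x2 * x3 = D * (y2 - x3)"
    unfolding y_eq by (simp add: algebra_simps)
  moreover have "D * 1 \<le> D * (y2 - x3)" using pos less by (intro mult_left_mono) auto
  ultimately have 2: "D \<le> y2 * y3 - x2 * x3" by simp
  have 3: "1 \<le> y2 * y3" "1 \<le> x0 * x1" using pos mult_pos_pos[of y2 y3] mult_pos_pos[of x0 x1] by linarith+
  have "D * 1 \<le> (y0 * y1 - x0 * x1) * (y2 * y3)" using 1 3 pos by (intro mult_mono) auto
  moreover have "1 * D \<le> (x0 * x1) * (y2 * y3 - x2 * x3)" using 2 3 pos by (intro mult_mono) auto
  moreover have "y0 * y1 * y2 * y3 - x0 * x1 * x2 * x3
      = (y0 * y1 - x0 * x1) * (y2 * y3) + (x0 * x1) * (y2 * y3 - x2 * x3)"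
    by (simp add: algebra_simps)
  ultimately show ?thesis using pos by linarith
qed

lemma prod4_mono:
  fixes x0 :: int
  assumes "0 \<le> x0" "x0 \<le> y0" "0 \<le> x1" "x1 \<le> y1" "0 \<le> x2" "x2 \<le> y2" "0 \<le> x3" "x3 \<le> y3"
  shows "x0 * x1 * x2 * x3 \<le> y0 * y1 * y2 * y3"
  using assms by (intro mult_mono mult_nonneg_nonneg) auto

context inverse_pair
begin

text \<open>A matrix with two diagonal blocks of size 2 has determinant divisible by \<open>d\<^sup>2\<close>.\<close>

lemma two_blocks:
  assumes rows: "distinct [p, q, r, s]" and cols: "distinct [i, j, k, l]" and d: "d \<ge> 2"
    and p: "a p k = 0" "a p l = 0" and q: "a q k = 0" "a q l = 0"
    and r: "a r i = 0" "a r j = 0" and s: "a s i = 0" "a s j = 0"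
  shows False
proof -
  have z: "int (a p j) = int d - int (a p i)" "int (a q j) = int d - int (a q i)"
    "int (a r l) = int d - int (a r k)" "int (a s l) = int d - int (a s k)"
    using row_sum_labels[OF cols, of p] row_sum_labels[OF cols, of q]
      row_sum_labels[OF cols, of r] row_sum_labels[OF cols, of s] p q r s by auto
  have "\<bar>int d * (int d * ((int (a p i) - int (a q i)) * (int (a r k) - int (a s k))))\<bar> = int d"
    using det_labels[OF rows cols] by (simp add: det4_def p q r s z algebra_simps)
  then have "\<bar>int d * ((int (a p i) - int (a q i)) * (int (a r k) - int (a s k)))\<bar> = 1"
    using d_pos by (simp add: abs_mult)
  then have "int d dvd 1" by (metis abs_dvd_iff dvd_abs_iff dvd_triv_left)
  then show False using d by simp
qed

text \<open>Row \<open>r\<^sub>n\<close> has support \<open>{k\<^sub>n, k\<^sub>n\<^sub>+\<^sub>1}\<close>, with cyclic indices and entries \<open>x\<^sub>n\<close>, \<open>y\<^sub>n\<close>. The monomials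
  vanish along the lines \<open>k\<^sub>0 = k\<^sub>2 = 0\<close> and \<open>k\<^sub>1 = k\<^sub>3 = 0\<close>, and the degree of the
  inverse is \<open>d\<^sup>2\<close> minus the two products of the smaller entries of columns \<open>k\<^sub>0\<close>, \<open>k\<^sub>2\<close> and of columns
  \<open>k\<^sub>1\<close>, \<open>k\<^sub>3\<close>. The last two assumptions say that the smaller entries of columns \<open>k\<^sub>0\<close> and \<open>k\<^sub>1\<close> are both
  in row \<open>r\<^sub>0\<close>; so their sum is \<open>d\<close>, which makes the two products large enough.\<close>

lemma eight_cycle_turn:
  assumes rows: "distinct [r0, r1, r2, r3]" and cols: "distinct [k0, k1, k2, k3]"
    and nz: "a r0 k0 > 0" "a r0 k1 > 0" "a r1 k1 > 0" "a r1 k2 > 0" "a r2 k2 > 0" "a r2 k3 > 0" "a r3 k3 > 0" "a r3 k0 > 0"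
    and z: "a r0 k2 = 0" "a r0 k3 = 0" "a r1 k3 = 0" "a r1 k0 = 0" "a r2 k0 = 0" "a r2 k1 = 0" "a r3 k1 = 0" "a r3 k2 = 0"
    and turn: "a r0 k0 \<le> a r3 k0" "a r0 k1 \<le> a r1 k1"
  shows "d \<le> defect a \<and> e \<le> d * (d - 1)"
proof -
  define D where "D = int d"
  define x0 y0 x1 y1 x2 y2 x3 y3 where
    "x0 = int (a r0 k0)" "y0 = int (a r0 k1)" "x1 = int (a r1 k1)" "y1 = int (a r1 k2)"
    "x2 = int (a r2 k2)" "y2 = int (a r2 k3)" "x3 = int (a r3 k3)" "y3 = int (a r3 k0)"
  note xy = this
  have pos: "x0 \<ge> 1" "y0 \<ge> 1" "x1 \<ge> 1" "y1 \<ge> 1" "x2 \<ge> 1" "y2 \<ge> 1" "x3 \<ge> 1" "y3 \<ge> 1"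
    using nz by (auto simp: xy)
  have sums: "x0 + y0 = D" "x1 + y1 = D" "x2 + y2 = D" "x3 + y3 = D"
    using row_sum_labels[OF cols, of r0] row_sum_labels[OF cols, of r1]
      row_sum_labels[OF cols, of r2] row_sum_labels[OF cols, of r3] z
    by (auto simp: xy D_def)
  have turn': "x0 \<le> y3" "y0 \<le> x1" "x3 \<le> y0" "y1 \<le> x0" using turn sums by (auto simp: xy)
  have D: "D > 0" using d_pos by (simp add: D_def)
  have det: "\<bar>x0 * x1 * x2 * x3 - y0 * y1 * y2 * y3\<bar> = D"
    using det_labels[OF rows cols] by (simp add: det4_def z xy D_def ac_simps)
  define s where "s = sgn (x0 * x1 * x2 * x3 - y0 * y1 * y2 * y3)"
  have s: "x0 * x1 * x2 * x3 - y0 * y1 * y2 * y3 = s * D" "s = 1 \<or> s = -1"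
    using det D by (auto simp: s_def sgn_if abs_if split: if_splits)
  have ss: "s * s = 1" using s(2) by auto
  have s': "x1 * x2 * x3 * x0 - y1 * y2 * y3 * y0 = s * D" "x2 * x3 * x0 * x1 - y2 * y3 * y0 * y1 = s * D"
    "x3 * x0 * x1 * x2 - y3 * y0 * y1 * y2 = s * D"
    using s(1) by (simp_all add: ac_simps)
  have dist: "r0 \<noteq> r1" "r0 \<noteq> r2" "r0 \<noteq> r3" "r1 \<noteq> r2" "r1 \<noteq> r3" "r2 \<noteq> r3" using rows by auto
  have F: "x0 * int (b k0 v) + y0 * int (b k1 v) = int (c v) + int (delta r0 v)"
    "x1 * int (b k1 v) + y1 * int (b k2 v) = int (c v) + int (delta r1 v)"
    "x2 * int (b k2 v) + y2 * int (b k3 v) = int (c v) + int (delta r2 v)"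
    "x3 * int (b k3 v) + y3 * int (b k0 v) = int (c v) + int (delta r3 v)" for v
    using facet_normal[OF cols, of r0 v] facet_normal[OF cols, of r1 v]
      facet_normal[OF cols, of r2 v] facet_normal[OF cols, of r3 v]
    by (simp_all add: z xy)
  have p: "x0 > 0" "x1 > 0" "x2 > 0" "x3 > 0" using pos by auto
  have f0: "x0 * int (b k0 r0) + y0 * int (b k1 r0) = int (c r0) + 1"
    "x1 * int (b k1 r0) + y1 * int (b k2 r0) = int (c r0)"
    "x2 * int (b k2 r0) + y2 * int (b k3 r0) = int (c r0)"
    "x3 * int (b k3 r0) + y3 * int (b k0 r0) = int (c r0)"
    using F[of r0] dist by (simp_all add: delta_def)
  note c0 = cyclic_system[OF sums(1,2,3,4) p(2,3,4) D ss s(1) f0]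
  have f1: "x1 * int (b k1 r1) + y1 * int (b k2 r1) = int (c r1) + 1"
    "x2 * int (b k2 r1) + y2 * int (b k3 r1) = int (c r1)"
    "x3 * int (b k3 r1) + y3 * int (b k0 r1) = int (c r1)"
    "x0 * int (b k0 r1) + y0 * int (b k1 r1) = int (c r1)"
    using F[of r1] dist by (simp_all add: delta_def)
  note c1 = cyclic_system[OF sums(2,3,4,1) p(3,4,1) D ss s'(1) f1]
  have f2: "x2 * int (b k2 r2) + y2 * int (b k3 r2) = int (c r2) + 1"
    "x3 * int (b k3 r2) + y3 * int (b k0 r2) = int (c r2)"
    "x0 * int (b k0 r2) + y0 * int (b k1 r2) = int (c r2)"
    "x1 * int (b k1 r2) + y1 * int (b k2 r2) = int (c r2)"
    using F[of r2] dist by (simp_all add: delta_def)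
  note c2 = cyclic_system[OF sums(3,4,1,2) p(4,1,2) D ss s'(2) f2]
  have f3: "x3 * int (b k3 r3) + y3 * int (b k0 r3) = int (c r3) + 1"
    "x0 * int (b k0 r3) + y0 * int (b k1 r3) = int (c r3)"
    "x1 * int (b k1 r3) + y1 * int (b k2 r3) = int (c r3)"
    "x2 * int (b k2 r3) + y2 * int (b k3 r3) = int (c r3)"
    using F[of r3] dist by (simp_all add: delta_def)
  note c3 = cyclic_system[OF sums(4,1,2,3) p(1,2,3) D ss s'(3) f3]
  note zero = facet_normal_zero[OF cols]
  have y_eq: "y0 = D - x0" "y1 = D - x1" "y2 = D - x2" "y3 = D - x3" using sums by auto
  have e_sum: "int e = int (b k0 r0) + int (b k0 r1) + int (b k0 r2) + int (b k0 r3)"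
    using row_b[of k0] unfolding sum_labels[OF rows] by simp
  have nn: "0 \<le> x * (y - z)" if "x \<ge> 1" "z \<le> y" for x y z :: int using that by simp
  have bound: "int e \<le> D * D - x0 * m - y0 * n \<Longrightarrow> m \<ge> 1 \<Longrightarrow> n \<ge> 1 \<Longrightarrow> int e \<le> D * D - D" for m n
  proof -
    assume *: "int e \<le> D * D - x0 * m - y0 * n" "m \<ge> 1" "n \<ge> 1"
    have "x0 * 1 \<le> x0 * m" "y0 * 1 \<le> y0 * n" using * pos by (intro mult_left_mono; simp)+
    then show ?thesis using *(1) sums(1) by simp
  qed
  have "int e \<le> D * D - D"
  proof (cases "s = 1")
    case True
    \<comment> \<open>Otherwise \<open>x0 \<le> y3\<close> and \<open>x2 \<le> y1\<close>, and the determinant could not be positive.\<close>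
    have Q2: "y1 \<le> x2"
    proof (rule ccontr)
      assume "\<not> y1 \<le> x2"
      then have "x2 \<le> y1" "x1 \<le> y2" using sums by auto
      then have "x0 * x1 * x2 * x3 \<le> y3 * y2 * y1 * y0"
        using turn' pos by (intro prod4_mono) auto
      then show False using s(1) True D by (simp add: ac_simps)
    qed
    then have Q2': "y2 \<le> x1" using sums by auto
    have 0: "int (b k0 r0) = x1 * x2"
    proof -
      have "int (b k1 r0) = int (b k3 r0) + y3 * (x1 - y2)"
        using c0 True by (simp add: algebra_simps)
      moreover have "0 \<le> y3 * (x1 - y2)" "0 < x1 * x2" "0 < x1 * y3" using nn pos Q2' by auto
      ultimately show ?thesis using zero[of r0] c0 True by (simp add: algebra_simps) linarith
    qed
    have 2: "int (b k0 r2) \<le> y0 * y1"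
    proof -
      have "x3 * y1 \<le> y0 * y1" using turn' pos by (intro mult_right_mono) auto
      moreover have "0 < x3 * x0" "0 < y0 * y1" using pos by auto
      ultimately show ?thesis using zero[of r2] c2 True by (simp add: algebra_simps) linarith
    qed
    have 3: "int (b k0 r3) \<le> y2 * (x0 - y1)"
    proof -
      have "int (b k0 r3) = int (b k2 r3) + y2 * (x0 - y1)" using c3 True by (simp add: algebra_simps)
      moreover have "0 \<le> y2 * (x0 - y1)" "0 < x0 * x1" "0 < x0 * y2" using nn pos turn' by auto
      ultimately show ?thesis using zero[of r3] c3 True by (simp add: algebra_simps) linarith
    qed
    have k2: "int (b k2 r1) = int (b k0 r1) + y0 * (x2 - y3)" using c1 True by (simp add: algebra_simps)
    have prod: "0 < x2 * x3" "0 < x2 * y0" using pos by auto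
    show ?thesis
    proof (cases "y3 \<le> x2")
      case Q3: True
      have "0 \<le> y0 * (x2 - y3)" using nn pos Q3 by auto
      then have "int (b k0 r1) = 0" using zero[of r1] k2 c1 True prod by (simp add: algebra_simps) linarith
      then have "int e \<le> x1 * x2 + y0 * y1 + y2 * (x0 - y1)" using e_sum 0 2 3 by simp
      also have "\<dots> = D * D - x0 * y1 - y0 * y2" unfolding y_eq by (simp add: algebra_simps)
      finally show ?thesis using pos by (intro bound)
    next
      case False
      then have "0 \<le> y0 * (y3 - x2)" using nn pos by auto
      then have "int (b k0 r1) \<le> y0 * (y3 - x2)"
        using zero[of r1] k2 c1 True prod by (simp add: algebra_simps) linarith
      then have "int e \<le> x1 * x2 + y0 * (y3 - x2) + y0 * y1 + y2 * (x0 - y1)" using e_sum 0 2 3 by simp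
      also have "\<dots> = D * D - x0 * y1 - y0 * x3" unfolding y_eq by (simp add: algebra_simps)
      finally show ?thesis using pos by (intro bound)
    qed
  next
    case False
    then have sm: "s = -1" using s(2) by auto
    \<comment> \<open>Otherwise \<open>y0 \<le> x1\<close> and \<open>y2 \<le> x3\<close>, and the determinant could not be negative.\<close>
    have P3: "x2 \<le> y3"
    proof (rule ccontr)
      assume "\<not> x2 \<le> y3"
      then have "y3 \<le> x2" "y2 \<le> x3" using sums by auto
      then have "y0 * y1 * y2 * y3 \<le> x1 * x0 * x3 * x2"
        using turn' pos by (intro prod4_mono) auto
      then show False using s(1) sm D by (simp add: ac_simps)
    qed
    have 0: "int (b k0 r0) \<le> x1 * (y3 - x2)"
    proof -
      have "int (b k0 r0) = int (b k2 r0) + x1 * (y3 - x2)" using c0 sm by (simp add: algebra_simps)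
      moreover have "0 \<le> x1 * (y3 - x2)" "0 < x1 * x2" "0 < y2 * y3" "0 < x1 * y3" using nn pos P3 by auto
      ultimately show ?thesis using zero[of r0] c0 sm by (simp add: algebra_simps) linarith
    qed
    have 1: "int (b k0 r1) \<le> x2 * y0"
    proof -
      have "x2 * x3 \<le> x2 * y0" using turn' pos by (intro mult_left_mono) auto
      moreover have "0 < x2 * y0" "0 < y3 * y0" using pos by auto
      ultimately show ?thesis using zero[of r1] c1 sm by (simp add: algebra_simps) linarith
    qed
    have 2: "int (b k0 r2) \<le> x3 * (x0 - y1)"
    proof -
      have "int (b k0 r2) = int (b k2 r2) + x3 * (x0 - y1)" using c2 sm by (simp add: algebra_simps)
      moreover have "0 \<le> x3 * (x0 - y1)" "0 < x3 * x0" "0 < y0 * y1" "0 < x3 * y1" using nn pos turn' by auto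
      ultimately show ?thesis using zero[of r2] c2 sm by (simp add: algebra_simps) linarith
    qed
    have k3: "int (b k3 r3) = int (b k1 r3) + x0 * (y2 - x1)" using c3 sm by (simp add: algebra_simps)
    have prod: "0 < y1 * y2" "0 < x0 * y2" "0 < x0 * x1" using pos by auto
    show ?thesis
    proof (cases "x1 \<le> y2")
      case P2: True
      have "0 \<le> x0 * (y2 - x1)" using nn pos P2 by auto
      then have "int (b k0 r3) \<le> y1 * y2" using zero[of r3] k3 c3 sm prod by (simp add: algebra_simps) linarith
      then have "int e \<le> x1 * (y3 - x2) + x2 * y0 + x3 * (x0 - y1) + y1 * y2" using e_sum 0 1 2 by simp
      also have "\<dots> = D * D - x0 * x2 - y0 * x3" unfolding y_eq by (simp add: algebra_simps)
      finally show ?thesis using pos by (intro bound)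
    next
      case False
      then have "0 \<le> x0 * (x1 - y2)" using nn pos by auto
      then have "int (b k0 r3) \<le> y1 * y2 + x0 * (x1 - y2)"
        using zero[of r3] k3 c3 sm prod by (simp add: algebra_simps) linarith
      then have "int e \<le> x1 * (y3 - x2) + x2 * y0 + x3 * (x0 - y1) + y1 * y2 + x0 * (x1 - y2)"
        using e_sum 0 1 2 by simp
      also have "\<dots> = D * D - x0 * y1 - y0 * x3" unfolding y_eq by (simp add: algebra_simps)
      finally show ?thesis using pos by (intro bound)
    qed
  qed
  also have "D * D - D = int (d * (d - 1))" using d_pos by (simp add: D_def algebra_simps of_nat_diff)
  finally have "e \<le> d * (d - 1)" by (simp only: of_nat_le_iff)
  moreover have "d \<le> defect a"
  proof -
    have rows_cases: "r' = r0 \<or> r' = r1 \<or> r' = r2 \<or> r' = r3" for r' using four_labels[OF rows] by auto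
    have "a r0 k0 \<le> mu a k2 k0"
    proof (rule mu_ge)
      fix r' assume "a r' k2 = 0"
      then show "a r0 k0 \<le> a r' k0" using rows_cases[of r'] nz turn by auto
    qed
    moreover have "a r0 k1 \<le> mu a k3 k1"
    proof (rule mu_ge)
      fix r' assume "a r' k3 = 0"
      then show "a r0 k1 \<le> a r' k1" using rows_cases[of r'] nz turn by auto
    qed
    ultimately have "a r0 k0 \<le> excess a k2 k0 + 1" "a r0 k1 \<le> excess a k3 k1 + 1"
      by (auto simp: excess_def)
    moreover have "disj a k0 k2 = 1" "disj a k1 k3 = 1"
    proof -
      have "\<not> (a r' k0 = 0 \<and> a r' k2 = 0)" "\<not> (a r' k1 = 0 \<and> a r' k3 = 0)" for r'
        using rows_cases[of r'] nz by auto
      then show "disj a k0 k2 = 1" "disj a k1 k3 = 1" by (auto simp: disj_def)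
    qed
    moreover have "a r0 k0 + a r0 k1 = d" using row_sum_labels[OF cols, of r0] z by simp
    ultimately show ?thesis unfolding defect_labels[OF cols] by linarith
  qed
  ultimately show ?thesis by simp
qed

text \<open>Compare each entry \<open>a r\<^sub>n k\<^sub>n\<close> with the other nonzero entry \<open>a r\<^sub>n\<^sub>-\<^sub>1 k\<^sub>n\<close> of its column. If the same
  side were strictly larger in all four columns, the two products in the determinant would be too far apart.
  So somewhere around the cycle the comparison changes, and there the previous lemma applies.\<close>

lemma eight_cycle:
  assumes rows: "distinct [r0, r1, r2, r3]" and cols: "distinct [k0, k1, k2, k3]"
    and nz: "a r0 k0 > 0" "a r0 k1 > 0" "a r1 k1 > 0" "a r1 k2 > 0" "a r2 k2 > 0" "a r2 k3 > 0" "a r3 k3 > 0" "a r3 k0 > 0"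
    and z: "a r0 k2 = 0" "a r0 k3 = 0" "a r1 k3 = 0" "a r1 k0 = 0" "a r2 k0 = 0" "a r2 k1 = 0" "a r3 k1 = 0" "a r3 k2 = 0"
  shows "d \<le> defect a \<and> e \<le> d * (d - 1)"
proof -
  have sums: "int (a r0 k0) + int (a r0 k1) = int d" "int (a r1 k1) + int (a r1 k2) = int d"
      "int (a r2 k2) + int (a r2 k3) = int d" "int (a r3 k3) + int (a r3 k0) = int d"
    using row_sum_labels[OF cols, of r0] row_sum_labels[OF cols, of r1]
      row_sum_labels[OF cols, of r2] row_sum_labels[OF cols, of r3] z by auto
  have sums': "int (a r0 k1) + int (a r0 k0) = int d" "int (a r1 k2) + int (a r1 k1) = int d"
      "int (a r2 k3) + int (a r2 k2) = int d" "int (a r3 k0) + int (a r3 k3) = int d"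
    using sums by auto
  have pos: "int (a r0 k0) > 0" "int (a r0 k1) > 0" "int (a r1 k1) > 0" "int (a r1 k2) > 0"
      "int (a r2 k2) > 0" "int (a r2 k3) > 0" "int (a r3 k3) > 0" "int (a r3 k0) > 0" "int d > 0"
    using nz d_pos by simp_all
  have det: "\<bar>int (a r0 k0) * int (a r1 k1) * int (a r2 k2) * int (a r3 k3)
      - int (a r0 k1) * int (a r1 k2) * int (a r2 k3) * int (a r3 k0)\<bar> = int d"
    using det_labels[OF rows cols] by (simp add: det4_def z ac_simps)
  have up: "a r1 k1 \<ge> a r0 k1 \<or> a r3 k3 \<ge> a r2 k3"
    using cyclic_products_far_apart[OF sums pos(1,3,6,8,9)] det by force
  have down: "a r1 k1 \<le> a r0 k1 \<or> a r3 k3 \<le> a r2 k3"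
    using cyclic_products_far_apart[OF sums' pos(2,4,5,7,9)] det sums by force
  have rot: "distinct [r1, r2, r3, r0]" "distinct [k1, k2, k3, k0]" "distinct [r2, r3, r0, r1]"
    "distinct [k2, k3, k0, k1]" "distinct [r3, r0, r1, r2]" "distinct [k3, k0, k1, k2]"
    using rows cols by auto
  consider "a r0 k0 \<le> a r3 k0" "a r0 k1 \<le> a r1 k1" | "a r1 k1 \<le> a r0 k1" "a r1 k2 \<le> a r2 k2"
    | "a r2 k2 \<le> a r1 k2" "a r2 k3 \<le> a r3 k3" | "a r3 k3 \<le> a r2 k3" "a r3 k0 \<le> a r0 k0"
    using up down by linarith
  then show ?thesis
  proof cases
    case 1
    then show ?thesis by (rule eight_cycle_turn[OF rows cols nz z])
  next
    case 2
    then show ?thesis by (rule eight_cycle_turn[OF rot(1,2) nz(3-8,1,2) z(3-8,1,2)])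
  next
    case 3
    then show ?thesis by (rule eight_cycle_turn[OF rot(3,4) nz(5-8,1-4) z(5-8,1-4)])
  next
    case 4
    then show ?thesis by (rule eight_cycle_turn[OF rot(5,6) nz(7,8,1-6) z(7,8,1-6)])
  qed
qed

end

section \<open>Classification of the zero patterns\<close>

lemma two_of_card_2:
  assumes "card S = 2" "x \<in> S"
  obtains y where "y \<noteq> x" "S = {x, y}"
  using assms by (metis card_2_iff doubleton_eq_iff insert_iff singletonD)

lemma other_labels:
  assumes "p \<noteq> (q :: 4)"
  obtains r s where "distinct [p, q, r, s]"
proof -
  have "card (UNIV - {p, q}) = 2" using assms by (subst card_Diff_subset) auto
  then obtain r s where "UNIV - {p, q} = {r, s}" "r \<noteq> s" by (auto simp: card_2_iff)
  then show thesis using assms by (intro that[of r s]) auto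
qed

lemma last_label:
  assumes "distinct [p, q, r :: 4]"
  obtains s where "distinct [p, q, r, s]"
proof -
  have "card (UNIV - {p, q, r}) = 1" using assms by (subst card_Diff_subset) auto
  then obtain s where "UNIV - {p, q, r} = {s}" by (auto simp: card_1_singleton_iff)
  then show thesis using assms by (intro that[of s]) auto
qed

context inverse_pair
begin

lemma pure_value:
  assumes "distinct [i, x, y, z]" "a p x = 0" "a p y = 0" "a p z = 0"
  shows "a p i = d" "k \<noteq> i \<Longrightarrow> a p k = 0"
  using row_sum_labels[OF assms(1), of p] four_labels[OF assms(1)] assms(2-) by auto

text \<open>Let \<open>p\<close> be the pure power of variable \<open>i0\<close>. Column \<open>i0\<close> has exactly one more nonzero entry, in a row
  \<open>s\<close>, which also has a nonzero entry in some column \<open>x\<close>. At most one further row is nonzero at \<open>x\<close>, so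
  another row \<open>q\<close> has support exactly \<open>{y, z}\<close>. The support of the last row \<open>v\<close> decides between
  the four preceding configurations.\<close>

lemma with_pure_row:
  assumes d: "d \<ge> 2" and cols: "distinct [i0, j1, j2, j3]" and pure: "a p j1 = 0" "a p j2 = 0" "a p j3 = 0"
    and two: "\<And>t u v w. distinct [u, v, w] \<Longrightarrow> a u t = 0 \<or> a v t = 0 \<or> a w t = 0"
  shows "equal_up_to_permutation a (phi3 d) \<or> d \<le> defect a \<and> e \<le> d * (d - 1)"
proof -
  note p = pure_value[OF cols pure]
  have not_pure: False if "u \<noteq> p" "distinct [k0, k1, k2, k3]" "a u k1 = 0" "a u k2 = 0" "a u k3 = 0" for u k0 k1 k2 k3
    using pure_row_unique[OF p(1) pure_value(1)[OF that(2-5)] d p(2)] pure_value(2)[OF that(2-5)] that(1) by blast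
  have "\<exists>s. s \<noteq> p \<and> a s i0 > 0"
  proof (rule ccontr)
    assume "\<nexists>s. s \<noteq> p \<and> a s i0 > 0"
    then have "a p i0 = 1" by (intro unit_entry) auto
    then show False using p d by simp
  qed
  then obtain s where s: "s \<noteq> p" "a s i0 > 0" by blast
  have "\<exists>x. x \<noteq> i0 \<and> a s x > 0"
  proof (rule ccontr)
    assume none: "\<nexists>x. x \<noteq> i0 \<and> a s x > 0"
    have zero: "a s k = 0" if "k \<noteq> i0" for k
    proof (rule ccontr)
      assume "a s k \<noteq> 0"
      then have "k \<noteq> i0 \<and> a s k > 0" using that by simp
      then show False using none by (simp only: not_ex)
    qed
    have "j1 \<noteq> i0" "j2 \<noteq> i0" "j3 \<noteq> i0" using cols by auto
    then show False by (intro not_pure[OF s(1) cols] zero)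
  qed
  then obtain x where x: "x \<noteq> i0" "a s x > 0" by blast
  obtain y z where xyz: "distinct [i0, x, y, z]" by (rule other_labels[OF x(1)[symmetric]])
  obtain u v where uv: "distinct [p, s, u, v]" by (rule other_labels[OF s(1)[symmetric]])
  have px: "a p x = 0" "a p y = 0" "a p z = 0" using p(2) xyz by auto
  have core: ?thesis if rows: "distinct [p, s, v, q]" and qx: "a q x = 0" for q v
  proof -
    have i0: "a q i0 = 0" "a v i0 = 0"
      using two[of p s q i0] two[of p s v i0] rows s p(1) d by auto
    have ne: "q \<noteq> p" "v \<noteq> p" using rows by auto
    have xyz': "distinct [y, i0, x, z]" "distinct [z, i0, x, y]" "distinct [i0, x, z, y]" "distinct [x, i0, y, z]"
      using xyz by auto
    have q: "a q y > 0" "a q z > 0"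
      using not_pure[OF ne(1) xyz'(1) i0(1) qx] not_pure[OF ne(1) xyz'(2) i0(1) qx] by blast+
    have sv: "a s t = 0 \<or> a v t = 0" if "a q t > 0" for t
      using two[of s v q t] rows that by auto
    show ?thesis
    proof (cases "a v x = 0")
      case True
      have "a v y > 0" "a v z > 0"
        using not_pure[OF ne(2) xyz'(1) i0(2) True] not_pure[OF ne(2) xyz'(2) i0(2) True] by blast+
      then have "a s y = 0" "a s z = 0" using sv[of y] sv[of z] q by simp_all
      then have False using pure_two_proportional[OF rows xyz d px _ _ i0(2) True i0(1) qx] by blast
      then show ?thesis ..
    next
      case False
      then have vx: "a v x > 0" by simp
      consider "a v y > 0" "a v z > 0" | "a v y > 0" "a v z = 0" | "a v y = 0" "a v z > 0"
        using not_pure[OF ne(2) xyz'(4) i0(2)] by blast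
      then show ?thesis
      proof cases
        case 1
        then have "a s y = 0" "a s z = 0" using sv[of y] sv[of z] q by simp_all
        then show ?thesis
          using pure_full_row[OF rows xyz d px x(2) _ _ i0(2) vx 1 i0(1) qx q] by blast
      next
        case 2
        then have sy: "a s y = 0" using sv[of y] sv[of z] q by simp_all
        show ?thesis
        proof (cases "a s z = 0")
          case True
          then show ?thesis
            using pure_chain[OF rows xyz px x(2) sy True i0(2) 2 i0(1) qx q(2)] by blast
        next
          case False
          then have "a s z > 0" by simp
          then show ?thesis
            using pure_cycle_contradiction[OF rows xyz px x(2) sy _ i0(2) vx 2 i0(1) qx q] by blast
        qed
      next
        case 3
        then have sz: "a s z = 0" using sv[of y] sv[of z] q by simp_all
        show ?thesis
        proof (cases "a s y = 0")
          case True
          then show ?thesis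
            using pure_chain[OF rows xyz'(3) px(1,3,2) x(2) sz True i0(2) 3(2,1) i0(1) qx q(1)] by blast
        next
          case False
          then have "a s y > 0" by simp
          then show ?thesis
            using pure_cycle_contradiction[OF rows xyz'(3) px(1,3,2) x(2) sz _ i0(2) vx 3(2,1) i0(1) qx q(2,1)] by blast
        qed
      qed
    qed
  qed
  have "a u x = 0 \<or> a v x = 0" using two[of s u v x] uv x by auto
  moreover have "distinct [p, s, v, u]" using uv by auto
  ultimately show ?thesis using core[of v u] core[of u v] uv by blast
qed

text \<open>Counting nonzero entries by rows and by columns gives exactly two in each row and each column. Such a
  pattern is a union of cycles: a cycle of length four leaves a second one and gives two blocks, the remaining case
  is a cycle of length eight.\<close>

lemma without_pure_row:
  assumes d: "d \<ge> 2"
    and np: "\<And>u k1 k2 k3. distinct [k1, k2, k3] \<Longrightarrow> \<not> (a u k1 = 0 \<and> a u k2 = 0 \<and> a u k3 = 0)"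
    and two: "\<And>t u v w. distinct [u, v, w] \<Longrightarrow> a u t = 0 \<or> a v t = 0 \<or> a w t = 0"
  shows "d \<le> defect a \<and> e \<le> d * (d - 1)"
proof -
  define S where "S r = {j. a r j \<noteq> 0}" for r
  define N where "N j = {r. a r j \<noteq> 0}" for j
  have S2: "2 \<le> card (S r)" for r
  proof (rule ccontr)
    assume "\<not> 2 \<le> card (S r)"
    then have "3 \<le> card (UNIV - S r)" by (subst card_Diff_subset) auto
    then obtain T where "T \<subseteq> UNIV - S r" "card T = 3" by (meson obtain_subset_with_card_n)
    then obtain k1 k2 k3 where "distinct [k1, k2, k3]" "{k1, k2, k3} \<subseteq> UNIV - S r"
      by (auto simp: card_3_iff)
    then show False using np[of k1 k2 k3 r] by (auto simp: S_def)
  qed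
  have N2: "card (N j) \<le> 2" for j
  proof (rule ccontr)
    assume "\<not> card (N j) \<le> 2"
    then have "3 \<le> card (N j)" by simp
    then obtain T where "T \<subseteq> N j" "card T = 3" by (meson obtain_subset_with_card_n)
    then obtain u v w where "distinct [u, v, w]" "{u, v, w} \<subseteq> N j"
      by (auto simp: card_3_iff)
    then show False using two[of u v w j] by (auto simp: N_def)
  qed
  have "(\<Sum>r\<in>UNIV. card (S r)) = (\<Sum>j\<in>UNIV. card (N j))"
  proof -
    have count: "card {u. P u} = (\<Sum>u\<in>UNIV. if P u then 1 else 0)" for P :: "4 \<Rightarrow> bool"
      using sum.inter_filter[of UNIV "\<lambda>_. 1 :: nat" P] by simp
    show ?thesis unfolding S_def N_def count by (rule sum.swap)
  qed
  moreover have lab: "distinct [0, 1, 2, 3 :: 4]" by simp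
  ultimately have total: "card (S 0) + card (S 1) + card (S 2) + card (S 3)
      = card (N 0) + card (N 1) + card (N 2) + card (N 3)"
    by (simp only: sum_labels)
  have S_card: "card (S r) = 2" and N_card: "card (N j) = 2" for r j
  proof -
    have "card (S 0) = 2 \<and> card (S 1) = 2 \<and> card (S 2) = 2 \<and> card (S 3) = 2 \<and>
        card (N 0) = 2 \<and> card (N 1) = 2 \<and> card (N 2) = 2 \<and> card (N 3) = 2"
      using total S2[of 0] S2[of 1] S2[of 2] S2[of 3] N2[of 0] N2[of 1] N2[of 2] N2[of 3] by linarith
    moreover have "r \<in> {0, 1, 2, 3}" "j \<in> {0, 1, 2, 3}" using four_labels[OF lab] by auto
    ultimately show "card (S r) = 2" "card (N j) = 2" by auto
  qed
  have mem: "j \<in> S r \<longleftrightarrow> r \<in> N j" for r j by (simp add: S_def N_def)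
  have S_eq: "a r j > 0 \<longleftrightarrow> j \<in> S r" "a r j = 0 \<longleftrightarrow> j \<notin> S r" for r j by (auto simp: S_def)
  obtain r0 :: 4 where "r0 = 0" by simp
  obtain c0 c1 where S0: "S r0 = {c0, c1}" "c0 \<noteq> c1" using S_card[of r0] by (auto simp: card_2_iff)
  have "r0 \<in> N c1" using S0 mem by auto
  then obtain r1 where N1: "r1 \<noteq> r0" "N c1 = {r0, r1}" by (rule two_of_card_2[OF N_card])
  have "c1 \<in> S r1" using N1 mem by auto
  then obtain c2 where S1: "c2 \<noteq> c1" "S r1 = {c1, c2}" by (rule two_of_card_2[OF S_card])
  show ?thesis
  proof (cases "c2 = c0")
    case True
    obtain r2 r3 where rows: "distinct [r0, r1, r2, r3]" by (rule other_labels[OF N1(1)[symmetric]])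
    obtain k l where cols: "distinct [c0, c1, k, l]" by (rule other_labels[OF S0(2)])
    have "{r0, r1} \<subseteq> N c0" using S0 S1 True mem by auto
    then have N0: "N c0 = {r0, r1}" using N_card[of c0] N1(1) by (intro card_subset_eq[symmetric]) auto
    have "a r2 c0 = 0" "a r2 c1 = 0" "a r3 c0 = 0" "a r3 c1 = 0"
      using N0 N1(2) rows by (auto simp: N_def)
    moreover have "a r0 k = 0" "a r0 l = 0" "a r1 k = 0" "a r1 l = 0"
      using S0 S1 True cols by (auto simp: S_def)
    ultimately show ?thesis using two_blocks[OF rows cols d] by blast
  next
    case False
    have "r1 \<in> N c2" using S1 mem by auto
    then obtain r2 where N2': "r2 \<noteq> r1" "N c2 = {r1, r2}" by (rule two_of_card_2[OF N_card])
    have "c2 \<notin> S r0" using S0 S1 False by auto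
    then have r2: "r2 \<noteq> r0" using N2' mem by auto
    have "c2 \<in> S r2" using N2' mem by auto
    then obtain c3 where S2': "c3 \<noteq> c2" "S r2 = {c2, c3}" by (rule two_of_card_2[OF S_card])
    have c31: "c3 \<noteq> c1" using S2' N1 N2' r2 mem by auto
    have "distinct [r0, r1, r2]" using N1(1) N2'(1) r2 by auto
    then obtain r3 where rows: "distinct [r0, r1, r2, r3]" by (rule last_label)
    have r3: "c1 \<notin> S r3" "c2 \<notin> S r3" using N1 N2' rows mem by auto
    have c30: "c3 \<noteq> c0"
    proof
      assume "c3 = c0"
      then have "{r0, r2} \<subseteq> N c0" using S0 S2' mem by auto
      then have "N c0 = {r0, r2}" using N_card[of c0] r2 by (intro card_subset_eq[symmetric]) auto
      then have "c0 \<notin> S r3" using rows mem by auto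
      then show False using np[of c0 c1 c2 r3] r3 S0(2) S1(1) False by (auto simp: S_eq)
    qed
    have cols: "distinct [c0, c1, c2, c3]" using S0(2) S1(1) S2'(1) False c31 c30 by auto
    have "c3 \<in> S r3" 
    proof -
      have "r2 \<in> N c3" using S2' mem by auto
      then obtain r where r: "r \<noteq> r2" "N c3 = {r2, r}" by (rule two_of_card_2[OF N_card])
      then have "c3 \<in> S r" using mem by auto
      then have "r \<noteq> r0" "r \<noteq> r1" using S0 S1 cols by auto
      then have "r = r3" using four_labels[OF rows] r(1) by auto
      then show ?thesis using \<open>c3 \<in> S r\<close> by simp
    qed
    moreover have "c0 \<in> S r3"
    proof -
      obtain k where k: "k \<noteq> c3" "S r3 = {c3, k}" by (rule two_of_card_2[OF S_card \<open>c3 \<in> S r3\<close>])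
      then have "k \<in> S r3" by simp
      then have "k \<noteq> c1" "k \<noteq> c2" using r3 by auto
      then have "k = c0" using four_labels[OF cols] k(1) by auto
      then show ?thesis using \<open>k \<in> S r3\<close> by simp
    qed
    ultimately show ?thesis
      using S0(1) S1(2) S2'(2) r3 cols by (intro eight_cycle[OF rows cols]) (auto simp: S_eq)
  qed
qed

text \<open>A column with a single zero is covered by the bounds above. Otherwise every column has at most two nonzero
  entries, and few patterns remain.\<close>

theorem dichotomy:
  assumes d: "d \<ge> 2"
  shows "equal_up_to_permutation a (phi3 d) \<or> d \<le> defect a \<and> e \<le> d * (d - 1)"
proof (cases "\<exists>t. card {r. a r t = 0} = 1")
  case True
  then obtain t r where tr: "{r. a r t = 0} = {r}" by (auto simp: card_1_singleton_iff)
  obtain x :: 4 where "x \<noteq> t" using ex_other by blast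
  then have "t \<noteq> x" by simp
  then obtain y z where cols: "distinct [t, x, y, z]" by (rule other_labels)
  have at: "a r' t = 0 \<longleftrightarrow> r' = r" for r' using tr by auto
  show ?thesis using single_zero_defect[OF cols at] single_zero_degree[OF cols at] by blast
next
  case False
  have two: "a u t = 0 \<or> a v t = 0 \<or> a w t = 0" if dist: "distinct [u, v, w]" for t u v w
  proof (rule ccontr)
    assume *: "\<not> ?thesis"
    obtain s where rows: "distinct [u, v, w, s]" by (rule last_label[OF dist])
    have "r = s" if "a r t = 0" for r
    proof -
      have "r \<in> {u, v, w, s}" using four_labels[OF rows] by auto
      then show ?thesis using * that by auto
    qed
    then have "{r. a r t = 0} = {s}" using zero_a[of t] by auto
    then have "card {r. a r t = 0} = 1" by simp
    then show False using False by blast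
  qed
  show ?thesis
  proof (cases "\<exists>u k1 k2 k3. distinct [k1, k2, k3] \<and> a u k1 = 0 \<and> a u k2 = 0 \<and> a u k3 = 0")
    case True
    then obtain u k1 k2 k3 where k: "distinct [k1, k2, k3]" "a u k1 = 0" "a u k2 = 0" "a u k3 = 0" by blast
    obtain k0 where "distinct [k1, k2, k3, k0]" by (rule last_label[OF k(1)])
    then have "distinct [k0, k1, k2, k3]" by auto
    from with_pure_row[OF d this k(2-4) two] show ?thesis .
  next
    case False
    then show ?thesis using without_pure_row[OF d _ two] by blast
  qed
qed

lemma degree_one:
  assumes "d = 1"
  shows "equal_up_to_permutation a (phi3 d)"
proof -
  have "\<exists>j. \<forall>k. a i k = delta j k" for i
  proof -
    have "(\<Sum>j\<in>UNIV. a i j) \<noteq> 0" using row_a[of i] assms by simp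
    then obtain j where j: "a i j \<noteq> 0" by (meson sum.not_neutral_contains_not_neutral)
    have "(\<Sum>k\<in>UNIV. a i k) = a i j + (\<Sum>k\<in>UNIV - {j}. a i k)" by (rule sum.remove) auto
    then have "a i j = 1" "(\<Sum>k\<in>UNIV - {j}. a i k) = 0" using row_a[of i] assms j by linarith+
    then have "a i k = delta j k" for k by (cases "k = j") (auto simp: delta_def)
    then show ?thesis by blast
  qed
  then obtain f where f: "\<And>i k. a i k = delta (f i) k" by metis
  have "inj f"
  proof (rule injI)
    fix u v assume "f u = f v"
    then have "a u = a v" using f by (auto simp: fun_eq_iff)
    then show "u = v" using rows_distinct by blast
  qed
  then have bij: "bij f" by (simp add: bij_def finite_UNIV_inj_surj)
  have "phi3 d i j = delta i j" for i j by (auto simp: phi3_def delta_def assms)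
  then have "a (id i) (f j) = phi3 d i j" for i j
    using f bij by (simp add: delta_def bij_def inj_eq)
  then show ?thesis unfolding equal_up_to_permutation_def using bij bij_id by metis
qed

text \<open>Solving \<open>a b = delta + c\<close> for the extremal map from top to bottom gives every column of \<open>b\<close> up to a
  constant, which is fixed by the zero in the column.\<close>

lemma phi3_values:
  assumes "equal_up_to_permutation a (phi3 d)"
  shows "defect a + 1 = d" "int e = (int d)\<^sup>2 - int d + 1"
proof -
  from assms obtain f g :: "4 \<Rightarrow> 4" where fg: "bij f" "bij g" "\<And>i j. a (f i) (g j) = phi3 d i j"
    by (auto simp: equal_up_to_permutation_def)
  define r0 r1 r2 r3 k0 k1 k2 k3 where
    "r0 = f 0" "r1 = f 1" "r2 = f 2" "r3 = f 3" "k0 = g 0" "k1 = g 1" "k2 = g 2" "k3 = g 3"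
  note rk = this
  have rows: "distinct [r0, r1, r2, r3]" and cols: "distinct [k0, k1, k2, k3]"
    using fg(1,2) by (simp_all add: rk bij_def inj_eq)
  have A: "a r0 k0 = d" "a r0 k1 = 0" "a r0 k2 = 0" "a r0 k3 = 0"
    "a r1 k0 = d - 1" "a r1 k1 = 1" "a r1 k2 = 0" "a r1 k3 = 0"
    "a r2 k0 = 0" "a r2 k1 = d - 1" "a r2 k2 = 1" "a r2 k3 = 0"
    "a r3 k0 = 0" "a r3 k1 = 0" "a r3 k2 = d - 1" "a r3 k3 = 1"
    by (simp_all add: rk fg(3) phi3_def)
  have rows_cases: "r' = r0 \<or> r' = r1 \<or> r' = r2 \<or> r' = r3" for r' using four_labels[OF rows] by auto
  have ex: "excess a i j = 0" if "a r i = 0" "a r j = 0" for r i j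
    using mu_eq_0[OF that] by (simp add: excess_def)
  have dj: "disj a i j = 0" if "a r i = 0" "a r j = 0" for r i j
    using that by (auto simp: disj_def)
  have m02: "excess a k0 k2 = 0" using mu_le[of r2 k0 k2] A by (simp add: excess_def)
  have m20: "excess a k2 k0 = d - 2"
  proof -
    obtain r where r: "a r k2 = 0" "a r k0 = mu a k2 k0" by (rule mu_attained)
    have "mu a k2 k0 \<le> d - 1" using mu_le[of r1 k2 k0] A by simp
    moreover have "d - 1 \<le> mu a k2 k0" using r rows_cases[of r] A by auto
    ultimately show ?thesis by (simp add: excess_def)
  qed
  have d02: "disj a k0 k2 = (if d = 1 then 0 else 1)"
  proof (cases "d = 1")
    case True
    then show ?thesis using dj[of r1 k0 k2] A by simp
  next
    case False
    then have "\<not> (a r' k0 = 0 \<and> a r' k2 = 0)" for r' using rows_cases[of r'] A d_pos by auto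
    then show ?thesis using False by (auto simp: disj_def)
  qed
  have "defect a = (d - 2) + (if d = 1 then 0 else 1)"
    unfolding defect_labels[OF cols] m02 m20 d02
    using ex[of r2 k0 k0] ex[of r3 k0 k1] ex[of r2 k0 k3] ex[of r3 k1 k0] ex[of r0 k1 k1] ex[of r0 k1 k2] ex[of r0 k1 k3]
      ex[of r0 k2 k1] ex[of r0 k2 k2] ex[of r0 k2 k3] ex[of r2 k3 k0] ex[of r0 k3 k1] ex[of r0 k3 k2] ex[of r0 k3 k3]
      dj[of r3 k0 k1] dj[of r2 k0 k3] dj[of r0 k1 k2] dj[of r0 k1 k3] dj[of r0 k2 k3] A
    by simp
  then show "defect a + 1 = d" using d_pos by (auto split: if_splits)
  define D where "D = int d"
  have D: "D \<ge> 1" using d_pos by (simp add: D_def)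
  have D1: "int (d - 1) = D - 1" "int (d - Suc 0) = D - 1" using d_pos by (simp_all add: D_def)
  have dist: "r0 \<noteq> r1" "r0 \<noteq> r2" "r0 \<noteq> r3" "r1 \<noteq> r2" "r1 \<noteq> r3" "r2 \<noteq> r3" using rows by auto
  have sys: "int (b k1 v) = int (b k0 v) + int (delta r1 v) - int (delta r0 v)"
    "int (b k2 v) = int (b k0 v) + int (delta r2 v) - (D - 1) * int (delta r1 v) + (D - 2) * int (delta r0 v)"
    "int (b k3 v) = int (b k0 v) + int (delta r3 v) - (D - 1) * int (delta r2 v)
       + (D - 1) * (D - 1) * int (delta r1 v) - (1 + (D - 1) * (D - 2)) * int (delta r0 v)" for v
  proof -
    have E: "D * int (b k0 v) = int (c v) + int (delta r0 v)"
      "(D - 1) * int (b k0 v) + int (b k1 v) = int (c v) + int (delta r1 v)"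
      "(D - 1) * int (b k1 v) + int (b k2 v) = int (c v) + int (delta r2 v)"
      "(D - 1) * int (b k2 v) + int (b k3 v) = int (c v) + int (delta r3 v)"
      using facet_normal[OF cols, of r0 v] facet_normal[OF cols, of r1 v] facet_normal[OF cols, of r2 v]
        facet_normal[OF cols, of r3 v]
      by (simp_all add: A D1 D_def[symmetric])
    show 1: "int (b k1 v) = int (b k0 v) + int (delta r1 v) - int (delta r0 v)"
      using E(1,2) by (simp add: algebra_simps)
    show 2: "int (b k2 v) = int (b k0 v) + int (delta r2 v) - (D - 1) * int (delta r1 v) + (D - 2) * int (delta r0 v)"
      using E(1,3) unfolding 1 by (simp add: algebra_simps)
    show "int (b k3 v) = int (b k0 v) + int (delta r3 v) - (D - 1) * int (delta r2 v)
       + (D - 1) * (D - 1) * int (delta r1 v) - (1 + (D - 1) * (D - 2)) * int (delta r0 v)"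
      using E(1,4) unfolding 2 by (simp add: algebra_simps)
  qed
  have nn: "0 \<le> (D - 1) * (D - 2)" "0 \<le> (D - 1) * (D - 1)" using D by (auto simp: zero_le_mult_iff)
  have "int (b k0 r3) = 0"
    using sys[of r3] dist facet_normal_zero[OF cols, of r3] D by (simp add: delta_def)
  moreover have "int (b k0 r2) = D - 1"
    using sys[of r2] dist facet_normal_zero[OF cols, of r2] D by (simp add: delta_def) linarith
  moreover have "int (b k0 r1) = D - 1"
  proof -
    have "int (b k1 r1) = int (b k0 r1) + 1" "int (b k2 r1) = int (b k0 r1) - (D - 1)"
      "int (b k3 r1) = int (b k0 r1) + (D - 1) * (D - 1)"
      using sys[of r1] dist by (simp_all add: delta_def)
    then show ?thesis using facet_normal_zero[OF cols, of r1] D nn(2) by linarith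
  qed
  moreover have "int (b k0 r0) = 1 + (D - 1) * (D - 2)"
    using sys[of r0] dist facet_normal_zero[OF cols, of r0] D nn by (simp add: delta_def) linarith
  moreover have "int e = int (b k0 r0) + int (b k0 r1) + int (b k0 r2) + int (b k0 r3)"
    using row_b[of k0] unfolding sum_labels[OF rows] by simp
  ultimately show "int e = (int d)\<^sup>2 - int d + 1"
    by (simp add: D_def[symmetric] power2_eq_square algebra_simps)
qed

end

theorem theorem3p3:
  fixes a :: "4 \<Rightarrow> 4 \<Rightarrow> nat" and d d' :: nat and f :: poly4 and K L :: int
  assumes "d > 0"
    and "\<forall>i. (\<Sum>j\<in>UNIV. a i j) = d"
    and "no_common_factor (monomial_map a)"
    and "birational (monomial_map a)"
    and "d' = inverse_degree a"
    and "f = (\<Sum>i\<in>UNIV. monomial_map a i)"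
    and "K = (\<Sum>i\<in>UNIV. int (k_num f i))"
    and "L = (\<Sum>(i, j)\<in>{(i, j). i < j}. int (l_num f i j))"
  shows "K - L \<le> 3 * int d + 1
    \<and> int d' \<le> int d ^ 2 - int d + 1
    \<and> (K - L = 3 * int d + 1 \<longleftrightarrow> equal_up_to_permutation a (phi3 d))
    \<and> (int d' = int d ^ 2 - int d + 1 \<longleftrightarrow> equal_up_to_permutation a (phi3 d))"
proof -
  obtain b e c c' where "inverse_pair a b d e c c'"
    using birational_imp_inverse_pair assms(1-4) by blast
  then interpret inverse_pair a b d e c c' .
  have e: "d' = e" using assms(5) inverse_degree_eq by simp
  have KL: "K - L = 4 * int d - int (defect a)"
    using K_minus_L assms(6-8) by (simp add: monomial_map_eq)
  show ?thesis
  proof (cases "equal_up_to_permutation a (phi3 d)")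
    case True
    note val = phi3_values[OF True]
    then have "K - L = 3 * int d + 1" unfolding KL by linarith
    then show ?thesis using True val(2) e by simp
  next
    case False
    then have "d \<noteq> 1" using degree_one by blast
    then have "d \<ge> 2" using d_pos by simp
    then have bounds: "d \<le> defect a" "e \<le> d * (d - 1)" using dichotomy False by blast+
    have "int e \<le> int (d * (d - 1))" using bounds(2) by (simp only: of_nat_le_iff)
    also have "\<dots> = (int d)\<^sup>2 - int d"
      using d_pos by (simp add: power2_eq_square algebra_simps of_nat_diff)
    finally show ?thesis using False bounds(1) KL e by auto
  qed
qed

end
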